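(* Let $\Omega\subset\hat{\mathbb C}$ be a rectifiable domain with $0,\infty\notin\partial\Omega$ and $\Omega=\mathrm{Int}(\overline\Omega)$, let $h$ be rational with $h\in\mathrm{Rat}_0(\Omega)$ if $\Omega$ is bounded and $h\in\mathrm{Rat}(\Omega)$ if $\Omega$ is unbounded, and fix $r\in(0,\operatorname{dist}(0,\partial\Omega))$. (1) If $0\notin\Omega$, then $\Omega\in\mathrm{QD}_0(h)$ if and only if $C^{\Omega}_{\rho_0}(w)=h(w)$ for all $w\in\Omega^*$. (2) If $0\in\Omega$, $\operatorname{Res}_{0}h=0$ and $q\in\mathbb C$, then $\Omega\in\mathrm{QD}_0(h;q)$ if and only if $C^{\Omega\setminus\mathbb D_r}_{\rho_0}(w)+\frac{\ln r^2}{w}=h(w)+\frac{q}{w}$ for all $w\in\Omega^*$.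
   Context: $\hat{\mathbb C}$ is the Riemann sphere; a domain is a connected open subset of $\hat{\mathbb C}$. For $\Omega\subset\hat{\mathbb C}$, $\overline{\Omega}$ is its closure and $\Omega^*:=\hat{\mathbb C}\setminus\overline{\Omega}$. $\mathbb D_r=\{|w|<r\}$. $dA=dx\,dy/\pi$ is normalized area measure; integrals over unbounded sets are principal values $\lim_{R\to\infty}\int_{\cdot\,\cap\mathbb D_R}$. Contour integrals are normalized: $\oint_{\partial\Omega}$ means $\frac{1}{2\pi i}\int_{\partial\Omega}$ with $\partial\Omega$ positively oriented with respect to $\Omega$. $A(\Omega)$ denotes functions analytic in $\Omega$ and continuous on $\overline\Omega$ (in $\hat{\mathbb C}$); $\mathrm{Rat}(\Omega)$ denotes rational functions all of whose poles lie in $\Omega$, and $\mathrm{Rat}_0(\Omega)$ those vanishing at $\infty$. Let $\rho_0(w)=|w|^{-2}$ and $L^1_a(\Omega;\rho_0)=\{f\in A(\Omega):\int_\Omega|f|\rho_0\,dA<\infty\}$. A rectifiable domain $\Omega\subset\hat{\mathbb C}$ with $0,\infty\notin\partial\Omega$ and $\Omega=\mathrm{Int}(\overline\Omega)$ is a log-weighted quadrature domain (LQD) with quadrature function $h$, written $\Omega\in\mathrm{QD}_0(h)$, if $h\in\mathrm{Rat}_0(\Omega)$ when $\Omega$ is bounded, $h\in\mathrm{Rat}(\Omega)$ when $\Omega$ is unbounded, and $\int_\Omega f(w)|w|^{-2}dA(w)=\oint_{\partial\Omega}f(w)h(w)\,dw$ for all $f\in L^1_a(\Omega;\rho_0)$.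 Weighted Cauchy transform: for $U\subset\mathbb C$, $C^U_{\rho_0}(w)=\int_U\frac{|\xi|^{-2}}{w-\xi}\,dA(\xi)$. For $0\in\Omega$, a rational $h$ with $\operatorname{Res}_0h=0$ and $q\in\mathbb C$, one writes $\Omega\in\mathrm{QD}_0(h;q)$ if $\Omega\in\mathrm{QD}_0(h)$ and there is $G\in A(\Omega)$ with $\frac{\ln|w|^2}{w}=h(w)+\frac qw+G(w)$ for all $w\in\partial\Omega$. *)

theory Defs
  imports "HOL-Complex_Analysis.Complex_Analysis" "HOL-Computational_Algebra.Polynomial"
begin

text \<open>A subset of the Riemann sphere is represented by its finite part
  \<open>Om :: complex set\<close> together with a flag \<open>hasinf\<close> saying whether \<open>\<infinity>\<close> belongs to it.\<close>

text \<open>Domain with \<open>0, \<infinity> \<notin> \<partial>\<Omega>\<close> and \<open>\<Omega> = Int(closure \<Omega>)\<close>.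
  Since \<open>\<infinity> \<notin> \<partial>\<Omega>\<close>: if \<open>\<infinity> \<in> \<Omega>\<close> the complement of the finite part is bounded,
  otherwise the finite part is bounded.\<close>
definition sphere_domain :: "complex set \<Rightarrow> bool \<Rightarrow> bool" where
  "sphere_domain Om hasinf \<longleftrightarrow> open Om \<and> connected Om \<and> Om \<noteq> {} \<and>
     (if hasinf then bounded (- Om) else bounded Om) \<and>
     0 \<notin> frontier Om \<and> interior (closure Om) = Om"

text \<open>Rectifiability: the (finite part of the) boundary is the union of finitely many
  rectifiable closed curves (Lipschitz parametrisations on [0,1]) which together
  form a cycle positively oriented with respect to \<Omega>.\<close>
definition boundary_cycle :: "complex set \<Rightarrow> bool \<Rightarrow> (real \<Rightarrow> complex) list \<Rightarrow> bool" where
  "boundary_cycle Om hasinf gs \<longleftrightarrow>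
     (\<forall>g\<in>set gs. path g \<and> pathfinish g = pathstart g \<and> (\<exists>C. C-lipschitz_on {0..1} g)) \<and>
     (\<Union>g\<in>set gs. path_image g) = frontier Om \<and>
     (\<forall>z. z \<notin> frontier Om \<longrightarrow>
        (\<Sum>g\<leftarrow>gs. winding_number g z) = (if z \<in> Om then 1 else 0) - (if hasinf then 1 else 0))"

definition bdry_int :: "(real \<Rightarrow> complex) list \<Rightarrow> (complex \<Rightarrow> complex) \<Rightarrow> complex" where
  "bdry_int gs f = (\<Sum>g\<leftarrow>gs. contour_integral g f) / (2 * of_real pi * \<i>)"

definition area_pv :: "complex set \<Rightarrow> (complex \<Rightarrow> complex) \<Rightarrow> complex" where
  "area_pv U g = Lim at_top (\<lambda>R::real. of_real (1 / pi) * set_lebesgue_integral lborel (U \<inter> ball 0 R) g)"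

definition wcauchy :: "complex set \<Rightarrow> complex \<Rightarrow> complex" where
  "wcauchy U w = area_pv U (\<lambda>\<xi>. (1 / of_real ((cmod \<xi>)\<^sup>2)) / (w - \<xi>))"

definition analytic_at_infinity :: "(complex \<Rightarrow> complex) \<Rightarrow> bool" where
  "analytic_at_infinity f \<longleftrightarrow>
     (\<exists>c R. R > 0 \<and> (\<lambda>w. if w = 0 then c else f (1 / w)) holomorphic_on ball 0 R)"

definition A_space :: "complex set \<Rightarrow> bool \<Rightarrow> (complex \<Rightarrow> complex) \<Rightarrow> bool" where
  "A_space Om hasinf f \<longleftrightarrow> f holomorphic_on Om \<and> continuous_on (closure Om) f \<and>
     (hasinf \<longrightarrow> analytic_at_infinity f)"

definition L1a :: "complex set \<Rightarrow> bool \<Rightarrow> (complex \<Rightarrow> complex) \<Rightarrow> bool" where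
  "L1a Om hasinf f \<longleftrightarrow> A_space Om hasinf f \<and>
     set_integrable lborel Om (\<lambda>w. f w / of_real ((cmod w)\<^sup>2))"

text \<open>\<open>Rat(\<Omega>)\<close>: rational functions (in lowest terms p/q) all of whose poles lie in \<Omega>;
  a pole at \<infinity> (deg p > deg q) is allowed only if \<open>\<infinity> \<in> \<Omega>\<close>.\<close>
definition Rat_on :: "complex set \<Rightarrow> bool \<Rightarrow> (complex \<Rightarrow> complex) \<Rightarrow> bool" where
  "Rat_on Om hasinf h \<longleftrightarrow> (\<exists>p q. q \<noteq> 0 \<and> coprime p q \<and> h = (\<lambda>w. poly p w / poly q w) \<and>
     {w. poly q w = 0} \<subseteq> Om \<and> (degree q < degree p \<longrightarrow> hasinf))"

definition Rat0_on :: "complex set \<Rightarrow> bool \<Rightarrow> (complex \<Rightarrow> complex) \<Rightarrow> bool" where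
  "Rat0_on Om hasinf h \<longleftrightarrow> (\<exists>p q. q \<noteq> 0 \<and> coprime p q \<and> h = (\<lambda>w. poly p w / poly q w) \<and>
     {w. poly q w = 0} \<subseteq> Om \<and> (p = 0 \<or> degree p < degree q))"

definition QD0 :: "complex set \<Rightarrow> bool \<Rightarrow> (real \<Rightarrow> complex) list \<Rightarrow> (complex \<Rightarrow> complex) \<Rightarrow> bool" where
  "QD0 Om hasinf gs h \<longleftrightarrow> (if hasinf then Rat_on Om hasinf h else Rat0_on Om hasinf h) \<and>
     (\<forall>f. L1a Om hasinf f \<longrightarrow>
        area_pv Om (\<lambda>w. f w / of_real ((cmod w)\<^sup>2)) = bdry_int gs (\<lambda>w. f w * h w))"

definition QD0q :: "complex set \<Rightarrow> bool \<Rightarrow> (real \<Rightarrow> complex) list \<Rightarrow> (complex \<Rightarrow> complex) \<Rightarrow> complex \<Rightarrow> bool" where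
  "QD0q Om hasinf gs h q \<longleftrightarrow> 0 \<in> Om \<and> residue h 0 = 0 \<and> QD0 Om hasinf gs h \<and>
     (\<exists>G. A_space Om hasinf G \<and>
        (\<forall>w\<in>frontier Om. of_real (ln ((cmod w)\<^sup>2)) / w = h w + q / w + G w))"

end

theory Submission
  imports Defs
begin

text \<open>For \<open>f\<close> in the test space, Cauchy's formula \<open>f(\<xi>) = \<oint> f(w)/(w - \<xi>) dw\<close> (no term at infinity, since
  integrability against \<open>|w|\<^sup>-\<^sup>2\<close> forces \<open>f(\<infinity>) = 0\<close>) and Fubini turn the area integral of \<open>f |w|\<^sup>-\<^sup>2\<close>
  into the boundary integral of \<open>f\<close> against the Cauchy transform, which is continuous up to the boundary;
  conversely the test function \<open>1/(w - \<xi>)\<close> recovers the Cauchy transform at the exterior point \<open>w\<close>.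
  If \<open>0 \<in> \<Omega>\<close>, integrability forces \<open>f(0) = 0\<close>, so a disc around \<open>0\<close> contributes nothing, and the test
  functions have to be the differences \<open>w/(w - \<xi>) - w\<^sub>0/(w\<^sub>0 - \<xi>)\<close>, which leave a multiple of \<open>1/w\<close>
  undetermined. As \<open>ln |w|\<^sup>2 / w\<close> is explicitly the Cauchy transform of the complement of a disc up to a multiple
  of \<open>1/w\<close>, the admissible \<open>G\<close> is the Cauchy transform of the complement of \<open>\<Omega>\<close>, and this fixes \<open>q\<close>.

  Cauchy's theorem for \<open>f\<close> merely continuous on the closure is obtained by mollification: the disc averages
  of \<open>f\<close> at scale \<open>\<epsilon>\<close> have \<open>\<partial>\<close>-bar derivative of size \<open>o(1/\<epsilon>)\<close>, supported in an \<open>\<epsilon>\<close>-collar of the boundary,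
  whose area is \<open>O(\<epsilon>)\<close> because the boundary has finite length.\<close>

text \<open>The boundary curves are merely Lipschitz, whereas \<open>contour_integral\<close> is
  built from the derivative of the parametrisation. Differentiability almost everywhere is what
  opens these integrals to Lebesgue theory and Fubini. Orientation is prescribed by the topological
  \<open>winding_number\<close>, so a logarithm must be lifted along the curve to identify it with
  the integral of \<open>1/(w - z)\<close>. Mollification balances exactly: density
  \<open>\<eta>/e\<close>, with \<eta> the oscillation at scale \<open>e\<close>, times area
  \<open>O(e)\<close>, is \<open>O(\<eta>)\<close>. If 0 lies in the domain, every
  \<open>v/(v - \<xi>)\<close> has the value 1 at \<xi> = 0; hence differences are tested, and a
  constant \<open>c\<close> in \<open>logC V = h + c/w\<close> stays unknown. It is found from
  \<open>G\<close>: the function \<open>F = logC (- Om) - G\<close> is analytic inside, and on the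
  boundary \<open>v * F v\<close> is a constant \<open>k\<close>, the error in \<open>q\<close>.
  Since \<open>\<xi> * F \<xi>\<close> may be unbounded at infinity, it is
  \<open>(\<xi> * F \<xi> - k)/(\<xi> - w)\<close>, with \<open>w\<close> exterior, that enters
  Cauchy's formula. It vanishes on the boundary, hence everywhere, and \<xi> = 0 yields
  \<open>k = 0\<close>.\<close>

section \<open>Lipschitz functions on the line are differentiable almost everywhere\<close>

text \<open>The points \<open>x\<close> for which the intervals satisfying \<open>P\<close> form a Vitali cover at \<open>x\<close>; with open intervals
  this is a \<open>G\<^sub>\<delta>\<close> set for arbitrary \<open>P\<close>.\<close>

definition slope_set :: "(real \<Rightarrow> real \<Rightarrow> bool) \<Rightarrow> real set" where
  "slope_set P = {x. \<forall>d>0. \<exists>a b. a < x \<and> x < b \<and> b - a < d \<and> P a b}"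

lemma slope_set_borel [measurable]: "slope_set P \<in> sets borel"
proof -
  have "slope_set P = (\<Inter>n::nat. \<Union>{{a<..<b} |a b. b - a < 1 / real (Suc n) \<and> P a b})" (is "_ = ?R")
  proof (rule subset_antisym; rule subsetI)
    fix x assume x: "x \<in> slope_set P"
    show "x \<in> ?R"
    proof
      fix n :: nat
      have "0 < 1 / real (Suc n)" by simp
      then obtain a b where "a < x" "x < b" "b - a < 1 / real (Suc n)" "P a b"
        using x unfolding slope_set_def by blast
      then show "x \<in> \<Union>{{a<..<b} |a b. b - a < 1 / real (Suc n) \<and> P a b}"
        by (intro UnionI[of "{a<..<b}"]) auto
    qed
  next
    fix x assume x: "x \<in> ?R"
    show "x \<in> slope_set P" unfolding slope_set_def
    proof (intro CollectI allI impI)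
      fix d :: real assume "d > 0"
      then obtain n where n: "1 / real (Suc n) < d" by (metis nat_approx_posE)
      have "x \<in> \<Union>{{a<..<b} |a b. b - a < 1 / real (Suc n) \<and> P a b}" using x by blast
      then obtain a b where "b - a < 1 / real (Suc n)" "P a b" "a < x" "x < b" by auto
      then show "\<exists>a b. a < x \<and> x < b \<and> b - a < d \<and> P a b"
        using n by (intro exI[of _ a] exI[of _ b]) auto
    qed
  qed
  moreover have "open (\<Union>{{a<..<b} |a b. b - a < 1 / real (Suc n) \<and> P a b})" for n :: nat
    by (intro open_Union) auto
  ultimately show ?thesis by auto
qed

text \<open>Written as balls around their midpoints, the admissible intervals satisfy the hypothesis
  of Vitali's covering theorem. Openness of \<open>U\<close> keeps all sufficiently short intervals
  inside \<open>U\<close>.\<close>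

lemma slope_set_vitali:
  assumes E: "E \<subseteq> slope_set P" "E \<subseteq> U" and U: "open U"
  obtains C where "countable C" "\<And>a b. (a,b) \<in> C \<Longrightarrow> a < b \<and> P a b \<and> {a<..<b} \<subseteq> U"
    "disjoint_family_on (\<lambda>(a,b). {a<..<b}) C" "negligible (E - (\<Union>(a,b)\<in>C. {a<..<b}))"
proof -
  define K where "K = {(a,b). a < b \<and> P a b \<and> {a<..<b} \<subseteq> U}"
  define c where "c = (\<lambda>(a::real,b). (a + b) / 2)"
  define r where "r = (\<lambda>(a::real,b). (b - a) / 2)"
  have ball: "ball (c i) (r i) = (\<lambda>(a,b). {a<..<b}) i" for i
    by (cases i) (auto simp: c_def r_def ball_eq_greaterThanLessThan field_simps)
  have *: "\<exists>i. i \<in> K \<and> x \<in> ball (c i) (r i) \<and> r i < d" if x: "x \<in> E" and d: "0 < d" for x d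
  proof -
    obtain e where e: "e > 0" "ball x e \<subseteq> U" using U E(2) x unfolding open_contains_ball by blast
    have "x \<in> slope_set P" "0 < min d e" using x E d e by auto
    then obtain a b where ab: "a < x" "x < b" "b - a < min d e" "P a b"
      unfolding slope_set_def by blast
    have "{a<..<b} \<subseteq> ball x e" using ab by (auto simp: dist_real_def)
    then have "(a,b) \<in> K" using ab e by (auto simp: K_def)
    moreover have "r (a,b) < d" using ab by (auto simp: r_def)
    moreover have "x \<in> ball (c (a,b)) (r (a,b))" unfolding ball using ab by simp
    ultimately show ?thesis by blast
  qed
  show thesis
  proof (rule Vitali_covering_theorem_balls[where S = E and K = K and a = c and r = r])
    show "\<exists>i. i \<in> K \<and> x \<in> ball (c i) (r i) \<and> r i < d" if "x \<in> E" "0 < d" for x d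
      using * that by blast
    fix C assume C: "countable C" "C \<subseteq> K"
     "pairwise (\<lambda>i j. disjnt (ball (c i) (r i)) (ball (c j) (r j))) C"
     "negligible (E - (\<Union>i\<in>C. ball (c i) (r i)))"
    show thesis
    proof (rule that[OF C(1)])
    show "a < b \<and> P a b \<and> {a<..<b} \<subseteq> U" if "(a,b) \<in> C" for a b
      using that C(2) by (auto simp: K_def)
    show "disjoint_family_on (\<lambda>(a,b). {a<..<b}) C"
      using C(3) unfolding ball disjoint_family_on_def pairwise_def disjnt_def by blast
    show "negligible (E - (\<Union>(a,b)\<in>C. {a<..<b}))"
      using C(4) unfolding ball by (simp add: case_prod_unfold)
    qed
  qed
qed

text \<open>Carries a comparison of two measures from the single intervals of a Vitali family over
  to their disjoint union.\<close>

lemma emeasure_UN_countable_le: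
  assumes "countable C" "disjoint_family_on X C" "\<And>i. i \<in> C \<Longrightarrow> X i \<in> sets M" "sets N = sets M"
    and "\<And>i. i \<in> C \<Longrightarrow> emeasure M (X i) \<le> k * emeasure N (X i)"
  shows "emeasure M (\<Union>i\<in>C. X i) \<le> k * emeasure N (\<Union>i\<in>C. X i)"
proof -
  have "emeasure M (\<Union>i\<in>C. X i) = (\<integral>\<^sup>+i. emeasure M (X i) \<partial>count_space C)"
    using assms by (intro emeasure_UN_countable) auto
  also have "\<dots> \<le> (\<integral>\<^sup>+i. k * emeasure N (X i) \<partial>count_space C)"
    using assms by (intro nn_integral_mono) auto
  also have "\<dots> = k * (\<integral>\<^sup>+i. emeasure N (X i) \<partial>count_space C)"
    by (intro nn_integral_cmult) auto
  also have "(\<integral>\<^sup>+i. emeasure N (X i) \<partial>count_space C) = emeasure N (\<Union>i\<in>C. X i)"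
    using assms by (intro emeasure_UN_countable[symmetric]) auto
  finally show ?thesis .
qed

lemma emeasure_interval_measure_Ioo:
  assumes "a \<le> b" "mono F" "continuous_on UNIV F"
  shows "emeasure (interval_measure F) {a<..<b} = ennreal (F b - F a)"
proof -
  have pt: "emeasure (interval_measure F) {c} = 0" for c
    using emeasure_interval_measure_Icc[of c c F] assms(2,3) by (auto simp: mono_def)
  have n: "{c} \<in> null_sets (interval_measure F)" for c using pt by (auto intro: null_setsI)
  have "{a,b} \<in> null_sets (interval_measure F)"
    using null_sets.Un[OF n n, of a b] by (simp add: insert_commute)
  then have "emeasure (interval_measure F) ({a..b} - {a,b}) = emeasure (interval_measure F) {a..b}"
    by (intro emeasure_Diff_null_set) auto
  moreover have "{a..b} - {a,b} = {a<..<b}" by auto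
  ultimately show ?thesis
    using emeasure_interval_measure_Icc[of a b F] assms by (auto simp: mono_def)
qed

text \<open>The increments of \<open>f\<close> form a Stieltjes measure \<open>\<nu>\<close>.
  Suppose the set \<open>F\<close> has measure \<open>\<mu> > 0\<close>. A Vitali family of slopes
  below \<open>p\<close>, inside an open \<open>U\<close> barely larger than \<open>F\<close>, has
  union \<open>W\<close> with \<open>\<nu> W \<le> p * (\<mu> + e)\<close>. A second family of
  slopes above \<open>q\<close>, chosen inside \<open>W\<close>, still covers almost all of
  \<open>F\<close> and gives \<open>\<nu> W \<ge> q * \<mu>\<close>, a contradiction for small
  \<open>e\<close>.\<close>

lemma mono_slopes_separated_null:
  fixes f :: "real \<Rightarrow> real"
  assumes f: "mono f" "continuous_on UNIV f" and pq: "0 \<le> p" "p < q"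
  defines "E \<equiv> slope_set (\<lambda>a b. f b - f a < p * (b - a)) \<inter> slope_set (\<lambda>a b. f b - f a > q * (b - a))"
  shows "E \<inter> {-N<..<N} \<in> null_sets lborel"
proof (rule ccontr)
  define F where "F = E \<inter> {-N<..<N}"
  assume "E \<inter> {-N<..<N} \<notin> null_sets lborel"
  then have nn: "F \<notin> null_sets lborel" by (simp add: F_def)
  have Fm[measurable]: "F \<in> sets borel" unfolding F_def E_def by measurable
  have "emeasure lborel F \<le> emeasure lborel {-N<..<N}" by (intro emeasure_mono) (auto simp: F_def)
  also have "\<dots> < \<infinity>" by (cases "-N \<le> N") auto
  finally have fin: "emeasure lborel F < \<infinity>" .
  define \<mu> where "\<mu> = measure lborel F"
  have \<mu>: "emeasure lborel F = ennreal \<mu>" unfolding \<mu>_def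
    using fin by (intro emeasure_eq_ennreal_measure) auto
  have mupos: "\<mu> > 0"
  proof (rule ccontr)
    assume "\<not> \<mu> > 0"
    then have "ennreal \<mu> = 0" by (auto simp: ennreal_neg)
    then show False using nn \<mu> by (auto intro: null_setsI)
  qed
  \<comment> \<open>Small enough for \<open>p * (\<mu> + e) < q * \<mu>\<close>; the
    \<open>p + 1\<close> in the denominator admits \<open>p = 0\<close>.\<close>
  define e where "e = (q - p) * \<mu> / (2 * (p + 1))"
  have e: "e > 0" using mupos pq by (auto simp: e_def)
  have "p * e \<le> (q - p) * \<mu> / 2"
  proof -
    have "p * e = (q - p) * \<mu> / 2 * (p / (p+1))" unfolding e_def using pq by (simp add: field_simps)
    also have "\<dots> \<le> (q - p) * \<mu> / 2 * 1" using pq mupos by (intro mult_left_mono) auto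
    finally show ?thesis by simp
  qed
  moreover have "(q - p) * \<mu> > 0" using pq mupos by auto
  ultimately have key: "p * (\<mu> + e) < q * \<mu>" by (simp add: algebra_simps)
  obtain U where U: "open U" "F \<subseteq> U" "emeasure lborel (U - F) < ennreal e"
    using outer_regular_lborel[of F e] e by auto
  have Um[measurable]: "U \<in> sets borel" using U by auto
  have "emeasure lborel U = emeasure lborel F + emeasure lborel (U - F)"
    using U by (subst plus_emeasure) (auto intro!: arg_cong[where f="emeasure lborel"])
  also have "\<dots> \<le> ennreal \<mu> + ennreal e" using U \<mu> by (intro add_mono) auto
  finally have eU: "emeasure lborel U \<le> ennreal (\<mu> + e)"
    using e mupos by (simp add: ennreal_plus)
  define \<nu> where "\<nu> = interval_measure f"
  have sets_nu: "sets \<nu> = sets borel" by (simp add: \<nu>_def)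
  have nuI: "emeasure \<nu> {a<..<b} = ennreal (f b - f a)" if "a < b" for a b
    unfolding \<nu>_def using that f by (intro emeasure_interval_measure_Ioo) auto
  have lbI: "emeasure lborel {a<..<b} = ennreal (b - a)" if "a < b" for a b :: real
    using that by simp
  obtain C where C: "countable C"
    "\<And>a b. (a,b) \<in> C \<Longrightarrow> a < b \<and> f b - f a < p * (b - a) \<and> {a<..<b} \<subseteq> U"
    "disjoint_family_on (\<lambda>(a,b). {a<..<b}) C" "negligible (F - (\<Union>(a,b)\<in>C. {a<..<b}))"
    using slope_set_vitali[of F "\<lambda>a b. f b - f a < p * (b - a)" U] U
    unfolding F_def E_def by (smt (verit) Int_iff subsetI)
  define W where "W = (\<Union>(a,b)\<in>C. {a<..<b})"
  have W: "open W" "W \<subseteq> U" unfolding W_def using C(2) by (auto intro!: open_UN)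
  have Wm[measurable]: "W \<in> sets borel" using W by auto
  \<comment> \<open>The steep intervals are sought inside \<open>W\<close>, so that the upper bound
    for \<open>\<nu> W\<close> applies to them.\<close>
  obtain D where D: "countable D"
    "\<And>a b. (a,b) \<in> D \<Longrightarrow> a < b \<and> f b - f a > q * (b - a) \<and> {a<..<b} \<subseteq> W"
    "disjoint_family_on (\<lambda>(a,b). {a<..<b}) D" "negligible ((F \<inter> W) - (\<Union>(a,b)\<in>D. {a<..<b}))"
    using slope_set_vitali[of "F \<inter> W" "\<lambda>a b. f b - f a > q * (b - a)" W] W
    unfolding F_def E_def by (smt (verit) Int_iff subsetI)
  define V where "V = (\<Union>(a,b)\<in>D. {a<..<b})"
  have V: "open V" "V \<subseteq> W" unfolding V_def using D(2) by (auto intro!: open_UN)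
  have Vm[measurable]: "V \<in> sets borel" using V by auto
  have "F - V \<subseteq> (F - W) \<union> (F \<inter> W - V)" by auto
  then have "negligible (F - V)"
    using C(4) D(4) unfolding W_def[symmetric] V_def[symmetric]
    by (meson negligible_Un negligible_subset)
  then have "F - V \<in> null_sets lborel"
    by (simp add: negligible_iff_null_sets null_sets_completion_iff)
  then have "emeasure lborel F \<le> emeasure lborel V"
    by (metis (no_types, lifting) Diff_partition Un_Diff_cancel2 Vm emeasure_Un_null_set emeasure_mono inf_sup_ord(3) sets.Un sets_lborel Fm sup_commute sup_ge1)
  then have 1: "ennreal q * ennreal \<mu> \<le> ennreal q * emeasure lborel V"
    unfolding \<mu> by (rule mult_left_mono) auto
  have 2: "ennreal q * emeasure lborel V \<le> emeasure \<nu> V"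
  proof -
    have "emeasure lborel V \<le> ennreal (1/q) * emeasure \<nu> V"
      unfolding V_def
    proof (rule emeasure_UN_countable_le[OF D(1) D(3)])
      fix i assume "i \<in> D"
      then obtain a b where i: "i = (a,b)" "(a,b) \<in> D" by (cases i) auto
      have ab: "a < b" "f b - f a > q * (b - a)" using D(2)[OF i(2)] by auto
      then have "b - a \<le> 1/q * (f b - f a)" using pq by (simp add: field_simps)
      then show "emeasure lborel (case i of (a, b) \<Rightarrow> {a<..<b}) \<le> ennreal (1 / q) * emeasure \<nu> (case i of (a, b) \<Rightarrow> {a<..<b})"
        using ab pq unfolding i(1) prod.case nuI[OF ab(1)] lbI[OF ab(1)]
        by (subst ennreal_mult[symmetric])  (auto simp: f monoD intro!: ennreal_leI)
    qed (auto simp: sets_nu)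
    then have "ennreal q * emeasure lborel V \<le> ennreal q * (ennreal (1/q) * emeasure \<nu> V)"
      by (rule mult_left_mono) auto
    also have "\<dots> = emeasure \<nu> V"
      using pq by (simp add: mult.assoc[symmetric] ennreal_mult[symmetric])
    finally show ?thesis .
  qed
  have 3: "emeasure \<nu> V \<le> emeasure \<nu> W" using V by (intro emeasure_mono) (auto simp: sets_nu)
  have 4: "emeasure \<nu> W \<le> ennreal p * emeasure lborel W"
    unfolding W_def
  proof (rule emeasure_UN_countable_le[OF C(1) C(3)])
    fix i assume "i \<in> C"
    then obtain a b where i: "i = (a,b)" "(a,b) \<in> C" by (cases i) auto
    have ab: "a < b" "f b - f a < p * (b - a)" using C(2)[OF i(2)] by auto
    then show "emeasure \<nu> (case i of (a, b) \<Rightarrow> {a<..<b}) \<le> ennreal p * emeasure lborel (case i of (a, b) \<Rightarrow> {a<..<b})"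
      using pq unfolding i(1) prod.case nuI[OF ab(1)] lbI[OF ab(1)]
      by (subst ennreal_mult[symmetric])  (auto simp: f monoD intro!: ennreal_leI)
  qed (auto simp: sets_nu)
  have 5: "ennreal p * emeasure lborel W \<le> ennreal p * ennreal (\<mu> + e)"
    using W eU by (intro mult_left_mono) (auto intro!: order_trans[OF emeasure_mono[of W U] eU])
  have "ennreal q * ennreal \<mu> \<le> ennreal p * ennreal (\<mu> + e)"
    using 1 2 3 4 5 by (meson order_trans)
  then have "ennreal (q * \<mu>) \<le> ennreal (p * (\<mu> + e))"
    using pq mupos e by (simp add: ennreal_mult)
  then have "q * \<mu> \<le> p * (\<mu> + e)" using pq mupos e by (subst (asm) ennreal_le_iff) auto
  then show False using key by linarith
qed

text \<open>The candidate \<open>D\<close> is the lower derivative over intervals straddling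
  \<open>x\<close>. Slopes near \<open>x\<close> are eventually above \<open>D - e\<close> by the
  definition of the infimum, and eventually below \<open>D + e\<close> because otherwise
  \<open>x\<close> would lie in one of the excluded sets for two rationals just above
  \<open>D\<close>.\<close>

lemma lipschitz_mono_derivative_at:
  fixes f :: "real \<Rightarrow> real"
  assumes f: "mono f" and L: "\<And>x y. \<bar>f x - f y\<bar> \<le> L * \<bar>x - y\<bar>" "L \<ge> 0"
    and sep: "\<And>p q. p \<in> \<rat> \<Longrightarrow> q \<in> \<rat> \<Longrightarrow> 0 \<le> p \<Longrightarrow> p < q \<Longrightarrow>
      x \<notin> slope_set (\<lambda>a b. f b - f a < p * (b - a)) \<inter> slope_set (\<lambda>a b. f b - f a > q * (b - a))"
  shows "\<exists>D. (f has_real_derivative D) (at x)"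
proof -
  define A where "A p = slope_set (\<lambda>a b. f b - f a < p * (b - a))" for p
  define B where "B q = slope_set (\<lambda>a b. f b - f a > q * (b - a))" for q
  have A_up: "x \<in> A p'" if pp: "x \<in> A p" "p \<le> p'" for p p'
    unfolding A_def slope_set_def
  proof (intro CollectI allI impI)
    fix d :: real assume "d > 0"
    then obtain a b where ab: "a < x" "x < b" "b - a < d" "f b - f a < p * (b - a)"
      using pp unfolding A_def slope_set_def by blast
    then have "p * (b - a) \<le> p' * (b - a)" using pp by (intro mult_right_mono) auto
    with ab have "f b - f a < p' * (b - a)" by linarith
    then show "\<exists>a b. a < x \<and> x < b \<and> b - a < d \<and> f b - f a < p' * (b - a)"
      using ab by blast
  qed
  have B_down: "x \<in> B p" if pp: "x \<in> B p'" "p \<le> p'" for p p'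
    unfolding B_def slope_set_def
  proof (intro CollectI allI impI)
    fix d :: real assume "d > 0"
    then obtain a b where ab: "a < x" "x < b" "b - a < d" "f b - f a > p' * (b - a)"
      using pp unfolding B_def slope_set_def by blast
    then have "p * (b - a) \<le> p' * (b - a)" using pp by (intro mult_right_mono) auto
    with ab have "f b - f a > p * (b - a)" by linarith
    then show "\<exists>a b. a < x \<and> x < b \<and> b - a < d \<and> f b - f a > p * (b - a)"
      using ab by blast
  qed
  have A_pos: "p > 0" if p: "x \<in> A p" for p
  proof -
    obtain a b where ab: "a < x" "x < b" "f b - f a < p * (b - a)"
      using p zero_less_one unfolding A_def slope_set_def by blast
    then have "0 \<le> f b - f a" using f by (auto simp: mono_def)
    then show ?thesis using ab by (smt (verit) mult_nonpos_nonneg)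
  qed
  have A_L: "x \<in> A (L + 1)"
    unfolding A_def slope_set_def
  proof (intro CollectI allI impI)
    fix d :: real assume d: "d > 0"
    have "f (x + d/4) - f (x - d/4) \<le> L * (d/2)" 
      using order_trans[OF abs_ge_self L(1)[of "x + d/4" "x - d/4"]] d by simp
    then show "\<exists>a b. a < x \<and> x < b \<and> b - a < d \<and> f b - f a < (L + 1) * (b - a)"
      using d by (intro exI[of _ "x - d/4"] exI[of _ "x + d/4"]) (auto simp: field_simps)
  qed
  define D where "D = Inf {p. x \<in> A p}"
  have bdd: "bdd_below {p. x \<in> A p}" using A_pos by (intro bdd_belowI[of _ 0]) force
  have contf: "isCont f y" for y
  proof -
    have "L-lipschitz_on UNIV f" using L by (intro lipschitz_onI) (auto simp: dist_real_def)
    then show ?thesis using lipschitz_on_continuous_on continuous_on_eq_continuous_at by blast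
  qed
  have low: "\<exists>d>0. \<forall>a b. a < x \<and> x < b \<and> b - a < d \<longrightarrow> (D - e) * (b - a) \<le> f b - f a" if "e > 0" for e
  proof -
    have "x \<notin> A (D - e)"
    proof
      assume "x \<in> A (D - e)"
      then have "D \<le> D - e" unfolding D_def by (intro cInf_lower bdd) auto
      then show False using that by simp
    qed
    then obtain d where "d > 0" "\<not> (\<exists>a b. a < x \<and> x < b \<and> b - a < d \<and> f b - f a < (D - e) * (b - a))"
      unfolding A_def slope_set_def by blast
    then show ?thesis by (meson not_less)
  qed
  have high: "\<exists>d>0. \<forall>a b. a < x \<and> x < b \<and> b - a < d \<longrightarrow> f b - f a \<le> (D + e) * (b - a)" if "e > 0" for e
  proof -
    have "Inf {p. x \<in> A p} < D + e" using that by (simp add: D_def)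
    then obtain p where p: "x \<in> A p" "p < D + e"
      using A_L by (subst (asm) cInf_less_iff[OF _ bdd]) auto
    \<comment> \<open>The separation hypothesis speaks of rational slopes only, so two rationals are
      inserted between \<open>p\<close> and \<open>D + e\<close>.\<close>
    obtain p' where p': "p' \<in> \<rat>" "p < p'" "p' < D + e" using Rats_dense_in_real p(2) by blast
    obtain q' where q': "q' \<in> \<rat>" "p' < q'" "q' < D + e" using Rats_dense_in_real p'(3) by blast
    have "x \<in> A p'" using A_up p p' by auto
    then have "x \<notin> B q'" using sep[OF p'(1) q'(1) _ q'(2)] A_pos[of p'] unfolding A_def B_def by auto
    then have "x \<notin> B (D + e)" using B_down q' by (meson less_imp_le)
    then obtain d where "d > 0" "\<not> (\<exists>a b. a < x \<and> x < b \<and> b - a < d \<and> f b - f a > (D + e) * (b - a))"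
      unfolding B_def slope_set_def by blast
    then show ?thesis by (meson not_less)
  qed
  have "\<exists>d>0. \<forall>y. y \<noteq> x \<and> norm (y - x) < d \<longrightarrow> norm ((f y - f x) / (y - x) - D) \<le> e" if e: "e > 0" for e
  proof -
    obtain d1 where d1: "d1 > 0" "\<And>a b. a < x \<Longrightarrow> x < b \<Longrightarrow> b - a < d1 \<Longrightarrow> (D - e) * (b - a) \<le> f b - f a"
      using low[OF e] by blast
    obtain d2 where d2: "d2 > 0" "\<And>a b. a < x \<Longrightarrow> x < b \<Longrightarrow> b - a < d2 \<Longrightarrow> f b - f a \<le> (D + e) * (b - a)"
      using high[OF e] by blast
    define d where "d = min d1 d2"
    have d: "d > 0" using d1 d2 by (simp add: d_def)
    \<comment> \<open>Slopes are controlled only for intervals with \<open>x\<close> strictly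
      inside. Letting the left endpoint tend to \<open>x\<close> and using continuity gives the
      one-sided quotients.\<close>
    have R: "(D - e) * (b - x) \<le> f b - f x \<and> f b - f x \<le> (D + e) * (b - x)" if b: "x < b" "b - x < d" for b
    proof
      have ev: "\<forall>\<^sub>F a in at_left x. a < x \<and> b - a < d"
      proof -
        have "\<forall>\<^sub>F a in at_left x. b - d < a" using b by (intro eventually_at_leftI[of "b - d" x]) auto
        moreover have "\<forall>\<^sub>F a in at_left x. a < x" by (simp add: eventually_at_filter)
        ultimately show ?thesis by eventually_elim auto
      qed
      have t: "((\<lambda>a. f b - f a) \<longlongrightarrow> f b - f x) (at_left x)"
        using contf[of x] by (intro tendsto_intros) (auto simp: isCont_def intro: tendsto_within_subset)
      show "(D - e) * (b - x) \<le> f b - f x"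
        by (rule tendsto_le[OF _ t, of "\<lambda>a. (D - e) * (b - a)"])
           (auto intro!: tendsto_intros eventually_mono[OF ev] d1(2) b simp: d_def)
      show "f b - f x \<le> (D + e) * (b - x)"
        by (rule tendsto_le[OF _ _ t, of "\<lambda>a. (D + e) * (b - a)"])
           (auto intro!: tendsto_intros eventually_mono[OF ev] d2(2) b simp: d_def)
    qed
    have Lf: "(D - e) * (x - a) \<le> f x - f a \<and> f x - f a \<le> (D + e) * (x - a)" if a: "a < x" "x - a < d" for a
    proof
      have ev: "\<forall>\<^sub>F b in at_right x. x < b \<and> b - a < d"
      proof -
        have "\<forall>\<^sub>F b in at_right x. b < a + d" using a by (intro eventually_at_rightI[of x "a + d"]) auto
        moreover have "\<forall>\<^sub>F b in at_right x. x < b" by (simp add: eventually_at_filter)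
        ultimately show ?thesis by eventually_elim auto
      qed
      have t: "((\<lambda>b. f b - f a) \<longlongrightarrow> f x - f a) (at_right x)"
        using contf[of x] by (intro tendsto_intros) (auto simp: isCont_def intro: tendsto_within_subset)
      show "(D - e) * (x - a) \<le> f x - f a"
        by (rule tendsto_le[OF _ t, of "\<lambda>b. (D - e) * (b - a)"])
           (auto intro!: tendsto_intros eventually_mono[OF ev] d1(2) a simp: d_def)
      show "f x - f a \<le> (D + e) * (x - a)"
        by (rule tendsto_le[OF _ _ t, of "\<lambda>b. (D + e) * (b - a)"])
           (auto intro!: tendsto_intros eventually_mono[OF ev] d2(2) a simp: d_def)
    qed
    have "norm ((f y - f x) / (y - x) - D) \<le> e" if y: "y \<noteq> x" "norm (y - x) < d" for y
    proof (cases "x < y")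
      case True
      then show ?thesis using R[of y] y by (auto simp: abs_le_iff field_simps)
    next
      case False
      then show ?thesis using Lf[of y] y by (auto simp: abs_le_iff field_simps)
    qed
    then show ?thesis using d by blast
  qed
  then have "((\<lambda>y. (f y - f x) / (y - x)) \<longlongrightarrow> D) (at x)"
    unfolding LIM_def dist_real_def
    by (smt (verit, ccfv_SIG) field_sum_of_halves half_gt_zero real_norm_def)
  then show ?thesis unfolding has_field_derivative_iff by blast
qed

theorem lipschitz_AE_differentiable:
  fixes f :: "real \<Rightarrow> real"
  assumes L: "\<And>x y. \<bar>f x - f y\<bar> \<le> L * \<bar>x - y\<bar>"
  shows "AE x in lborel. \<exists>D. (f has_real_derivative D) (at x)"
proof -
  have L0: "L \<ge> 0" using L[of 1 0] by auto
  \<comment> \<open>Adding \<open>L * x\<close> makes the function increasing at the cost of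
    doubling the Lipschitz constant; subtracting it again does not affect differentiability.\<close>
  define g where "g x = f x + L * x" for x
  have g: "mono g"
  proof (rule monoI)
    fix x y :: real assume "x \<le> y"
    then show "g x \<le> g y" using L[of x y] by (auto simp: g_def algebra_simps abs_if split: if_splits)
  qed
  have gL: "\<bar>g x - g y\<bar> \<le> (2 * L) * \<bar>x - y\<bar>" for x y
  proof -
    have "\<bar>g x - g y\<bar> \<le> \<bar>f x - f y\<bar> + \<bar>L * (x - y)\<bar>" unfolding g_def by (simp add: algebra_simps)
    then show ?thesis using L[of x y] L0 by (simp add: abs_mult)
  qed
  have "(2*L)-lipschitz_on UNIV g" using gL L0 by (intro lipschitz_onI) (auto simp: dist_real_def)
  then have gc: "continuous_on UNIV g" by (rule lipschitz_on_continuous_on)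
  define E where "E p q = slope_set (\<lambda>a b. g b - g a < p * (b - a)) \<inter> slope_set (\<lambda>a b. g b - g a > q * (b - a))" for p q
  define P where "P = {(p,q). p \<in> \<rat> \<and> q \<in> \<rat> \<and> 0 \<le> p \<and> p < (q::real)}"
  have cP: "countable P"
    by (rule countable_subset[of _ "\<rat> \<times> \<rat>"]) (auto simp: P_def countable_rat intro!: countable_SIGMA)
  \<comment> \<open>The windows \<open>{-N<..<N}\<close> are present because the Vitali argument
    compares finite measures.\<close>
  have "(\<Union>i\<in>P. \<Union>N::nat. E (fst i) (snd i) \<inter> {-real N<..<real N}) \<in> null_sets lborel"
    using cP by (intro null_sets_UN' null_sets_UN) (auto simp: P_def E_def intro!: mono_slopes_separated_null g gc)
  moreover have "(\<Union>i\<in>P. \<Union>N::nat. E (fst i) (snd i) \<inter> {-real N<..<real N}) = (\<Union>i\<in>P. E (fst i) (snd i))"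
  proof -
    have "\<exists>N::nat. x \<in> {-real N<..<real N}" for x
      using reals_Archimedean2[of "\<bar>x\<bar>"] by (auto simp: abs_less_iff) (metis minus_less_iff)
    then show ?thesis by blast
  qed
  ultimately have "(\<Union>i\<in>P. E (fst i) (snd i)) \<in> null_sets lborel" by simp
  then have "AE x in lborel. x \<notin> (\<Union>i\<in>P. E (fst i) (snd i))" by (rule AE_not_in)
  then show ?thesis
  proof eventually_elim
    case (elim x)
    have "\<exists>D. (g has_real_derivative D) (at x)"
    proof (rule lipschitz_mono_derivative_at[OF g gL])
      show "2 * L \<ge> 0" using L0 by simp
      show "x \<notin> slope_set (\<lambda>a b. g b - g a < p * (b - a)) \<inter> slope_set (\<lambda>a b. g b - g a > q * (b - a))"
        if "p \<in> \<rat>" "q \<in> \<rat>" "0 \<le> p" "p < q" for p q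
        using elim that unfolding E_def[symmetric] P_def by force
    qed
    then obtain D where D: "(g has_real_derivative D) (at x)" ..
    have "((\<lambda>x. g x - L * x) has_real_derivative D - L) (at x)"
      by (auto intro!: derivative_eq_intros D)
    then show ?case unfolding g_def by auto
  qed
qed

section \<open>Rotations and radial integrals in the plane\<close>

lemma measurable_pair_to_complex [measurable]:
  "(\<lambda>p::real \<times> real. complex_of_real (fst p) + \<i> * complex_of_real (snd p)) \<in> borel_measurable (lborel \<Otimes>\<^sub>M lborel)"
  by measurable

text \<open>Puts the plane in Cartesian coordinates, so that rotations can be treated one real
  coordinate at a time.\<close>

lemma lborel_complex_eq:
  "lborel = distr (lborel \<Otimes>\<^sub>M lborel) borel (\<lambda>p::real \<times> real. complex_of_real (fst p) + \<i> * complex_of_real (snd p))"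
proof (rule lborel_eqI)
  fix l u :: complex assume le: "\<And>b. b \<in> Basis \<Longrightarrow> l \<bullet> b \<le> u \<bullet> b"
  have le': "Re l \<le> Re u" "Im l \<le> Im u" using le[of 1] le[of \<i>] by (auto simp: Basis_complex_def)
  have "(\<lambda>p::real \<times> real. complex_of_real (fst p) + \<i> * complex_of_real (snd p)) -` box l u
      = {Re l<..<Re u} \<times> {Im l<..<Im u}"
    by (auto simp: box_def Basis_complex_def)
  then have "emeasure (distr (lborel \<Otimes>\<^sub>M lborel) borel (\<lambda>p::real \<times> real. complex_of_real (fst p) + \<i> * complex_of_real (snd p))) (box l u)
      = emeasure (lborel \<Otimes>\<^sub>M lborel) ({Re l<..<Re u} \<times> {Im l<..<Im u})"
    by (subst emeasure_distr) (auto simp: space_pair_measure)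
  also have "\<dots> = ennreal (Re u - Re l) * ennreal (Im u - Im l)"
    using le' by (subst lborel.emeasure_pair_measure_Times) auto
  also have "\<dots> = (\<Prod>b\<in>Basis. (u - l) \<bullet> b)"
    using le' by (simp add: Basis_complex_def ennreal_mult)
  finally show "emeasure (distr (lborel \<Otimes>\<^sub>M lborel) borel (\<lambda>p::real \<times> real. complex_of_real (fst p) + \<i> * complex_of_real (snd p))) (box l u)
     = (\<Prod>b\<in>Basis. (u - l) \<bullet> b)" .
qed simp

text \<open>By Tonelli, a shear acts on each horizontal line as a translation.\<close>

lemma nn_integral_shear_fst:
  fixes f :: "real \<times> real \<Rightarrow> ennreal"
  assumes [measurable]: "f \<in> borel_measurable (lborel \<Otimes>\<^sub>M lborel)"
  shows "(\<integral>\<^sup>+p. f (fst p + a * snd p, snd p) \<partial>(lborel \<Otimes>\<^sub>M lborel)) = (\<integral>\<^sup>+p. f p \<partial>(lborel \<Otimes>\<^sub>M lborel))"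
proof -
  have "(\<integral>\<^sup>+p. f (fst p + a * snd p, snd p) \<partial>(lborel \<Otimes>\<^sub>M lborel)) = (\<integral>\<^sup>+y. \<integral>\<^sup>+x. f (x + a * y, y) \<partial>lborel \<partial>lborel)"
    by (subst lborel_pair.nn_integral_snd[symmetric]) simp_all
  also have "\<dots> = (\<integral>\<^sup>+y. \<integral>\<^sup>+x. f (x, y) \<partial>lborel \<partial>lborel)"
  proof (rule nn_integral_cong)
    fix y :: real
    show "(\<integral>\<^sup>+x. f (x + a * y, y) \<partial>lborel) = (\<integral>\<^sup>+x. f (x, y) \<partial>lborel)"
      by (subst (2) nn_integral_real_affine[of _ 1 "a * y"]) (simp_all add: add.commute)
  qed
  also have "\<dots> = (\<integral>\<^sup>+p. f p \<partial>(lborel \<Otimes>\<^sub>M lborel))"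
    by (subst lborel_pair.nn_integral_snd[symmetric]) simp_all
  finally show ?thesis .
qed

lemma nn_integral_shear_snd:
  fixes f :: "real \<times> real \<Rightarrow> ennreal"
  assumes [measurable]: "f \<in> borel_measurable (lborel \<Otimes>\<^sub>M lborel)"
  shows "(\<integral>\<^sup>+p. f (fst p, snd p + b * fst p) \<partial>(lborel \<Otimes>\<^sub>M lborel)) = (\<integral>\<^sup>+p. f p \<partial>(lborel \<Otimes>\<^sub>M lborel))"
proof -
  have "(\<integral>\<^sup>+p. f (fst p, snd p + b * fst p) \<partial>(lborel \<Otimes>\<^sub>M lborel)) = (\<integral>\<^sup>+x. \<integral>\<^sup>+y. f (x, y + b * x) \<partial>lborel \<partial>lborel)"
    by (subst lborel.nn_integral_fst[symmetric]) simp_all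
  also have "\<dots> = (\<integral>\<^sup>+x. \<integral>\<^sup>+y. f (x, y) \<partial>lborel \<partial>lborel)"
  proof (rule nn_integral_cong)
    fix x :: real
    show "(\<integral>\<^sup>+y. f (x, y + b * x) \<partial>lborel) = (\<integral>\<^sup>+y. f (x, y) \<partial>lborel)"
      by (subst (2) nn_integral_real_affine[of _ 1 "b * x"]) (simp_all add: add.commute)
  qed
  also have "\<dots> = (\<integral>\<^sup>+p. f p \<partial>(lborel \<Otimes>\<^sub>M lborel))"
    by (subst lborel.nn_integral_fst[symmetric]) simp_all
  finally show ?thesis .
qed

text \<open>A rotation that is not real factors into three shears, horizontal, vertical and
  horizontal, and each of them preserves area.\<close>

lemma nn_integral_rotate_nonreal:
  fixes f :: "complex \<Rightarrow> ennreal"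
  assumes f[measurable]: "f \<in> borel_measurable borel" and c: "cmod c = 1" "Im c \<noteq> 0"
  shows "(\<integral>\<^sup>+z. f (c * z) \<partial>lborel) = (\<integral>\<^sup>+z. f z \<partial>lborel)"
proof -
  define b where "b = Im c"
  \<comment> \<open>For \<open>c\<close> of argument \<theta> this is minus the tangent of
    \<theta>/2, the coefficient of both horizontal shears; the vertical one has the sine as
    coefficient.\<close>
  define a where "a = (Re c - 1) / b"
  define \<phi> where "\<phi> = (\<lambda>p::real \<times> real. complex_of_real (fst p) + \<i> * complex_of_real (snd p))"
  have \<phi>m[measurable]: "\<phi> \<in> borel_measurable (lborel \<Otimes>\<^sub>M lborel)" unfolding \<phi>_def by measurable
  have ab: "1 + a * b = Re c" using c by (simp add: a_def b_def)
  have sq: "(Re c)\<^sup>2 + b\<^sup>2 = 1" using c(1) by (simp add: b_def cmod_def)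
  have "b * (a + a * (1 + b * a)) = a * b * (2 + a * b)" by (simp add: algebra_simps)
  also have "\<dots> = (Re c - 1) * (Re c + 1)" unfolding ab[symmetric] by (simp add: algebra_simps)
  also have "\<dots> = b * - b" using sq by (simp add: power2_eq_square algebra_simps)
  finally have "b * (a + a * (1 + b * a)) = b * - b" .
  then have aa: "a + a * (1 + b * a) = - b" using c(2) unfolding b_def mult_left_cancel[OF c(2)] by simp
  have rot: "c * \<phi> (x, y) = \<phi> ((x + a * y) + a * (y + b * (x + a * y)), y + b * (x + a * y))" for x y
  proof -
    have "(x + a * y) + a * (y + b * (x + a * y)) = (1 + a * b) * x + (a + a * (1 + b * a)) * y"
      by (simp add: algebra_simps)
    also have "\<dots> = Re c * x - b * y" using ab aa by simp
    finally have 1: "(x + a * y) + a * (y + b * (x + a * y)) = Re c * x - b * y" .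
    have "y + b * (x + a * y) = b * x + (1 + a * b) * y" by (simp add: algebra_simps)
    also have "\<dots> = b * x + Re c * y" using ab by simp
    finally have 2: "y + b * (x + a * y) = b * x + Re c * y" .
    show ?thesis unfolding 1 unfolding 2 unfolding \<phi>_def b_def by (simp add: complex_eq_iff)
  qed
  have L: "(lborel :: complex measure) = distr (lborel \<Otimes>\<^sub>M lborel) borel \<phi>"
    unfolding \<phi>_def by (rule lborel_complex_eq)
  have "(\<integral>\<^sup>+z. f (c * z) \<partial>lborel) = (\<integral>\<^sup>+p. f (c * \<phi> p) \<partial>(lborel \<Otimes>\<^sub>M lborel))"
    unfolding L by (subst nn_integral_distr) simp_all
  also have "\<dots> = (\<integral>\<^sup>+p. (\<lambda>q. (\<lambda>r. f (\<phi> (fst r + a * snd r, snd r))) (fst q, snd q + b * fst q))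
      (fst p + a * snd p, snd p) \<partial>(lborel \<Otimes>\<^sub>M lborel))"
  proof (rule nn_integral_cong)
    fix p :: "real \<times> real"
    show "f (c * \<phi> p) = (\<lambda>q. (\<lambda>r. f (\<phi> (fst r + a * snd r, snd r))) (fst q, snd q + b * fst q)) (fst p + a * snd p, snd p)"
      using rot[of "fst p" "snd p"] by simp
  qed
  also have "\<dots> = (\<integral>\<^sup>+p. f (\<phi> p) \<partial>(lborel \<Otimes>\<^sub>M lborel))"
    by (subst nn_integral_shear_fst, measurable, subst nn_integral_shear_snd, measurable,
        subst nn_integral_shear_fst[of "\<lambda>p. f (\<phi> p)"]) measurable
  also have "\<dots> = (\<integral>\<^sup>+z. f z \<partial>lborel)"
    unfolding L by (subst nn_integral_distr) simp_all
  finally show ?thesis .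
qed

lemma lborel_distr_rotate:
  assumes c: "cmod c = 1"
  shows "distr lborel borel (\<lambda>z::complex. c * z) = lborel"
proof -
  have *: "(\<integral>\<^sup>+z. f (c * z) \<partial>lborel) = (\<integral>\<^sup>+z. f z \<partial>lborel)" if f[measurable]: "f \<in> borel_measurable borel" for f
  proof (cases "Im c = 0")
    case False
    then show ?thesis using nn_integral_rotate_nonreal[OF f c] by simp
  next
    case True
    then have "Re c = 1 \<or> Re c = -1" using c by (auto simp: cmod_def)
    then have "c = 1 \<or> c = -1" using True by (auto simp: complex_eq_iff)
    \<comment> \<open>The rotation by -1 has no factorisation into these shears, but it is the
      square of the rotation by \<open>\<i>\<close>.\<close>
    moreover have "(\<integral>\<^sup>+z. f (- z) \<partial>lborel) = (\<integral>\<^sup>+z. f z \<partial>lborel)"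
    proof -
      have "(\<integral>\<^sup>+z. f (- z) \<partial>lborel) = (\<integral>\<^sup>+z. (\<lambda>z. f (\<i> * z)) (\<i> * z) \<partial>lborel)"
        by (simp add: mult.assoc[symmetric])
      also have "\<dots> = (\<integral>\<^sup>+z. f z \<partial>lborel)"
        using nn_integral_rotate_nonreal[of "\<lambda>z. f (\<i> * z)" \<i>] nn_integral_rotate_nonreal[of f \<i>] by simp
      finally show ?thesis .
    qed
    ultimately show ?thesis by auto
  qed
  show ?thesis
  proof (rule measure_eqI)
    fix A assume "A \<in> sets (distr lborel borel ((*) c))"
    then have A[measurable]: "A \<in> sets borel" by simp
    have "emeasure (distr lborel borel ((*) c)) A = (\<integral>\<^sup>+z. indicator A (c * z) \<partial>lborel)"
      using nn_integral_distr[of "(*) c" lborel borel "indicator A"] nn_integral_indicator[of A "distr lborel borel ((*) c)"]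
      by simp
    also have "\<dots> = emeasure lborel A" by (subst *) (auto simp: nn_integral_indicator)
    finally show "emeasure (distr lborel borel ((*) c)) A = emeasure lborel A" .
  qed simp
qed

lemma nn_integral_rotate:
  fixes f :: "complex \<Rightarrow> ennreal"
  assumes [measurable]: "f \<in> borel_measurable borel" and c: "cmod c = 1"
  shows "(\<integral>\<^sup>+z. f (c * z) \<partial>lborel) = (\<integral>\<^sup>+z. f z \<partial>lborel)"
  by (subst (2) lborel_distr_rotate[OF c, symmetric], subst nn_integral_distr) auto

lemma lborel_integral_rotate:
  fixes f :: "complex \<Rightarrow> complex"
  assumes [measurable]: "f \<in> borel_measurable borel" and c: "cmod c = 1"
  shows "(\<integral>z. f (c * z) \<partial>lborel) = (\<integral>z. f z \<partial>lborel)"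
  by (subst (2) lborel_distr_rotate[OF c, symmetric], subst integral_distr) auto

text \<open>Polar coordinates for radial functions: both measures give \<open>{..a}\<close> the area
  of the disc of radius \<open>a\<close>, and a Borel measure that is finite on the half-lines is
  determined by them.\<close>

lemma lborel_distr_cmod:
  "distr lborel borel cmod = density lborel (\<lambda>\<rho>. ennreal (2 * pi * \<rho>) * indicator {0..} \<rho>)" (is "?M = ?N")
proof (rule measure_eqI_generator_eq[where E="range atMost" and \<Omega>=UNIV and A="\<lambda>n::nat. {..real n}"])
  show "Int_stable (range (atMost :: real \<Rightarrow> _))" by (auto simp: Int_stable_def)
  show "sets ?M = sigma_sets UNIV (range atMost)" "sets ?N = sigma_sets UNIV (range atMost)"
    by (simp_all add: borel_eq_atMost)
  show "(\<Union>n::nat. {..real n}) = UNIV"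
    by (auto simp: real_arch_simple)
  have M: "emeasure ?M {..a} = ennreal (pi * (max 0 a)\<^sup>2)" for a
  proof -
    have "emeasure ?M {..a} = emeasure lborel (cmod -` {..a})" by (subst emeasure_distr) auto
    also have "cmod -` {..a} = cball 0 a" by auto
    also have "emeasure lborel \<dots> = ennreal (pi * (max 0 a)\<^sup>2)"
    proof (cases "a \<ge> 0")
      case True
      then show ?thesis using emeasure_cball[of a "0::complex"] by (simp add: unit_ball_vol_2)
    next
      case False
      then show ?thesis by simp
    qed
    finally show ?thesis .
  qed
  have N: "emeasure ?N {..a} = ennreal (pi * (max 0 a)\<^sup>2)" for a
  proof (cases "a \<ge> 0")
    case True
    have "emeasure ?N {..a} = (\<integral>\<^sup>+\<rho>. ennreal (2 * pi * \<rho>) * indicator {0..a} \<rho> \<partial>lborel)"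
      by (subst emeasure_density) (auto intro!: nn_integral_cong split: split_indicator)
    also have "\<dots> = ennreal (pi * a\<^sup>2 - pi * 0\<^sup>2)"
      using True by (intro nn_integral_FTC_Icc) (auto intro!: derivative_eq_intros)
    finally show ?thesis using True by simp
  next
    case False
    have "emeasure ?N {..a} = (\<integral>\<^sup>+\<rho>. ennreal (2 * pi * \<rho>) * indicator {0..} \<rho> * indicator {..a} \<rho> \<partial>lborel)"
      by (subst emeasure_density) auto
    also have "\<dots> = (\<integral>\<^sup>+\<rho>. 0 \<partial>(lborel::real measure))"
      using False by (intro nn_integral_cong) (auto split: split_indicator)
    finally show ?thesis using False by simp
  qed
  show "emeasure ?M X = emeasure ?N X" if "X \<in> range atMost" for X using that M N by auto
  show "emeasure ?M {..real i} \<noteq> \<infinity>" for i using M by simp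
qed auto

lemma nn_integral_radial:
  assumes [measurable]: "g \<in> borel_measurable borel"
  shows "(\<integral>\<^sup>+z. g (cmod z) \<partial>lborel) = (\<integral>\<^sup>+\<rho>. ennreal (2 * pi * \<rho>) * indicator {0..} \<rho> * g \<rho> \<partial>lborel)"
proof -
  have "(\<integral>\<^sup>+z. g (cmod z) \<partial>lborel) = (\<integral>\<^sup>+\<rho>. g \<rho> \<partial>(distr lborel borel cmod))"
    by (subst nn_integral_distr) auto
  also have "\<dots> = (\<integral>\<^sup>+\<rho>. ennreal (2 * pi * \<rho>) * indicator {0..} \<rho> * g \<rho> \<partial>lborel)"
    unfolding lborel_distr_cmod by (subst nn_integral_density) auto
  finally show ?thesis .
qed

lemma nn_integral_translate_complex:
  fixes f :: "complex \<Rightarrow> ennreal"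
  assumes [measurable]: "f \<in> borel_measurable borel"
  shows "(\<integral>\<^sup>+z. f (w - z) \<partial>lborel) = (\<integral>\<^sup>+z. f z \<partial>lborel)"
proof -
  have "(\<integral>\<^sup>+z. f (w - z) \<partial>lborel) = (\<integral>\<^sup>+z. f z \<partial>(distr lborel borel (\<lambda>x. w + (-1::real) *\<^sub>R x)))"
    by (subst nn_integral_distr) auto
  also have "\<dots> = (\<integral>\<^sup>+z. f z \<partial>(density (distr lborel borel (\<lambda>x. w + (-1::real) *\<^sub>R x)) (\<lambda>_. ennreal (\<bar>-1\<bar> ^ DIM(complex)))))"
    by (subst nn_integral_density) auto
  also have "density (distr lborel borel (\<lambda>x. w + (-1::real) *\<^sub>R x)) (\<lambda>_. ennreal (\<bar>-1\<bar> ^ DIM(complex))) = lborel"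
    by (rule lborel_affine[symmetric]) simp
  finally show ?thesis .
qed

lemma nn_integral_inverse_ball:
  assumes "R \<ge> 0"
  shows "(\<integral>\<^sup>+\<xi>. ennreal (1 / cmod (w - \<xi>)) * indicator (ball w R) \<xi> \<partial>lborel) = ennreal (2 * pi * R)"
proof -
  have "(\<integral>\<^sup>+\<xi>. ennreal (1 / cmod (w - \<xi>)) * indicator (ball w R) \<xi> \<partial>lborel) =
        (\<integral>\<^sup>+\<xi>. (\<lambda>z. ennreal (1 / cmod z) * indicator {..<R} (cmod z)) (w - \<xi>) \<partial>lborel)"
    by (intro nn_integral_cong) (auto split: split_indicator simp: dist_norm)
  also have "\<dots> = (\<integral>\<^sup>+z. (\<lambda>\<rho>. ennreal (1 / \<rho>) * indicator {..<R} \<rho>) (cmod z) \<partial>lborel)"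
    by (subst nn_integral_translate_complex) auto
  also have "\<dots> = (\<integral>\<^sup>+\<rho>. ennreal (2 * pi * \<rho>) * indicator {0..} \<rho> * (ennreal (1 / \<rho>) * indicator {..<R} \<rho>) \<partial>lborel)"
    by (subst nn_integral_radial) auto
  also have "\<dots> = (\<integral>\<^sup>+\<rho>. ennreal (2 * pi) * indicator {0<..<R} \<rho> \<partial>lborel)"
    by (intro nn_integral_cong) (auto split: split_indicator simp: ennreal_mult[symmetric])
  also have "\<dots> = ennreal (2 * pi * R)"
    using assms by (subst nn_integral_cmult_indicator) (auto simp: ennreal_mult)
  finally show ?thesis .
qed

text \<open>The exponent 3/2 is what a Hoelder estimate of order 1/2 for
  \<open>1/(w - \<xi>)\<close> leaves behind; it is integrable in the plane because it is below
  2.\<close>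

lemma nn_integral_powr_ball:
  "(\<integral>\<^sup>+\<xi>. ennreal (cmod (w - \<xi>) powr (-3/2)) * indicator (ball w 1) \<xi> \<partial>lborel) \<le> ennreal (4 * pi)"
proof -
  have hi: "((\<lambda>x. 2 * pi * x powr (-1/2)) has_integral (2 * pi * (1 powr (-1/2+1) / (-1/2+1)))) {0..1}"
    by (intro has_integral_mult_right has_integral_powr_from_0) auto
  have "(\<integral>\<^sup>+\<xi>. ennreal (cmod (w - \<xi>) powr (-3/2)) * indicator (ball w 1) \<xi> \<partial>lborel) =
        (\<integral>\<^sup>+\<xi>. (\<lambda>z. ennreal (cmod z powr (-3/2)) * indicator {..<1} (cmod z)) (w - \<xi>) \<partial>lborel)"
    by (intro nn_integral_cong) (auto split: split_indicator simp: dist_norm)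
  also have "\<dots> = (\<integral>\<^sup>+z. (\<lambda>\<rho>. ennreal (\<rho> powr (-3/2)) * indicator {..<1} \<rho>) (cmod z) \<partial>lborel)"
    by (subst nn_integral_translate_complex) auto
  also have "\<dots> = (\<integral>\<^sup>+\<rho>. ennreal (2 * pi * \<rho>) * indicator {0..} \<rho> * (ennreal (\<rho> powr (-3/2)) * indicator {..<1} \<rho>) \<partial>lborel)"
    by (subst nn_integral_radial) auto
  also have "\<dots> \<le> (\<integral>\<^sup>+\<rho>. ennreal (2 * pi * \<rho> powr (-1/2)) * indicator {0..1} \<rho> \<partial>lborel)"
  proof (intro nn_integral_mono)
    fix \<rho> :: real
    have "\<rho> * \<rho> powr (-3/2) = \<rho> powr (-1/2)" if "0 < \<rho>"
      using that powr_add[of \<rho> 1 "-3/2"] by simp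
    then show "ennreal (2 * pi * \<rho>) * indicator {0..} \<rho> * (ennreal (\<rho> powr (-3/2)) * indicator {..<1} \<rho>)
      \<le> ennreal (2 * pi * \<rho> powr (-1/2)) * indicator {0..1} \<rho>"
      by (cases "\<rho> = 0") (auto split: split_indicator simp: ennreal_mult[symmetric] mult.assoc)
  qed
  also have "\<dots> = ennreal (2 * pi * (1 powr (-1/2+1) / (-1/2+1)))"
    by (rule nn_integral_has_integral_lebesgue'[OF _ hi]) auto
  also have "\<dots> = ennreal (4 * pi)" by simp
  finally show ?thesis .
qed

lemma nn_integral_inverse_cube:
  assumes d: "d > 0"
  shows "(\<integral>\<^sup>+\<xi>. ennreal (1 / cmod \<xi> ^ 3) * indicator (- ball 0 d) \<xi> \<partial>lborel) = ennreal (2 * pi / d)"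
proof -
  have "(\<integral>\<^sup>+\<xi>. ennreal (1 / cmod \<xi> ^ 3) * indicator (- ball 0 d) \<xi> \<partial>lborel) =
        (\<integral>\<^sup>+z. (\<lambda>\<rho>. ennreal (1 / \<rho> ^ 3) * indicator {d..} \<rho>) (cmod z) \<partial>lborel)"
    by (intro nn_integral_cong) (auto split: split_indicator simp: dist_norm)
  also have "\<dots> = (\<integral>\<^sup>+\<rho>. ennreal (2 * pi * \<rho>) * indicator {0..} \<rho> * (ennreal (1 / \<rho> ^ 3) * indicator {d..} \<rho>) \<partial>lborel)"
    by (subst nn_integral_radial) auto
  also have "\<dots> = (\<integral>\<^sup>+\<rho>. ennreal (2 * pi / \<rho>\<^sup>2) * indicator {d..} \<rho> \<partial>lborel)"
    using d by (intro nn_integral_cong)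
      (auto split: split_indicator simp: ennreal_mult[symmetric] power2_eq_square power3_eq_cube field_simps)
  also have "\<dots> = ennreal (0 - (- 2 * pi / d))"
  proof (rule nn_integral_FTC_atLeast)
    show "((\<lambda>x. - 2 * pi / x) \<longlongrightarrow> 0) at_top"
      by (rule tendsto_divide_0[OF tendsto_const filterlim_at_top_imp_at_infinity[OF filterlim_ident]])
    show "((\<lambda>x. - 2 * pi / x) has_real_derivative 2 * pi / x\<^sup>2) (at x)" if "d \<le> x" for x
      using that d by (auto intro!: derivative_eq_intros simp: power2_eq_square)
  qed auto
  finally show ?thesis by simp
qed

text \<open>The value depends on the ratio of the radii only and is unbounded. This is the source of
  the logarithm in the theorem as well as of the forced zeros of test functions at 0 and at
  infinity.\<close>

lemma nn_integral_inverse_square_annulus: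
  assumes "0 < a" "a \<le> b"
  shows "(\<integral>\<^sup>+\<xi>. ennreal (1 / (cmod \<xi>)\<^sup>2) * indicator (ball 0 b - ball 0 a) \<xi> \<partial>lborel) = ennreal (2 * pi * ln (b / a))"
proof -
  have "(\<integral>\<^sup>+\<xi>. ennreal (1 / (cmod \<xi>)\<^sup>2) * indicator (ball 0 b - ball 0 a) \<xi> \<partial>lborel) =
        (\<integral>\<^sup>+z. (\<lambda>\<rho>. ennreal (1 / \<rho>\<^sup>2) * indicator {a..<b} \<rho>) (cmod z) \<partial>lborel)"
    by (intro nn_integral_cong) (auto split: split_indicator simp: dist_norm)
  also have "\<dots> = (\<integral>\<^sup>+\<rho>. ennreal (2 * pi * \<rho>) * indicator {0..} \<rho> * (ennreal (1 / \<rho>\<^sup>2) * indicator {a..<b} \<rho>) \<partial>lborel)"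
    by (subst nn_integral_radial) auto
  also have "\<dots> = (\<integral>\<^sup>+\<rho>. ennreal (2 * pi / \<rho>) * indicator {a..b} \<rho> \<partial>lborel)"
  proof (rule nn_integral_cong_AE)
    show "AE \<rho> in lborel. ennreal (2 * pi * \<rho>) * indicator {0..} \<rho> * (ennreal (1 / \<rho>\<^sup>2) * indicator {a..<b} \<rho>)
        = ennreal (2 * pi / \<rho>) * indicator {a..b} \<rho>"
      using AE_lborel_singleton[of b]
    proof eventually_elim
      case (elim \<rho>)
      then show ?case using assms
        by (auto split: split_indicator simp: ennreal_mult[symmetric] power2_eq_square)
    qed
  qed
  also have "\<dots> = ennreal (2 * pi * ln b - 2 * pi * ln a)"
    using assms by (intro nn_integral_FTC_Icc) (auto intro!: derivative_eq_intros)
  also have "2 * pi * ln b - 2 * pi * ln a = 2 * pi * ln (b / a)"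
    using assms by (simp add: ln_div algebra_simps)
  finally show ?thesis .
qed

text \<open>Tonelli gives joint integrability from a bound on the inner integrals that is uniform in
  \<open>t\<close>. The bound is required almost everywhere only, since derivatives of Lipschitz
  curves are bounded only in that sense.\<close>

lemma integral_swap_interval_plane:
  fixes F :: "real \<Rightarrow> complex \<Rightarrow> complex"
  assumes m[measurable]: "case_prod F \<in> borel_measurable (lborel \<Otimes>\<^sub>M lborel)"
    and B: "AE t in lborel. t \<in> {0..1} \<longrightarrow> (\<integral>\<^sup>+z. ennreal (cmod (F t z)) \<partial>lborel) \<le> ennreal B"
  shows "(LINT t:{0..1}|lborel. (\<integral>z. F t z \<partial>lborel)) = (\<integral>z. (LINT t:{0..1}|lborel. F t z) \<partial>lborel)"
    and "integrable lborel (\<lambda>z. (LINT t:{0..1}|lborel. F t z))"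
    and "set_integrable lborel {0..1} (\<lambda>t. \<integral>z. F t z \<partial>lborel)"
proof -
  define G where "G t z = indicator {0..1} t *\<^sub>R F t z" for t :: real and z
  have Gm[measurable]: "case_prod G \<in> borel_measurable (lborel \<Otimes>\<^sub>M lborel)"
    unfolding G_def by measurable
  have int: "integrable (lborel \<Otimes>\<^sub>M lborel) (case_prod G)"
  proof (rule integrableI_bounded)
    have "(\<integral>\<^sup>+p. ennreal (norm (case_prod G p)) \<partial>(lborel \<Otimes>\<^sub>M lborel)) = (\<integral>\<^sup>+t. \<integral>\<^sup>+z. ennreal (cmod (G t z)) \<partial>lborel \<partial>lborel)"
      by (subst lborel.nn_integral_fst[symmetric]) simp_all
    also have "\<dots> \<le> (\<integral>\<^sup>+t. ennreal B * indicator {0..1} t \<partial>(lborel :: real measure))"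
    proof (rule nn_integral_mono_AE)
      show "AE t in lborel. (\<integral>\<^sup>+z. ennreal (cmod (G t z)) \<partial>lborel) \<le> ennreal B * indicator {0..1} t"
        using B
      proof eventually_elim
        case (elim t)
        then show ?case by (cases "t \<in> {0..1}") (auto simp: G_def)
      qed
    qed
    also have "\<dots> = ennreal B" by (simp add: nn_integral_cmult_indicator)
    also have "\<dots> < \<infinity>" by simp
    finally show "(\<integral>\<^sup>+p. ennreal (norm (case_prod G p)) \<partial>(lborel \<Otimes>\<^sub>M lborel)) < \<infinity>" .
  qed measurable
  have 1: "(\<integral>z. (\<integral>t. G t z \<partial>lborel) \<partial>lborel) = (\<integral>t. (\<integral>z. G t z \<partial>lborel) \<partial>lborel)"
    by (rule lborel_pair.Fubini_integral[OF int])
  have 2: "(\<integral>t. (\<integral>z. G t z \<partial>lborel) \<partial>lborel) = (LINT t:{0..1}|lborel. (\<integral>z. F t z \<partial>lborel))"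
    unfolding set_lebesgue_integral_def G_def by simp
  have 3: "(\<integral>t. G t z \<partial>lborel) = (LINT t:{0..1}|lborel. F t z)" for z
    unfolding set_lebesgue_integral_def G_def by simp
  show "(LINT t:{0..1}|lborel. (\<integral>z. F t z \<partial>lborel)) = (\<integral>z. (LINT t:{0..1}|lborel. F t z) \<partial>lborel)"
    using 1 2 3 by simp
  show "integrable lborel (\<lambda>z. (LINT t:{0..1}|lborel. F t z))"
    using lborel_pair.integrable_snd[OF int] 3 by simp
  show "set_integrable lborel {0..1} (\<lambda>t. \<integral>z. F t z \<partial>lborel)"
    using lborel_pair.integrable_fst[OF int] unfolding set_integrable_def G_def by simp
qed

text \<open>This is Cauchy's formula at the centre, where \<open>du / u\<close> is a multiple of
  \<open>dt\<close>. The reversed traversal serves integrands that are analytic in the reciprocal of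
  the circle variable.\<close>

lemma mean_value_unit_circle:
  assumes F: "F holomorphic_on ball 0 R" and R: "R > 1"
  shows "(LINT t:{0..1}|lborel. F (exp (2 * of_real pi * \<i> * of_real t))) = F 0"
    and "(LINT t:{0..1}|lborel. F (exp (- (2 * of_real pi * \<i> * of_real t)))) = F 0"
proof -
  have cF: "continuous_on (cball 0 1) F"
    using R by (intro continuous_on_subset[OF holomorphic_on_imp_continuous_on[OF F]]) auto
  have "((\<lambda>u. F u / (u - 0)) has_contour_integral 2 * of_real pi * \<i> * F 0) (circlepath 0 1)"
    by (rule Cauchy_integral_circlepath[OF cF]) (use R in \<open>auto intro: holomorphic_on_subset[OF F]\<close>)
  then have "((\<lambda>t. F (exp (2 * of_real pi * \<i> * of_real t)) / exp (2 * of_real pi * \<i> * of_real t)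
      * (2 * of_real pi * \<i> * exp (2 * of_real pi * \<i> * of_real t))) has_integral 2 * of_real pi * \<i> * F 0) {0..1}"
    unfolding has_contour_integral_def
    by (rule has_integral_eq[rotated], simp only: atLeastAtMost_iff vector_derivative_circlepath01)
       (simp add: circlepath)
  then have "((\<lambda>t. (2 * of_real pi * \<i>) * F (exp (2 * of_real pi * \<i> * of_real t))) has_integral 2 * of_real pi * \<i> * F 0) {0..1}"
    by (rule has_integral_eq[rotated]) auto
  then have "((\<lambda>t. 1 / (2 * of_real pi * \<i>) * ((2 * of_real pi * \<i>) * F (exp (2 * of_real pi * \<i> * of_real t))))
     has_integral 1 / (2 * of_real pi * \<i>) * (2 * of_real pi * \<i> * F 0)) {0..1}"
    by (rule has_integral_mult_right)
  then have 1: "((\<lambda>t. F (exp (2 * of_real pi * \<i> * of_real t))) has_integral F 0) {0..1}" by simp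
  have cont: "continuous_on {0..1::real} (\<lambda>t. F (exp (2 * of_real pi * \<i> * of_real t)))"
    "continuous_on {0..1::real} (\<lambda>t. F (exp (- (2 * of_real pi * \<i> * of_real t))))"
    by (intro continuous_on_compose2[OF cF] continuous_intros; auto)+
  have "((\<lambda>t. F (exp (2 * of_real pi * \<i> * of_real (1 - t)))) has_integral F 0) {0..1}"
    using has_integral_affinity[OF 1[unfolded interval_cbox], of "-1" 1]
    by (simp add: image_affinity_cbox)
  moreover have "exp (2 * of_real pi * \<i> * of_real (1 - t)) = exp (- (2 * of_real pi * \<i> * of_real t))" for t :: real
    by (simp add: algebra_simps exp_diff exp_minus divide_inverse)
  ultimately have 2: "((\<lambda>t. F (exp (- (2 * of_real pi * \<i> * of_real t)))) has_integral F 0) {0..1}"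
    by simp
  have si: "set_integrable lborel {0..1} (\<lambda>t::real. F (exp (2 * of_real pi * \<i> * of_real t)))"
     "set_integrable lborel {0..1} (\<lambda>t::real. F (exp (- (2 * of_real pi * \<i> * of_real t))))"
    using cont by (auto intro!: borel_integrable_atLeastAtMost' )
  show "(LINT t:{0..1}|lborel. F (exp (2 * of_real pi * \<i> * of_real t))) = F 0"
    using set_borel_integral_eq_integral(2)[OF si(1)] integral_unique[OF 1] by simp
  show "(LINT t:{0..1}|lborel. F (exp (- (2 * of_real pi * \<i> * of_real t)))) = F 0"
    using set_borel_integral_eq_integral(2)[OF si(2)] integral_unique[OF 2] by simp
qed

section \<open>Contour integrals along Lipschitz curves\<close>

lemma average_tendsto_lipschitz:
  fixes \<phi> :: "real \<Rightarrow> real"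
  assumes L: "\<And>x y. \<bar>\<phi> x - \<phi> y\<bar> \<le> L * \<bar>x - y\<bar>"
  shows "(\<lambda>n. real (Suc n) * (LINT x:{a..a + 1 / real (Suc n)}|lborel. \<phi> x)) \<longlonglongrightarrow> \<phi> a"
proof -
  have L0: "L \<ge> 0" using L[of 1 0] by auto
  have "L-lipschitz_on UNIV \<phi>" using L L0 by (intro lipschitz_onI) (auto simp: dist_real_def)
  then have c: "continuous_on S \<phi>" for S using lipschitz_on_continuous_on continuous_on_subset by blast
  have bnd: "\<bar>real (Suc n) * (LINT x:{a..a + 1 / real (Suc n)}|lborel. \<phi> x) - \<phi> a\<bar> \<le> L * (1 / real (Suc n))" for n
  proof -
    define h where "h = 1 / real (Suc n)"
    have h: "h > 0" "real (Suc n) * h = 1" by (auto simp: h_def)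
    have i: "set_integrable lborel {a..a+h} \<phi>" "set_integrable lborel {a..a+h} (\<lambda>x. \<phi> x - \<phi> a)"
      using c by (auto intro!: borel_integrable_atLeastAtMost' continuous_intros)
    have ci: "set_integrable lborel {a..a+h} (\<lambda>x. c)" for c :: real
      by (auto intro!: borel_integrable_atLeastAtMost')
    have lc: "(LINT x:{a..a+h}|lborel. c) = h * c" for c :: real
      using h by (simp add: set_lebesgue_integral_def)
    have "(LINT x:{a..a+h}|lborel. \<phi> x) - h * \<phi> a = (LINT x:{a..a+h}|lborel. \<phi> x - \<phi> a)"
      using i ci lc by (subst set_integral_diff(2)) auto
    moreover have "norm (LINT x:{a..a+h}|lborel. \<phi> x - \<phi> a) \<le> (LINT x:{a..a+h}|lborel. L * h)"
      unfolding set_lebesgue_integral_def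
    proof (rule Bochner_Integration.integral_norm_bound_integral)
      show "integrable lborel (\<lambda>x. indicator {a..a+h} x *\<^sub>R (\<phi> x - \<phi> a))"
        using i(2) by (simp add: set_integrable_def)
      show "integrable lborel (\<lambda>x. indicator {a..a+h} x *\<^sub>R (L * h))"
        using ci by (simp add: set_integrable_def)
      fix x
      have "\<bar>\<phi> x - \<phi> a\<bar> \<le> L * h" if "x \<in> {a..a+h}"
        using L[of x a] that L0 by (auto intro!: order_trans[OF L[of x a]] mult_left_mono)
      then show "norm (indicator {a..a+h} x *\<^sub>R (\<phi> x - \<phi> a)) \<le> indicator {a..a+h} x *\<^sub>R (L * h)"
        by (auto split: split_indicator)
    qed
    ultimately have b: "\<bar>(LINT x:{a..a+h}|lborel. \<phi> x) - h * \<phi> a\<bar> \<le> h * (L * h)"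
      by (simp add: lc mult_ac)
    have "\<bar>real (Suc n) * (LINT x:{a..a+h}|lborel. \<phi> x) - \<phi> a\<bar>
        = real (Suc n) * \<bar>(LINT x:{a..a+h}|lborel. \<phi> x) - h * \<phi> a\<bar>"
    proof -
      have "real (Suc n) * (LINT x:{a..a+h}|lborel. \<phi> x) - \<phi> a
          = real (Suc n) * ((LINT x:{a..a+h}|lborel. \<phi> x) - h * \<phi> a)"
        unfolding right_diff_distrib mult.assoc[symmetric] h(2) by simp
      then show ?thesis by (simp add: abs_mult)
    qed
    also have "\<dots> \<le> real (Suc n) * (h * (L * h))" using b by (intro mult_left_mono) auto
    also have "\<dots> = L * h" unfolding mult.assoc[symmetric] h(2) by simp
    finally show ?thesis unfolding h_def .
  qed
  have "\<forall>\<^sub>F n in sequentially. norm (real (Suc n) * (LINT x:{a..a + 1 / real (Suc n)}|lborel. \<phi> x) - \<phi> a) \<le> L * (1 / real (Suc n))"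
    unfolding real_norm_def by (intro always_eventually allI bnd)
  moreover have "(\<lambda>n. L * (1 / real (Suc n))) \<longlonglongrightarrow> 0"
    using tendsto_mult_left[OF LIMSEQ_Suc[OF lim_1_over_n], of L] by simp
  ultimately have "(\<lambda>n. real (Suc n) * (LINT x:{a..a + 1 / real (Suc n)}|lborel. \<phi> x) - \<phi> a) \<longlonglongrightarrow> 0"
    by (rule Lim_null_comparison)
  then show ?thesis by (rule LIM_zero_cancel)
qed

text \<open>A limit along one fixed sequence of increments is Borel measurable on the whole line,
  with no exceptional set to remove first.\<close>

definition dq_limit :: "(real \<Rightarrow> real) \<Rightarrow> real \<Rightarrow> real" where
  "dq_limit \<phi> x = lim (\<lambda>n. real (Suc n) * (\<phi> (x + 1 / real (Suc n)) - \<phi> x))"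

lemma dq_tendsto:
  assumes "(\<phi> has_real_derivative D) (at x)"
  shows "(\<lambda>n. real (Suc n) * (\<phi> (x + 1 / real (Suc n)) - \<phi> x)) \<longlonglongrightarrow> D"
proof -
  have "((\<lambda>h. (\<phi> (x + h) - \<phi> x) / h) \<longlongrightarrow> D) (at 0)"
    using assms by (simp add: DERIV_def)
  moreover have "filterlim (\<lambda>n. 1 / real (Suc n)) (at 0) sequentially"
    unfolding filterlim_at using LIMSEQ_Suc[OF lim_1_over_n] by simp
  ultimately have "(\<lambda>n. (\<phi> (x + 1 / real (Suc n)) - \<phi> x) / (1 / real (Suc n))) \<longlonglongrightarrow> D"
    by (rule filterlim_compose)
  then show ?thesis by (simp add: mult.commute)
qed

text \<open>The difference quotients are bounded by \<open>L\<close>, so dominated convergence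
  applies to their integrals over \<open>[0,1]\<close>. After a shift, such an integral is the
  average of \<open>\<phi>\<close> just to the right of 1 minus its average just to the right of 0,
  which tends to \<open>\<phi> 1 - \<phi> 0\<close>.\<close>

lemma lipschitz_dq_limit:
  fixes \<phi> :: "real \<Rightarrow> real"
  assumes L: "\<And>x y. \<bar>\<phi> x - \<phi> y\<bar> \<le> L * \<bar>x - y\<bar>"
  shows "dq_limit \<phi> \<in> borel_measurable borel"
    and "AE x in lborel. (\<phi> has_real_derivative dq_limit \<phi> x) (at x) \<and> \<bar>dq_limit \<phi> x\<bar> \<le> L"
    and "(dq_limit \<phi> has_integral (\<phi> 1 - \<phi> 0)) {0..1}"
proof -
  have L0: "L \<ge> 0" using L[of 1 0] by auto
  have "L-lipschitz_on UNIV \<phi>" using L L0 by (intro lipschitz_onI) (auto simp: dist_real_def)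
  then have c: "continuous_on S \<phi>" for S using lipschitz_on_continuous_on continuous_on_subset by blast
  have m[measurable]: "\<phi> \<in> borel_measurable borel" using c by (intro borel_measurable_continuous_onI)
  define q where "q n x = real (Suc n) * (\<phi> (x + 1 / real (Suc n)) - \<phi> x)" for n x
  have qm[measurable]: "q n \<in> borel_measurable borel" for n unfolding q_def by measurable
  have qL: "\<bar>q n x\<bar> \<le> L" for n x
  proof -
    have "\<bar>q n x\<bar> = real (Suc n) * \<bar>\<phi> (x + 1 / real (Suc n)) - \<phi> x\<bar>" unfolding q_def by (simp add: abs_mult)
    also have "\<dots> \<le> real (Suc n) * (L * \<bar>x + 1 / real (Suc n) - x\<bar>)" by (intro mult_left_mono L) auto
    also have "\<dots> = L" by simp
    finally show ?thesis .
  qed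
  have dq: "dq_limit \<phi> = (\<lambda>x. lim (\<lambda>n. q n x))" by (simp add: dq_limit_def q_def fun_eq_iff)
  show dm[measurable]: "dq_limit \<phi> \<in> borel_measurable borel"
    unfolding dq by (rule borel_measurable_lim_metric) measurable
  have qlim: "AE x in lborel. (\<phi> has_real_derivative dq_limit \<phi> x) (at x) \<and> (\<lambda>n. q n x) \<longlonglongrightarrow> dq_limit \<phi> x"
    using lipschitz_AE_differentiable[OF L]
  proof eventually_elim
    case (elim x)
    then obtain D where D: "(\<phi> has_real_derivative D) (at x)" by blast
    have "(\<lambda>n. q n x) \<longlonglongrightarrow> D" unfolding q_def by (rule dq_tendsto[OF D])
    moreover from this have "dq_limit \<phi> x = D" unfolding dq by (rule limI)
    ultimately show ?case using D by simp
  qed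
  show bd: "AE x in lborel. (\<phi> has_real_derivative dq_limit \<phi> x) (at x) \<and> \<bar>dq_limit \<phi> x\<bar> \<le> L"
    using qlim
  proof eventually_elim
    case (elim x)
    then have "(\<lambda>n. \<bar>q n x\<bar>) \<longlonglongrightarrow> \<bar>dq_limit \<phi> x\<bar>" by (intro tendsto_rabs) auto
    then show ?case using elim qL LIMSEQ_le_const2[of "\<lambda>n. \<bar>q n x\<bar>" "\<bar>dq_limit \<phi> x\<bar>" L] by auto
  qed
  have conv: "(\<lambda>n. LINT x:{0..1}|lborel. q n x) \<longlonglongrightarrow> (LINT x:{0..1}|lborel. dq_limit \<phi> x)"
    unfolding set_lebesgue_integral_def
  proof (rule integral_dominated_convergence[where w="\<lambda>x. indicator {0..1} x * L"])
    show "AE x in lborel. (\<lambda>n. indicator {0..1} x *\<^sub>R q n x) \<longlonglongrightarrow> indicator {0..1} x *\<^sub>R dq_limit \<phi> x"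
      using qlim by eventually_elim (auto intro!: tendsto_intros)
    show "AE x in lborel. norm (indicator {0..1} x *\<^sub>R q n x) \<le> indicator {0..1} x * L" for n
      using qL by (auto split: split_indicator)
    show "integrable lborel (\<lambda>x::real. indicator {0..1} x * L)" by auto
  qed measurable
  have si: "set_integrable lborel {a..b} \<phi>" for a b using c by (auto intro!: borel_integrable_atLeastAtMost')
  have val: "(LINT x:{0..1}|lborel. q n x) = real (Suc n) * (LINT x:{1..1 + 1 / real (Suc n)}|lborel. \<phi> x)
      - real (Suc n) * (LINT x:{0..0 + 1 / real (Suc n)}|lborel. \<phi> x)" for n
  proof -
    define h where "h = 1 / real (Suc n)"
    have h: "0 < h" "h \<le> 1" by (auto simp: h_def)
    have HK: "(LINT x:{a..b}|lborel. \<phi> x) = integral {a..b} \<phi>" for a b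
      by (rule set_borel_integral_eq_integral(2)[OF si])
    have io: "\<phi> integrable_on {a..b}" for a b by (rule set_borel_integral_eq_integral(1)[OF si])
    have qi: "(LINT x:{0..1}|lborel. q n x) = integral {0..1} (q n)"
      unfolding q_def by (rule set_borel_integral_eq_integral(2), rule borel_integrable_atLeastAtMost')
         (intro continuous_intros continuous_on_compose2[OF c[of UNIV]]; simp)+
    have sh: "integral {0..1} (\<lambda>x. \<phi> (x + h)) = integral {h..1+h} \<phi>"
      using integral_shift[where a = 0 and b = 1 and c = h and f = \<phi>] c by (simp add: o_def)
    have shi: "(\<lambda>x. \<phi> (x + h)) integrable_on {0..1}"
      by (intro integrable_continuous_interval continuous_on_compose2[OF c[of UNIV]] continuous_intros) auto
    have "integral {0..1} (q n) = real (Suc n) * (integral {0..1} (\<lambda>x. \<phi> (x + h)) - integral {0..1} \<phi>)"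
      unfolding q_def h_def[symmetric] using shi io by (subst integral_mult_right, subst integral_diff) auto
    moreover have "integral {0..h} \<phi> + integral {h..1+h} \<phi> = integral {0..1+h} \<phi>"
      using h by (intro Henstock_Kurzweil_Integration.integral_combine io) auto
    moreover have "integral {0..1} \<phi> + integral {1..1+h} \<phi> = integral {0..1+h} \<phi>"
      using h by (intro Henstock_Kurzweil_Integration.integral_combine io) auto
    ultimately have "integral {h..1+h} \<phi> - integral {0..1} \<phi> = integral {1..1+h} \<phi> - integral {0..h} \<phi>"
      "integral {0..1} (q n) = real (Suc n) * (integral {h..1+h} \<phi> - integral {0..1} \<phi>)"
      unfolding sh by linarith+
    then show ?thesis unfolding qi HK h_def[symmetric] by (simp only: right_diff_distrib add_0_left)
  qed
  have "(\<lambda>n. LINT x:{0..1}|lborel. q n x) \<longlonglongrightarrow> \<phi> 1 - \<phi> 0"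
    unfolding val by (intro tendsto_diff average_tendsto_lipschitz[OF L])
  then have eq: "(LINT x:{0..1}|lborel. dq_limit \<phi> x) = \<phi> 1 - \<phi> 0" using conv LIMSEQ_unique by blast
  have "set_integrable lborel {0..1} (dq_limit \<phi>)"
    unfolding set_integrable_def
  proof (rule Bochner_Integration.integrable_bound[of _ "\<lambda>x. indicator {0..1} x * L"])
    show "AE x in lborel. norm (indicator {0..1} x *\<^sub>R dq_limit \<phi> x) \<le> norm (indicator {0..1} x * L)"
      using bd by eventually_elim (use L0 in \<open>auto split: split_indicator\<close>)
  qed auto
  then show "(dq_limit \<phi> has_integral (\<phi> 1 - \<phi> 0)) {0..1}"
    unfolding has_integral_iff using set_borel_integral_eq_integral[of "{0..1}" "dq_limit \<phi>"] eq by metis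
qed

text \<open>Composition with it extends a curve from \<open>[0,1]\<close> to the whole line without
  increasing the Lipschitz constant and without leaving the path image, so that results for
  functions on the line and measurability apply directly.\<close>

definition clamp01 :: "real \<Rightarrow> real" where "clamp01 t = max 0 (min 1 t)"

text \<open>A Borel function equal to the derivative of \<open>g\<close> almost everywhere on \<open>[0,1]\<close>, for Lipschitz \<open>g\<close>; elsewhere it
  is whatever \<^const>\<open>lim\<close> returns for a divergent sequence.\<close>

definition curve_deriv :: "(real \<Rightarrow> complex) \<Rightarrow> real \<Rightarrow> complex" where
  "curve_deriv g t = complex_of_real (dq_limit (\<lambda>s. Re (g (clamp01 s))) t) + \<i> * complex_of_real (dq_limit (\<lambda>s. Im (g (clamp01 s))) t)"

lemma clamp01_lipschitz: "\<bar>clamp01 x - clamp01 y\<bar> \<le> \<bar>x - y\<bar>"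
  by (auto simp: clamp01_def)

lemma clamp01_range: "clamp01 t \<in> {0..1}" by (auto simp: clamp01_def)
lemma clamp01_id: "t \<in> {0..1} \<Longrightarrow> clamp01 t = t" by (auto simp: clamp01_def)

text \<open>Real and imaginary part are treated separately; adding their bounds accounts for the
  factor in \<open>2 * C\<close>.\<close>

lemma curve_deriv_props:
  fixes g :: "real \<Rightarrow> complex"
  assumes g: "C-lipschitz_on {0..1} g"
  shows "curve_deriv g \<in> borel_measurable borel"
    and "AE t in lborel. cmod (curve_deriv g t) \<le> 2 * C"
    and "\<exists>N. negligible N \<and> (\<forall>t\<in>{0..1} - N. (g has_vector_derivative curve_deriv g t) (at t within {0..1}))"
    and "(curve_deriv g has_integral (g 1 - g 0)) {0..1}"
proof -
  define u where "u s = Re (g (clamp01 s))" for s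
  define v where "v s = Im (g (clamp01 s))" for s
  have gd: "cmod (g (clamp01 x) - g (clamp01 y)) \<le> C * \<bar>x - y\<bar>" for x y
  proof -
    have "cmod (g (clamp01 x) - g (clamp01 y)) \<le> C * \<bar>clamp01 x - clamp01 y\<bar>"
      using lipschitz_onD[OF g clamp01_range[of x] clamp01_range[of y]] by (simp add: dist_norm)
    also have "\<dots> \<le> C * \<bar>x - y\<bar>"
      using lipschitz_on_nonneg[OF g] clamp01_lipschitz by (rule mult_left_mono[rotated])
    finally show ?thesis .
  qed
  have uL: "\<bar>u x - u y\<bar> \<le> C * \<bar>x - y\<bar>" for x y
    unfolding u_def using order_trans[OF abs_Re_le_cmod gd[of x y]] by simp
  have vL: "\<bar>v x - v y\<bar> \<le> C * \<bar>x - y\<bar>" for x y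
    unfolding v_def using order_trans[OF abs_Im_le_cmod gd[of x y]] by simp
  have cd: "curve_deriv g = (\<lambda>t. of_real (dq_limit u t) + \<i> * of_real (dq_limit v t))"
    by (simp add: curve_deriv_def u_def[abs_def] v_def[abs_def] fun_eq_iff)
  note mu = lipschitz_dq_limit(1)[OF uL] and mv = lipschitz_dq_limit(1)[OF vL]
  note [measurable] = mu mv
  show "curve_deriv g \<in> borel_measurable borel" unfolding cd by measurable
  have ae: "AE t in lborel. ((u has_real_derivative dq_limit u t) (at t) \<and> \<bar>dq_limit u t\<bar> \<le> C) \<and>
     ((v has_real_derivative dq_limit v t) (at t) \<and> \<bar>dq_limit v t\<bar> \<le> C)"
    using lipschitz_dq_limit(2)[OF uL] lipschitz_dq_limit(2)[OF vL] by (rule AE_conjI)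
  show "AE t in lborel. cmod (curve_deriv g t) \<le> 2 * C"
    using ae
  proof eventually_elim
    case (elim t)
    have "cmod (curve_deriv g t) \<le> \<bar>dq_limit u t\<bar> + \<bar>dq_limit v t\<bar>"
      unfolding cd by (rule order_trans[OF norm_triangle_ineq]) (simp add: norm_mult)
    then show ?case using elim by linarith
  qed
  from ae obtain N where N: "N \<in> null_sets lborel" and
    N': "\<And>t. t \<notin> N \<Longrightarrow> (u has_real_derivative dq_limit u t) (at t) \<and> (v has_real_derivative dq_limit v t) (at t)"
    by (elim AE_E3) auto
  have "negligible N" using N by (simp add: negligible_iff_null_sets null_sets_completionI)
  moreover have "(g has_vector_derivative curve_deriv g t) (at t within {0..1})" if t: "t \<in> {0..1} - N" for t
  proof (rule has_vector_derivative_transform)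
    have u': "(u has_vector_derivative dq_limit u t) (at t within {0..1})"
      and v': "(v has_vector_derivative dq_limit v t) (at t within {0..1})"
      using N'[of t] t by (auto simp: has_real_derivative_iff_has_vector_derivative
        intro: has_vector_derivative_at_within)
    have "((\<lambda>s. complex_of_real (u s)) has_vector_derivative of_real (dq_limit u t)) (at t within {0..1})"
      using bounded_linear.has_vector_derivative[OF bounded_linear_of_real u'] .
    moreover have "((\<lambda>s. complex_of_real (v s)) has_vector_derivative of_real (dq_limit v t)) (at t within {0..1})"
      using bounded_linear.has_vector_derivative[OF bounded_linear_of_real v'] .
    ultimately show "((\<lambda>s. of_real (u s) + \<i> * of_real (v s)) has_vector_derivative curve_deriv g t) (at t within {0..1})"
      unfolding cd by (intro has_vector_derivative_add has_vector_derivative_mult_right)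
    show "t \<in> {0..1}" using t by auto
    show "g s = of_real (u s) + \<i> * of_real (v s)" if "s \<in> {0..1}" for s
      using that by (simp add: u_def v_def clamp01_id complex_eq_iff)
  qed
  ultimately show "\<exists>N. negligible N \<and> (\<forall>t\<in>{0..1} - N. (g has_vector_derivative curve_deriv g t) (at t within {0..1}))"
    by blast
  have 1: "((\<lambda>t. complex_of_real (dq_limit u t)) has_integral of_real (u 1 - u 0)) {0..1}"
    using has_integral_linear[OF lipschitz_dq_limit(3)[OF uL] bounded_linear_of_real] by (simp add: o_def)
  have 2: "((\<lambda>t. complex_of_real (dq_limit v t)) has_integral of_real (v 1 - v 0)) {0..1}"
    using has_integral_linear[OF lipschitz_dq_limit(3)[OF vL] bounded_linear_of_real] by (simp add: o_def)
  have "(curve_deriv g has_integral (of_real (u 1 - u 0) + \<i> * of_real (v 1 - v 0))) {0..1}"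
    unfolding cd by (intro has_integral_add 1 has_integral_mult_right 2)
  moreover have "of_real (u 1 - u 0) + \<i> * of_real (v 1 - v 0) = g 1 - g 0"
    by (simp add: u_def v_def clamp01_id complex_eq_iff)
  ultimately show "(curve_deriv g has_integral (g 1 - g 0)) {0..1}" by simp
qed

text \<open>The derivative inside \<open>has_contour_integral\<close> agrees with
  \<open>curve_deriv g\<close> off a negligible set of parameters, which the gauge integral
  ignores.\<close>

lemma lipschitz_curve_integral:
  fixes g :: "real \<Rightarrow> complex"
  assumes g: "C-lipschitz_on {0..1} g"
  shows "(f has_contour_integral I) g \<longleftrightarrow> ((\<lambda>t. f (g t) * curve_deriv g t) has_integral I) {0..1}"
proof -
  obtain N where N: "negligible N" "\<And>t. t \<in> {0..1} - N \<Longrightarrow> (g has_vector_derivative curve_deriv g t) (at t within {0..1})"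
    using curve_deriv_props(3)[OF g] by blast
  have "vector_derivative g (at t within {0..1}) = curve_deriv g t" if "t \<in> {0..1} - N" for t
    using N(2)[OF that] that by (intro vector_derivative_within_closed_interval) auto
  then show ?thesis unfolding has_contour_integral_def
    by (intro has_integral_spike_eq[OF N(1)]) auto
qed

lemma lipschitz_curve_integrable:
  fixes g :: "real \<Rightarrow> complex"
  assumes g: "C-lipschitz_on {0..1} g" and f: "continuous_on (path_image g) f"
  shows "set_integrable lborel {0..1} (\<lambda>t. f (g t) * curve_deriv g t)"
    and "(f has_contour_integral (LINT t:{0..1}|lborel. f (g t) * curve_deriv g t)) g"
    and "contour_integral g f = (LINT t:{0..1}|lborel. f (g t) * curve_deriv g t)"
proof -
  have gc: "continuous_on {0..1} g" using g by (rule lipschitz_on_continuous_on)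
  have fg: "continuous_on {0..1} (\<lambda>t. f (g t))"
    by (rule continuous_on_compose2[OF f gc]) (auto simp: path_image_def)
  have [measurable]: "curve_deriv g \<in> borel_measurable borel" by (rule curve_deriv_props(1)[OF g])
  have "bounded ((\<lambda>t. f (g t)) ` {0..1})"
    using compact_continuous_image[OF fg compact_Icc] by (rule compact_imp_bounded)
  then obtain B where B: "\<And>t. t \<in> {0..1} \<Longrightarrow> cmod (f (g t)) \<le> B"
    unfolding bounded_iff by blast
  have B0: "B \<ge> 0" using B[of 0] norm_ge_zero order_trans by (metis atLeastAtMost_iff order_refl zero_le_one)
  have m: "(\<lambda>t. indicator {0..1} t *\<^sub>R f (g t)) \<in> borel_measurable borel"
    using fg by (intro borel_measurable_continuous_on_indicator) auto
  have "(\<lambda>t. (indicator {0..1} t *\<^sub>R f (g t)) * curve_deriv g t) \<in> borel_measurable borel"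
    using m by measurable
  then have m2: "(\<lambda>t. indicator {0..1} t *\<^sub>R (f (g t) * curve_deriv g t)) \<in> borel_measurable borel"
    by simp
  show si: "set_integrable lborel {0..1} (\<lambda>t. f (g t) * curve_deriv g t)"
    unfolding set_integrable_def
  proof (rule Bochner_Integration.integrable_bound[of _ "\<lambda>t. indicator {0..1} t * (B * (2 * C))"])
    show "AE t in lborel. norm (indicator {0..1} t *\<^sub>R (f (g t) * curve_deriv g t)) \<le> norm (indicator {0..1} t * (B * (2 * C)))"
      using curve_deriv_props(2)[OF g]
    proof eventually_elim
      case (elim t)
      show ?case
      proof (cases "t \<in> {0..1}")
        case True
        then have "cmod (f (g t)) * cmod (curve_deriv g t) \<le> B * (2 * C)"
          using elim B[of t] B0 by (intro mult_mono) auto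
        then show ?thesis using True B0 lipschitz_on_nonneg[OF g] by (simp add: norm_mult)
      qed simp
    qed
  qed (use m2 in auto)
  then have "((\<lambda>t. f (g t) * curve_deriv g t) has_integral (LINT t:{0..1}|lborel. f (g t) * curve_deriv g t)) {0..1}"
    using set_borel_integral_eq_integral[OF si] by (simp add: has_integral_iff)
  then show "(f has_contour_integral (LINT t:{0..1}|lborel. f (g t) * curve_deriv g t)) g"
    unfolding lipschitz_curve_integral[OF g] .
  then show "contour_integral g f = (LINT t:{0..1}|lborel. f (g t) * curve_deriv g t)"
    by (rule contour_integral_unique)
qed

text \<open>The estimate with constant \<open>K\<close> is additive over adjacent intervals, so
  bisection propagates it from short intervals to long ones without loss in the constant.\<close>

lemma lipschitz_on_01_local:
  fixes q :: "real \<Rightarrow> complex"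
  assumes "\<And>t. t \<in> {0..1} \<Longrightarrow> \<exists>d>0. \<forall>s s'. s \<in> {0..1} \<longrightarrow> s' \<in> {0..1} \<longrightarrow> \<bar>s - t\<bar> < d \<longrightarrow> \<bar>s' - t\<bar> < d \<longrightarrow> cmod (q s - q s') \<le> K * \<bar>s - s'\<bar>"
    and K: "K \<ge> 0"
  shows "K-lipschitz_on {0..1} q"
proof -
  have "cmod (q y - q x) \<le> K * (y - x)" if xy: "x \<in> {0..1}" "y \<in> {0..1}" "x \<le> y" for x y
  proof -
    have "x \<le> y \<longrightarrow> x \<in> {0..1} \<and> y \<in> {0..1} \<longrightarrow> cmod (q y - q x) \<le> K * (y - x)"
    proof (rule Bolzano[where P="\<lambda>x y. x \<in> {0..1} \<and> y \<in> {0..1} \<longrightarrow> cmod (q y - q x) \<le> K * (y - x)", THEN impI])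
      show "x \<le> y" by fact
      fix a b c assume ab: "a \<in> {0..1} \<and> b \<in> {0..1} \<longrightarrow> cmod (q b - q a) \<le> K * (b - a)"
        "b \<in> {0..1} \<and> c \<in> {0..1} \<longrightarrow> cmod (q c - q b) \<le> K * (c - b)" "a \<le> b" "b \<le> c"
      show "a \<in> {0..1} \<and> c \<in> {0..1} \<longrightarrow> cmod (q c - q a) \<le> K * (c - a)"
      proof
        assume "a \<in> {0..1} \<and> c \<in> {0..1}"
        then have "cmod (q b - q a) \<le> K * (b - a)" "cmod (q c - q b) \<le> K * (c - b)" using ab by auto
        moreover have "cmod (q c - q a) \<le> cmod (q c - q b) + cmod (q b - q a)"
          using norm_triangle_ineq[of "q c - q b" "q b - q a"] by simp
        ultimately show "cmod (q c - q a) \<le> K * (c - a)" by (simp add: algebra_simps)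
      qed
    next
      fix t assume "x \<le> t" "t \<le> y"
      then have "t \<in> {0..1}" using xy by auto
      from assms(1)[OF this] obtain d where d: "d > 0"
        "\<And>s s'. s \<in> {0..1} \<Longrightarrow> s' \<in> {0..1} \<Longrightarrow> \<bar>s - t\<bar> < d \<Longrightarrow> \<bar>s' - t\<bar> < d \<Longrightarrow> cmod (q s - q s') \<le> K * \<bar>s - s'\<bar>"
        by blast
      show "\<exists>d>0. \<forall>a b. a \<le> t \<and> t \<le> b \<and> b - a < d \<longrightarrow> a \<in> {0..1} \<and> b \<in> {0..1} \<longrightarrow> cmod (q b - q a) \<le> K * (b - a)"
      proof (intro exI[of _ d] conjI allI impI d(1))
        fix a b assume ab: "a \<le> t \<and> t \<le> b \<and> b - a < d" "a \<in> {0..1} \<and> b \<in> {0..1}"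
        then show "cmod (q b - q a) \<le> K * (b - a)" using d(2)[of b a] by auto
      qed
    qed
    then show ?thesis using xy by blast
  qed
  then show ?thesis
    using K by (intro lipschitz_on_leI) (auto simp: dist_norm norm_minus_commute)
qed

lemma exp_minus_one_lower_bound:
  obtains \<delta> where "\<delta> > 0" "\<And>x::complex. cmod x < \<delta> \<Longrightarrow> cmod x \<le> 2 * cmod (exp x - 1)"
proof -
  have "(exp has_field_derivative exp 0) (at (0::complex))" by (rule DERIV_exp)
  then have "((\<lambda>h. (exp h - 1) / h) \<longlongrightarrow> 1) (at (0::complex))"
    by (simp add: DERIV_def)
  then have "((\<lambda>h. cmod ((exp h - 1) / h)) \<longlongrightarrow> cmod 1) (at (0::complex))" by (rule tendsto_norm)
  then have "\<forall>\<^sub>F h in at (0::complex). cmod ((exp h - 1) / h) > 1/2" by (rule order_tendstoD(1)) simp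
  then obtain \<delta> where \<delta>: "\<delta> > 0" "\<And>h::complex. h \<noteq> 0 \<Longrightarrow> cmod h < \<delta> \<Longrightarrow> cmod ((exp h - 1) / h) > 1/2"
    unfolding eventually_at by (auto simp: dist_norm)
  show thesis
  proof (rule that[OF \<delta>(1)])
    fix x :: complex assume "cmod x < \<delta>"
    then show "cmod x \<le> 2 * cmod (exp x - 1)"
      using \<delta>(2)[of x] by (cases "x = 0") (auto simp: norm_divide field_simps)
  qed
qed

text \<open>For nearby parameters the difference of \<open>q\<close> is small, so it is at most
  twice the modulus of \<open>exp (q s - q s') - 1\<close>, which equals
  \<open>(p s - p s') / (p s' - \<zeta>)\<close>. By compactness the curve keeps a positive distance
  \<open>m\<close> from \<zeta>.\<close>

lemma lipschitz_log_lift: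
  fixes p q :: "real \<Rightarrow> complex"
  assumes p: "C-lipschitz_on {0..1} p" and q: "continuous_on {0..1} q"
    and pq: "\<And>t. t \<in> {0..1} \<Longrightarrow> p t = \<zeta> + exp (q t)"
  obtains K where "K-lipschitz_on {0..1} q"
proof -
  obtain \<delta> where \<delta>: "\<delta> > 0" "\<And>x::complex. cmod x < \<delta> \<Longrightarrow> cmod x \<le> 2 * cmod (exp x - 1)"
    using exp_minus_one_lower_bound by blast
  have C0: "C \<ge> 0" using p by (rule lipschitz_on_nonneg)
  have "continuous_on {0..1} (\<lambda>t. cmod (exp (q t)))" by (intro continuous_intros q)
  then obtain t0 where t0: "t0 \<in> {0..1}" "\<And>t. t \<in> {0..1} \<Longrightarrow> cmod (exp (q t0)) \<le> cmod (exp (q t))"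
    using continuous_attains_inf[of "{0..1::real}" "\<lambda>t. cmod (exp (q t))"] by auto
  define m where "m = cmod (exp (q t0))"
  have m: "m > 0" "\<And>t. t \<in> {0..1} \<Longrightarrow> m \<le> cmod (exp (q t))" using t0 by (auto simp: m_def)
  have "(2 * C / m)-lipschitz_on {0..1} q"
  proof (rule lipschitz_on_01_local)
    show "2 * C / m \<ge> 0" using C0 m by simp
    fix t :: real assume t: "t \<in> {0..1}"
    obtain d where d: "d > 0" "\<And>s. s \<in> {0..1} \<Longrightarrow> dist s t < d \<Longrightarrow> dist (q s) (q t) < \<delta> / 2"
      using q[unfolded continuous_on_iff, rule_format, OF t, of "\<delta>/2"] \<delta>(1) by auto
    show "\<exists>d>0. \<forall>s s'. s \<in> {0..1} \<longrightarrow> s' \<in> {0..1} \<longrightarrow> \<bar>s - t\<bar> < d \<longrightarrow> \<bar>s' - t\<bar> < d \<longrightarrow> cmod (q s - q s') \<le> 2 * C / m * \<bar>s - s'\<bar>"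
    proof (intro exI[of _ d] conjI allI impI d(1))
      fix s s' assume s: "s \<in> {0..1}" "s' \<in> {0..1}" "\<bar>s - t\<bar> < d" "\<bar>s' - t\<bar> < d"
      have "dist (q s) (q s') < \<delta>"
        using d(2)[of s] d(2)[of s'] s dist_triangle_half_l[of "q s" "q t" \<delta> "q s'"]
        by (simp add: dist_real_def)
      then have "cmod (q s - q s') \<le> 2 * cmod (exp (q s - q s') - 1)"
        using \<delta>(2) by (simp add: dist_norm)
      also have "exp (q s - q s') - 1 = (p s - p s') / exp (q s')"
        using pq[OF s(1)] pq[OF s(2)] by (simp add: exp_diff field_simps)
      also have "2 * cmod \<dots> = 2 * (cmod (p s - p s') / cmod (exp (q s')))" by (simp only: norm_divide)
      also have "\<dots> \<le> 2 * (C * \<bar>s - s'\<bar> / m)"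
        using lipschitz_onD[OF p s(1,2)] m(1) m(2)[OF s(2)] C0
        by (intro mult_left_mono frac_le) (auto simp: dist_norm)
      finally show "cmod (q s - q s') \<le> 2 * C / m * \<bar>s - s'\<bar>" by simp
    qed
  qed
  then show thesis by (rule that)
qed

text \<open>On writing \<open>g = \<zeta> + exp q\<close> with Lipschitz \<open>q\<close>, the
  integrand is the derivative of \<open>q\<close> almost everywhere. The fundamental theorem then
  gives the total increment of the logarithm, which is how the winding number enters.\<close>

lemma lipschitz_winding_number_integral:
  fixes g :: "real \<Rightarrow> complex"
  assumes g: "C-lipschitz_on {0..1} g" and cl: "pathfinish g = pathstart g" and \<zeta>: "\<zeta> \<notin> path_image g"
  shows "((\<lambda>w. 1 / (w - \<zeta>)) has_contour_integral (2 * of_real pi * \<i> * winding_number g \<zeta>)) g"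
proof -
  have gc: "continuous_on {0..1} g" using g by (rule lipschitz_on_continuous_on)
  then have "path g" by (simp add: path_def)
  then obtain q where q: "path q" "pathfinish q - pathstart q = 2 * of_real pi * \<i> * winding_number g \<zeta>"
     "\<And>t. t \<in> {0..1} \<Longrightarrow> g t = \<zeta> + exp (q t)"
    using winding_number_as_continuous_log[OF _ \<zeta>] by metis
  have qc: "continuous_on {0..1} q" using q(1) by (simp add: path_def)
  obtain K where K: "K-lipschitz_on {0..1} q" using lipschitz_log_lift[OF g qc q(3)] by blast
  obtain N where N: "negligible N" "\<And>t. t \<in> {0..1} - N \<Longrightarrow> (g has_vector_derivative curve_deriv g t) (at t within {0..1})"
    using curve_deriv_props(3)[OF g] by blast
  obtain M where M: "negligible M" "\<And>t. t \<in> {0..1} - M \<Longrightarrow> (q has_vector_derivative curve_deriv q t) (at t within {0..1})"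
    using curve_deriv_props(3)[OF K] by blast
  have eq: "1 / (g t - \<zeta>) * curve_deriv g t = curve_deriv q t" if t: "t \<in> {0..1} - (N \<union> M)" for t
  proof -
    have "((\<lambda>s. exp (q s)) has_vector_derivative (curve_deriv q t * exp (q t))) (at t within {0..1})"
      using field_vector_diff_chain_within[OF M(2), of t exp "exp (q t)"] t
      by (auto simp: o_def intro!: DERIV_exp[THEN DERIV_subset] )
    then have "((\<lambda>s. \<zeta> + exp (q s)) has_vector_derivative (curve_deriv q t * exp (q t))) (at t within {0..1})"
      by (auto intro!: derivative_eq_intros)
    then have "(g has_vector_derivative (curve_deriv q t * exp (q t))) (at t within {0..1})"
      by (rule has_vector_derivative_transform[rotated 2]) (use t q(3) in auto)
    then have "curve_deriv g t = curve_deriv q t * exp (q t)"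
      using N(2)[of t] t by (intro vector_derivative_unique_within[of t "{0..1}" g]) (auto simp: trivial_limit_within islimpt_Icc)
    then show ?thesis using q(3)[of t] t by simp
  qed
  have "(curve_deriv q has_integral (q 1 - q 0)) {0..1}" by (rule curve_deriv_props(4)[OF K])
  then have "((\<lambda>t. 1 / (g t - \<zeta>) * curve_deriv g t) has_integral (q 1 - q 0)) {0..1}"
    using has_integral_spike_eq[of "N \<union> M" "{0..1}" "\<lambda>t. 1 / (g t - \<zeta>) * curve_deriv g t" "curve_deriv q"] eq N(1) M(1)
    by (simp add: negligible_Un)
  moreover have "q 1 - q 0 = 2 * of_real pi * \<i> * winding_number g \<zeta>"
    using q(2) by (simp add: pathstart_def pathfinish_def)
  ultimately show ?thesis unfolding lipschitz_curve_integral[OF g] by simp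
qed

section \<open>The logarithmically weighted Cauchy transform\<close>

text \<open>The same transform as \<open>wcauchy\<close> but as a plain Lebesgue integral. The two
  agree for sets that avoid a disc around 0, where the kernel is absolutely integrable even at
  infinity.\<close>

definition logC :: "complex set \<Rightarrow> complex \<Rightarrow> complex" where
  "logC W w = of_real (1 / pi) * (LINT \<xi>:W|lborel. (1 / of_real ((cmod \<xi>)\<^sup>2)) / (w - \<xi>))"

lemma ball_in_sets_borel [measurable]: "ball (w::'a::metric_space) r \<in> sets borel"
  by simp

text \<open>Within distance 1 of \<open>w\<close> the weight is at most \<open>1 / d^2\<close> and
  the singularity of \<open>k\<close> is integrated alone. Farther away
  \<open>cmod \<xi> \<le> (M + 1) * cmod (w - \<xi>)\<close>, so the integrand decays like the
  inverse cube. The bound is uniform for \<open>w\<close> in a disc and does not see how close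
  \<open>w\<close> is to \<open>W\<close>. It is applied to the kernel itself and to its Hoelder
  majorant.\<close>

lemma nn_integral_log_kernel:
  fixes k :: "real \<Rightarrow> real"
  assumes W: "W \<in> sets borel" "W \<inter> ball 0 d = {}" and d: "d > 0" and w: "cmod w \<le> M"
    and k[measurable]: "k \<in> borel_measurable borel" and k0: "\<And>x. k x \<ge> 0" and k1: "\<And>x. x \<ge> 1 \<Longrightarrow> k x \<le> 1 / x"
    and B: "(\<integral>\<^sup>+\<xi>. ennreal (k (cmod (w - \<xi>))) * indicator (ball w 1) \<xi> \<partial>lborel) \<le> ennreal B" "B \<ge> 0"
  shows "(\<integral>\<^sup>+\<xi>. ennreal (1 / (cmod \<xi>)\<^sup>2 * k (cmod (w - \<xi>))) * indicator W \<xi> \<partial>lborel)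
     \<le> ennreal (B / d\<^sup>2 + (M + 1) * (2 * pi / d))"
proof -
  have M: "M \<ge> 0" using w norm_ge_zero order_trans by blast
  have "(\<integral>\<^sup>+\<xi>. ennreal (1 / (cmod \<xi>)\<^sup>2 * k (cmod (w - \<xi>))) * indicator W \<xi> \<partial>lborel)
    \<le> (\<integral>\<^sup>+\<xi>. ennreal (1 / d\<^sup>2) * (ennreal (k (cmod (w - \<xi>))) * indicator (ball w 1) \<xi>)
         + ennreal (M + 1) * (ennreal (1 / cmod \<xi> ^ 3) * indicator (- ball 0 d) \<xi>) \<partial>lborel)"
  proof (rule nn_integral_mono)
    fix \<xi> :: complex
    show "ennreal (1 / (cmod \<xi>)\<^sup>2 * k (cmod (w - \<xi>))) * indicator W \<xi>
      \<le> ennreal (1 / d\<^sup>2) * (ennreal (k (cmod (w - \<xi>))) * indicator (ball w 1) \<xi>)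
         + ennreal (M + 1) * (ennreal (1 / cmod \<xi> ^ 3) * indicator (- ball 0 d) \<xi>)"
    proof (cases "\<xi> \<in> W")
      case True
      then have xd: "d \<le> cmod \<xi>" using W(2) by (auto simp: disjoint_iff)
      then have x0: "cmod \<xi> > 0" using d by linarith
      show ?thesis
      proof (cases "cmod (w - \<xi>) < 1")
        case near: True
        have "1 / (cmod \<xi>)\<^sup>2 \<le> 1 / d\<^sup>2" using xd d by (intro divide_left_mono power_mono mult_pos_pos) auto
        then have "1 / (cmod \<xi>)\<^sup>2 * k (cmod (w - \<xi>)) \<le> 1 / d\<^sup>2 * k (cmod (w - \<xi>))"
          using k0 by (rule mult_right_mono)
        then have "ennreal (1 / (cmod \<xi>)\<^sup>2 * k (cmod (w - \<xi>))) \<le> ennreal (1 / d\<^sup>2) * ennreal (k (cmod (w - \<xi>)))"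
          using k0 by (subst ennreal_mult[symmetric]) (auto intro!: ennreal_leI)
        then show ?thesis using near True by (simp add: dist_norm add_increasing2)
      next
        case far: False
        have "cmod \<xi> \<le> cmod w + cmod (w - \<xi>)" using norm_triangle_ineq4[of w "w - \<xi>"] by simp
        also have "\<dots> \<le> M * cmod (w - \<xi>) + cmod (w - \<xi>)"
          using w far M mult_left_mono[of 1 "cmod (w - \<xi>)" M] by simp
        finally have "cmod \<xi> \<le> (M + 1) * cmod (w - \<xi>)" by (simp add: algebra_simps)
        then have "cmod \<xi> / cmod (w - \<xi>) \<le> M + 1" using far by (subst pos_divide_le_eq) auto
        then have "(cmod \<xi> / cmod (w - \<xi>)) / cmod \<xi> \<le> (M + 1) / cmod \<xi>" by (rule divide_right_mono) simp
        then have "1 / cmod (w - \<xi>) \<le> (M + 1) / cmod \<xi>" using x0 by simp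
        then have "k (cmod (w - \<xi>)) \<le> (M + 1) / cmod \<xi>" using k1[of "cmod (w - \<xi>)"] far by linarith
        then have "1 / (cmod \<xi>)\<^sup>2 * k (cmod (w - \<xi>)) \<le> 1 / (cmod \<xi>)\<^sup>2 * ((M + 1) / cmod \<xi>)"
          by (rule mult_left_mono) simp
        also have "\<dots> = (M + 1) * (1 / cmod \<xi> ^ 3)" by (simp add: power2_eq_square power3_eq_cube)
        finally have "ennreal (1 / (cmod \<xi>)\<^sup>2 * k (cmod (w - \<xi>))) \<le> ennreal (M + 1) * ennreal (1 / cmod \<xi> ^ 3)"
          using M by (subst ennreal_mult[symmetric]) (auto intro!: ennreal_leI)
        then show ?thesis using xd True by (simp add: add_increasing)
      qed
    qed simp
  qed
  also have "\<dots> = ennreal (1 / d\<^sup>2) * (\<integral>\<^sup>+\<xi>. ennreal (k (cmod (w - \<xi>))) * indicator (ball w 1) \<xi> \<partial>lborel)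
     + ennreal (M + 1) * (\<integral>\<^sup>+\<xi>. ennreal (1 / cmod \<xi> ^ 3) * indicator (- ball 0 d) \<xi> \<partial>lborel)"
  proof -
    have 1: "(\<lambda>\<xi>. ennreal (k (cmod (w - \<xi>))) * indicator (ball w 1) \<xi>) \<in> borel_measurable lborel"
      by measurable
    have 2: "(\<lambda>\<xi>::complex. ennreal (1 / cmod \<xi> ^ 3) * indicator (- ball 0 d) \<xi>) \<in> borel_measurable lborel"
      by measurable
    note [measurable] = 1 2
    have 3: "(\<lambda>\<xi>. ennreal (1 / d\<^sup>2) * (ennreal (k (cmod (w - \<xi>))) * indicator (ball w 1) \<xi>)) \<in> borel_measurable lborel"
      by measurable
    have 4: "(\<lambda>\<xi>::complex. ennreal (M + 1) * (ennreal (1 / cmod \<xi> ^ 3) * indicator (- ball 0 d) \<xi>)) \<in> borel_measurable lborel"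
      by measurable
    show ?thesis
      by (simp only: nn_integral_add[OF 3 4] nn_integral_cmult[OF 1] nn_integral_cmult[OF 2])
  qed
  also have "\<dots> \<le> ennreal (1 / d\<^sup>2) * ennreal B + ennreal (M + 1) * ennreal (2 * pi / d)"
    unfolding nn_integral_inverse_cube[OF d] using B by (intro add_mono mult_left_mono) auto
  also have "\<dots> = ennreal (B / d\<^sup>2 + (M + 1) * (2 * pi / d))"
  proof -
    have "ennreal (1 / d\<^sup>2) * ennreal B = ennreal (B / d\<^sup>2)" using B(2) by (subst ennreal_mult[symmetric]) auto
    moreover have "ennreal (M + 1) * ennreal (2 * pi / d) = ennreal ((M + 1) * (2 * pi / d))"
      using M d by (subst ennreal_mult[symmetric]) auto
    ultimately show ?thesis using B(2) M d by (simp del: times_divide_eq_right)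
  qed
  finally show ?thesis .
qed

lemma nn_integral_log_cauchy_kernel:
  assumes "W \<in> sets borel" "W \<inter> ball 0 d = {}" "d > 0" "cmod w \<le> M"
  shows "(\<integral>\<^sup>+\<xi>. ennreal (1 / (cmod \<xi>)\<^sup>2 * (1 / cmod (w - \<xi>))) * indicator W \<xi> \<partial>lborel)
     \<le> ennreal (2 * pi / d\<^sup>2 + (M + 1) * (2 * pi / d))"
proof -
  have "(\<integral>\<^sup>+\<xi>. ennreal (1 / (cmod \<xi>)\<^sup>2 * (1 / \<bar>cmod (w - \<xi>)\<bar>)) * indicator W \<xi> \<partial>lborel)
     \<le> ennreal (2 * pi / d\<^sup>2 + (M + 1) * (2 * pi / d))"
    by (rule nn_integral_log_kernel[where k="\<lambda>x. 1 / \<bar>x\<bar>", OF assms])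
       (use nn_integral_inverse_ball[of 1 w] in auto)
  then show ?thesis by simp
qed

lemma nn_integral_log_powr_kernel:
  assumes "W \<in> sets borel" "W \<inter> ball 0 d = {}" "d > 0" "cmod w \<le> M"
  shows "(\<integral>\<^sup>+\<xi>. ennreal (1 / (cmod \<xi>)\<^sup>2 * cmod (w - \<xi>) powr (-3/2)) * indicator W \<xi> \<partial>lborel)
     \<le> ennreal (4 * pi / d\<^sup>2 + (M + 1) * (2 * pi / d))"
proof (rule nn_integral_log_kernel[where k="\<lambda>x. x powr (-3/2)", OF assms])
  show "x powr (-3/2) \<le> 1 / x" if "1 \<le> x" for x :: real
  proof -
    have "x powr (-3/2) \<le> x powr (-1)" using that by (intro powr_mono) auto
    also have "x powr (-1) = 1 / x" using powr_minus_divide[of x 1] that by simp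
    finally show ?thesis .
  qed
qed (use nn_integral_powr_ball[of w] in auto)

text \<open>The point \<open>w\<close> may lie in \<open>W\<close> or on its boundary, since
  \<open>1 / cmod (w - \<xi>)\<close> is locally integrable in the plane.\<close>

lemma set_integrable_log_cauchy_kernel:
  assumes "W \<in> sets borel" "W \<inter> ball 0 d = {}" "d > 0"
  shows "set_integrable lborel W (\<lambda>\<xi>. (1 / of_real ((cmod \<xi>)\<^sup>2)) / (w - \<xi>))"
  unfolding set_integrable_def
proof (rule integrableI_bounded)
  have "(\<integral>\<^sup>+\<xi>. ennreal (norm (indicator W \<xi> *\<^sub>R ((1 / of_real ((cmod \<xi>)\<^sup>2)) / (w - \<xi>)))) \<partial>lborel)
     = (\<integral>\<^sup>+\<xi>. ennreal (1 / (cmod \<xi>)\<^sup>2 * (1 / cmod (w - \<xi>))) * indicator W \<xi> \<partial>lborel)"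
    by (intro nn_integral_cong) (auto split: split_indicator simp: norm_divide norm_mult norm_power)
  also have "\<dots> \<le> ennreal (2 * pi / d\<^sup>2 + (cmod w + 1) * (2 * pi / d))"
    by (rule nn_integral_log_cauchy_kernel[OF assms]) simp
  also have "\<dots> < \<infinity>" by simp
  finally show "(\<integral>\<^sup>+\<xi>. ennreal (norm (indicator W \<xi> *\<^sub>R ((1 / of_real ((cmod \<xi>)\<^sup>2)) / (w - \<xi>)))) \<partial>lborel) < \<infinity>" .
qed (use assms(1) in measurable)

lemma logC_Un:
  assumes "A \<in> sets borel" "B \<in> sets borel" "A \<inter> B = {}" "A \<inter> ball 0 d = {}" "B \<inter> ball 0 d = {}" "d > 0"
  shows "logC (A \<union> B) w = logC A w + logC B w"
  unfolding logC_def
  using set_integral_Un[OF assms(3) set_integrable_log_cauchy_kernel[OF assms(1,4,6), of w]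
    set_integrable_log_cauchy_kernel[OF assms(2,5,6), of w]]
  by (simp add: distrib_left)

text \<open>The left side is \<open>cmod (u - v) / (cmod u * cmod v)\<close>. One square root of
  \<open>cmod (u - v)\<close> is kept, the other is bounded by the sum of the roots of the moduli.
  With \<open>x\<close> and \<open>y\<close> the inverse roots, what remains is
  \<open>x * y^2 + x^2 * y\<close>, at most \<open>x^3 + y^3\<close>.\<close>

lemma inverse_diff_holder:
  fixes u v :: complex
  shows "cmod (1 / u - 1 / v) \<le> sqrt (cmod (u - v)) * (cmod u powr (-3/2) + cmod v powr (-3/2))"
proof -
  have p: "a powr (-3/2) = (1 / sqrt a) ^ 3" if "a > 0" for a :: real
  proof -
    have "a powr (-3/2) = (a powr (1/2)) powr (-3)" by (simp add: powr_powr)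
    also have "\<dots> = sqrt a powr (-3)" using that by (simp add: powr_half_sqrt)
    also have "\<dots> = (1 / sqrt a) ^ 3"
      using that powr_realpow[of "sqrt a" 3] by (simp add: powr_minus divide_inverse power_inverse)
    finally show ?thesis .
  qed
  have one: "1 / a = sqrt a * (1 / sqrt a) ^ 3" if a: "a > 0" for a :: real
  proof -
    have "sqrt a * (1 / sqrt a) ^ 3 = (1 / sqrt a)\<^sup>2 * (sqrt a * (1 / sqrt a))"
      by (simp only: power3_eq_cube power2_eq_square mult_ac)
    also have "\<dots> = 1 / a" using a by (simp add: power_divide)
    finally show ?thesis by simp
  qed
  show ?thesis
  proof (cases "u = 0 \<or> v = 0")
    \<comment> \<open>Here the conventions \<open>1 / 0 = 0\<close> and \<open>0 powr a = 0\<close>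
      make the estimate hold, with equality.\<close>
    case True
    then show ?thesis
      using p[of "cmod u"] p[of "cmod v"] one[of "cmod u"] one[of "cmod v"] by (cases "u = 0"; cases "v = 0") (auto simp: norm_divide)
  next
    case False
    define x where "x = 1 / sqrt (cmod u)"
    define y where "y = 1 / sqrt (cmod v)"
    have xy: "x > 0" "y > 0" using False by (auto simp: x_def y_def)
    have ux: "cmod u = 1 / x\<^sup>2" and vy: "cmod v = 1 / y\<^sup>2" using False by (auto simp: x_def y_def power_divide)
    have "sqrt (cmod (u - v)) \<le> sqrt (cmod u + cmod v)" using norm_triangle_ineq4 by simp
    also have "\<dots> \<le> sqrt (cmod u) + sqrt (cmod v)" by (rule sqrt_add_le_add_sqrt) auto
    also have "\<dots> = 1 / x + 1 / y" by (simp add: x_def y_def)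
    finally have s: "sqrt (cmod (u - v)) \<le> 1 / x + 1 / y" .
    have "cmod (1 / u - 1 / v) = cmod (u - v) / (cmod u * cmod v)"
      using False by (simp add: norm_divide[symmetric] norm_mult[symmetric] diff_divide_eq_iff divide_diff_eq_iff norm_minus_commute)
         (simp add: divide_simps norm_minus_commute norm_divide norm_mult)
    also have "\<dots> = sqrt (cmod (u - v)) * (sqrt (cmod (u - v)) * (x\<^sup>2 * y\<^sup>2))"
      unfolding ux vy using real_sqrt_mult_self[of "cmod (u - v)"] by (simp add: field_simps)
    also have "\<dots> \<le> sqrt (cmod (u - v)) * ((1 / x + 1 / y) * (x\<^sup>2 * y\<^sup>2))"
      by (intro mult_left_mono mult_right_mono s) auto
    also have "(1 / x + 1 / y) * (x\<^sup>2 * y\<^sup>2) = x ^ 3 + y ^ 3 - (x + y) * (x - y)\<^sup>2"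
      using xy by (simp add: field_simps power2_eq_square power3_eq_cube)
    also have "\<dots> \<le> x ^ 3 + y ^ 3" using xy by simp
    finally show ?thesis using False p[of "cmod u"] p[of "cmod v"] by (simp only: x_def y_def) (simp add: mult_left_mono)
  qed
qed

text \<open>No regularity of \<open>W\<close> enters, so the estimate holds across its boundary;
  this is the source of the continuity of the transform up to the boundary of the domain.\<close>

lemma logC_holder:
  assumes W: "W \<in> sets borel" "W \<inter> ball 0 d = {}" "d > 0" and w: "cmod w \<le> M" "cmod w' \<le> M"
  shows "cmod (logC W w - logC W w') \<le> sqrt (cmod (w - w')) * (2 * (4 * pi / d\<^sup>2 + (M + 1) * (2 * pi / d)))"
proof -
  define K where "K = 4 * pi / d\<^sup>2 + (M + 1) * (2 * pi / d)"
  have M: "M \<ge> 0" using w norm_ge_zero order_trans by blast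
  then have K: "K \<ge> 0" using W(3) by (simp add: K_def)
  note [measurable] = W(1)
  define k where "k v \<xi> = (1 / complex_of_real ((cmod \<xi>)\<^sup>2)) / (v - \<xi>)" for v \<xi>
  have si: "set_integrable lborel W (k v)" for v
    unfolding k_def by (rule set_integrable_log_cauchy_kernel[OF W])
  have "ennreal (cmod (LINT \<xi>:W|lborel. k w \<xi> - k w' \<xi>)) \<le> (\<integral>\<^sup>+\<xi>. ennreal (norm (indicator W \<xi> *\<^sub>R (k w \<xi> - k w' \<xi>))) \<partial>lborel)"
    unfolding set_lebesgue_integral_def
    using set_integral_diff(1)[OF si si, of w w'] by (intro integral_norm_bound_ennreal) (simp add: set_integrable_def)
  also have "\<dots> \<le> (\<integral>\<^sup>+\<xi>. ennreal (sqrt (cmod (w - w'))) * (ennreal (1 / (cmod \<xi>)\<^sup>2 * cmod (w - \<xi>) powr (-3/2)) * indicator W \<xi>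
      + ennreal (1 / (cmod \<xi>)\<^sup>2 * cmod (w' - \<xi>) powr (-3/2)) * indicator W \<xi>) \<partial>lborel)"
  proof (rule nn_integral_mono)
    fix \<xi>
    have "cmod (k w \<xi> - k w' \<xi>) = 1 / (cmod \<xi>)\<^sup>2 * cmod (1 / (w - \<xi>) - 1 / (w' - \<xi>))"
    proof -
      have "k w \<xi> - k w' \<xi> = (1 / complex_of_real ((cmod \<xi>)\<^sup>2)) * (1 / (w - \<xi>) - 1 / (w' - \<xi>))"
        by (simp add: k_def right_diff_distrib)
      then show ?thesis by (simp only: norm_mult) (simp add: norm_divide norm_power)
    qed
    also have "\<dots> \<le> 1 / (cmod \<xi>)\<^sup>2 * (sqrt (cmod (w - w')) * (cmod (w - \<xi>) powr (-3/2) + cmod (w' - \<xi>) powr (-3/2)))"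
      using inverse_diff_holder[of "w - \<xi>" "w' - \<xi>"] by (intro mult_left_mono) auto
    also have "\<dots> = sqrt (cmod (w - w')) * (1 / (cmod \<xi>)\<^sup>2 * cmod (w - \<xi>) powr (-3/2) + 1 / (cmod \<xi>)\<^sup>2 * cmod (w' - \<xi>) powr (-3/2))"
      by (simp add: algebra_simps)
    finally have "ennreal (cmod (k w \<xi> - k w' \<xi>)) \<le> ennreal (sqrt (cmod (w - w'))) * (ennreal (1 / (cmod \<xi>)\<^sup>2 * cmod (w - \<xi>) powr (-3/2)) + ennreal (1 / (cmod \<xi>)\<^sup>2 * cmod (w' - \<xi>) powr (-3/2)))"
      by (subst ennreal_plus[symmetric], simp, simp, subst ennreal_mult[symmetric]) (auto intro!: ennreal_leI)
    then show "ennreal (norm (indicator W \<xi> *\<^sub>R (k w \<xi> - k w' \<xi>))) \<le> ennreal (sqrt (cmod (w - w'))) * (ennreal (1 / (cmod \<xi>)\<^sup>2 * cmod (w - \<xi>) powr (-3/2)) * indicator W \<xi>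
      + ennreal (1 / (cmod \<xi>)\<^sup>2 * cmod (w' - \<xi>) powr (-3/2)) * indicator W \<xi>)"
      by (auto split: split_indicator)
  qed
  also have "\<dots> = ennreal (sqrt (cmod (w - w'))) * ((\<integral>\<^sup>+\<xi>. ennreal (1 / (cmod \<xi>)\<^sup>2 * cmod (w - \<xi>) powr (-3/2)) * indicator W \<xi> \<partial>lborel)
      + (\<integral>\<^sup>+\<xi>. ennreal (1 / (cmod \<xi>)\<^sup>2 * cmod (w' - \<xi>) powr (-3/2)) * indicator W \<xi> \<partial>lborel))"
    by (subst nn_integral_cmult, measurable, subst nn_integral_add) auto
  also have "\<dots> \<le> ennreal (sqrt (cmod (w - w'))) * (ennreal K + ennreal K)"
    unfolding K_def by (intro mult_left_mono add_mono nn_integral_log_powr_kernel W w) simp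
  also have "\<dots> = ennreal (sqrt (cmod (w - w')) * (2 * K))"
  proof -
    have "ennreal K + ennreal K = ennreal (2 * K)" using ennreal_plus[OF K K] by simp
    then show ?thesis using K ennreal_mult[of "sqrt (cmod (w - w'))" "2 * K"] by simp
  qed
  finally have b: "cmod (LINT \<xi>:W|lborel. k w \<xi> - k w' \<xi>) \<le> sqrt (cmod (w - w')) * (2 * K)"
    using K by (subst (asm) ennreal_le_iff) auto
  have "logC W w - logC W w' = of_real (1 / pi) * (LINT \<xi>:W|lborel. k w \<xi> - k w' \<xi>)"
    unfolding logC_def using set_integral_diff(2)[OF si si, of w w'] by (simp add: k_def right_diff_distrib)
  then have "cmod (logC W w - logC W w') = 1 / pi * cmod (LINT \<xi>:W|lborel. k w \<xi> - k w' \<xi>)"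
    by (simp add: norm_mult norm_divide)
  also have "\<dots> \<le> 1 * cmod (LINT \<xi>:W|lborel. k w \<xi> - k w' \<xi>)"
    using pi_gt3 by (intro mult_right_mono) auto
  finally show ?thesis using b unfolding K_def by simp
qed

lemma continuous_logC:
  assumes W: "W \<in> sets borel" "W \<inter> ball 0 d = {}" "d > 0"
  shows "continuous_on S (logC W)"
proof -
  have "isCont (logC W) w" for w
  proof -
    define K where "K = 2 * (4 * pi / d\<^sup>2 + (cmod w + 1 + 1) * (2 * pi / d))"
    have "((\<lambda>v. sqrt (cmod (v - w)) * K) \<longlongrightarrow> sqrt (cmod (w - w)) * K) (at w)"
      by (intro tendsto_intros)
    then have t: "((\<lambda>v. sqrt (cmod (v - w)) * K) \<longlongrightarrow> 0) (at w)" by simp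
    have "\<forall>\<^sub>F v in at w. norm (logC W v - logC W w) \<le> sqrt (cmod (v - w)) * K"
      unfolding eventually_at
    proof (intro exI[of _ 1] conjI ballI impI)
      fix v assume "v \<noteq> w \<and> dist v w < 1"
      then have "cmod (v - w) \<le> 1" by (simp add: dist_norm)
      then have "cmod v \<le> cmod w + 1" using norm_triangle_ineq[of "v - w" w] by simp
      then show "norm (logC W v - logC W w) \<le> sqrt (cmod (v - w)) * K"
        unfolding K_def by (intro logC_holder[OF W]) auto
    qed simp
    then have "((\<lambda>v. logC W v - logC W w) \<longlongrightarrow> 0) (at w)" using t by (rule Lim_null_comparison)
    then show ?thesis unfolding isCont_def by (rule LIM_zero_cancel)
  qed
  then show ?thesis by (simp add: continuous_at_imp_continuous_on)
qed

text \<open>Differentiation under the integral sign: the difference quotient of the kernel minus its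
  derivative is \<open>v - w0\<close> times a function dominated by the integrable kernel at
  \<open>w0\<close>, as long as \<open>v\<close> and \<open>w0\<close> keep distance
  \<open>e\<close> from \<open>W\<close>.\<close>

lemma holomorphic_logC:
  assumes W: "W \<in> sets borel" "W \<inter> ball 0 d = {}" "d > 0" and S: "open S" "S \<inter> W = {}"
  shows "logC W holomorphic_on S"
  unfolding holomorphic_on_open[OF S(1)]
proof (intro ballI)
  fix w0 assume w0: "w0 \<in> S"
  note [measurable] = W(1)
  obtain e' where e': "e' > 0" "ball w0 e' \<subseteq> S" using S(1) w0 open_contains_ball by blast
  \<comment> \<open>Half the radius, so that every \<open>v\<close> within \<open>e\<close> of
    \<open>w0\<close> is itself at distance at least \<open>e\<close> from \<open>W\<close>.\<close>
  define e where "e = e' / 2"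
  have e: "e > 0" using e' by (simp add: e_def)
  have far: "e \<le> cmod (v - \<xi>)" if "\<xi> \<in> W" "cmod (v - w0) < e" for v \<xi>
  proof (rule ccontr)
    assume "\<not> e \<le> cmod (v - \<xi>)"
    then have "cmod (w0 - \<xi>) < e'"
      using that norm_triangle_ineq[of "w0 - v" "v - \<xi>"] by (simp add: e_def norm_minus_commute)
    then have "\<xi> \<in> S" using e'(2) by (auto simp: dist_norm)
    then show False using S(2) that by auto
  qed
  define k where "k v \<xi> = (1 / complex_of_real ((cmod \<xi>)\<^sup>2)) / (v - \<xi>)" for v \<xi>
  define k' where "k' \<xi> = - (1 / complex_of_real ((cmod \<xi>)\<^sup>2)) / (w0 - \<xi>)\<^sup>2" for \<xi>
  define J where "J = (LINT \<xi>:W|lborel. cmod (k w0 \<xi>))"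
  have si: "set_integrable lborel W (k v)" for v
    unfolding k_def by (rule set_integrable_log_cauchy_kernel[OF W])
  have nk: "cmod (k v \<xi>) = 1 / (cmod \<xi>)\<^sup>2 / cmod (v - \<xi>)" for v \<xi>
    by (simp add: k_def norm_divide norm_power norm_mult)
  have k'm[measurable]: "k' \<in> borel_measurable borel" unfolding k'_def by measurable
  have sin: "set_integrable lborel W (\<lambda>\<xi>. cmod (k w0 \<xi>))"
    using si[of w0] by (rule set_integrable_norm)
  have si': "set_integrable lborel W k'"
  proof (rule set_integrable_bound[where f="\<lambda>\<xi>. 1 / e * cmod (k w0 \<xi>)"])
    show "set_integrable lborel W (\<lambda>\<xi>. 1 / e * cmod (k w0 \<xi>))" using sin by (intro set_integrable_mult_right) auto
    show "AE \<xi> in lborel. \<xi> \<in> W \<longrightarrow> norm (k' \<xi>) \<le> norm (1 / e * cmod (k w0 \<xi>))"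
    proof (intro AE_I2 impI)
      fix \<xi> assume \<xi>: "\<xi> \<in> W"
      have f: "e \<le> cmod (w0 - \<xi>)" using far[OF \<xi>, of w0] e by simp
      have "norm (k' \<xi>) = 1 / cmod (w0 - \<xi>) * cmod (k w0 \<xi>)"
        unfolding nk by (simp add: k'_def norm_divide norm_power power2_eq_square norm_mult)
      also have "\<dots> \<le> 1 / e * cmod (k w0 \<xi>)" using f e by (intro mult_right_mono divide_left_mono mult_pos_pos) auto
      finally show "norm (k' \<xi>) \<le> norm (1 / e * cmod (k w0 \<xi>))" using e by simp
    qed
    show "set_borel_measurable lborel W k'" unfolding set_borel_measurable_def by measurable
  qed
  define D where "D = of_real (1 / pi) * (LINT \<xi>:W|lborel. k' \<xi>)"
  have bound: "cmod ((logC W v - logC W w0) / (v - w0) - D) \<le> cmod (v - w0) / (e * e) * J"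
    if v: "v \<noteq> w0" "cmod (v - w0) < e" for v
  proof -
    have "(logC W v - logC W w0) / (v - w0) - D
       = of_real (1 / pi) * (LINT \<xi>:W|lborel. (k v \<xi> - k w0 \<xi>) / (v - w0) - k' \<xi>)"
      unfolding logC_def D_def k_def[symmetric]
      using si si' by (subst set_integral_diff(2)) (auto simp: set_integral_diff(2)[OF si si] right_diff_distrib diff_divide_distrib)
    then have "cmod ((logC W v - logC W w0) / (v - w0) - D)
       = 1 / pi * cmod (LINT \<xi>:W|lborel. (k v \<xi> - k w0 \<xi>) / (v - w0) - k' \<xi>)"
      by (simp add: norm_mult norm_divide)
    also have "\<dots> \<le> 1 * cmod (LINT \<xi>:W|lborel. (k v \<xi> - k w0 \<xi>) / (v - w0) - k' \<xi>)"
      using pi_gt3 by (intro mult_right_mono) auto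
    also have "\<dots> \<le> 1 * (LINT \<xi>:W|lborel. cmod (v - w0) / (e * e) * cmod (k w0 \<xi>))"
      unfolding set_lebesgue_integral_def
    proof (intro mult_left_mono Bochner_Integration.integral_norm_bound_integral)
      show "integrable lborel (\<lambda>\<xi>. indicator W \<xi> *\<^sub>R ((k v \<xi> - k w0 \<xi>) / (v - w0) - k' \<xi>))"
        using si si' unfolding set_integrable_def[symmetric]
        by (intro set_integral_diff set_integrable_divide) auto
      show "integrable lborel (\<lambda>\<xi>. indicator W \<xi> *\<^sub>R (cmod (v - w0) / (e * e) * cmod (k w0 \<xi>)))"
        using sin unfolding set_integrable_def[symmetric] by (intro set_integrable_mult_right) auto
      fix \<xi>
      have "cmod ((k v \<xi> - k w0 \<xi>) / (v - w0) - k' \<xi>) \<le> cmod (v - w0) / (e * e) * cmod (k w0 \<xi>)" if \<xi>: "\<xi> \<in> W"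
      proof -
        have f: "e \<le> cmod (w0 - \<xi>)" "e \<le> cmod (v - \<xi>)" using far[OF \<xi>, of w0] far[OF \<xi> v(2)] e by auto
        then have nz: "w0 - \<xi> \<noteq> 0" "v - \<xi> \<noteq> 0" "v - w0 \<noteq> 0" using e v by auto
        have id: "(1 / a - 1 / b) / (a - b) - (- 1 / b\<^sup>2) = (a - b) / (b\<^sup>2 * a)" if "a \<noteq> 0" "b \<noteq> 0" "a - b \<noteq> 0" for a b :: complex
          using that by (simp add: divide_simps power2_eq_square) (simp add: algebra_simps)
        have "(k v \<xi> - k w0 \<xi>) / (v - w0) - k' \<xi> = (1 / complex_of_real ((cmod \<xi>)\<^sup>2)) * ((1 / (v - \<xi>) - 1 / (w0 - \<xi>)) / ((v - \<xi>) - (w0 - \<xi>)) - (- 1 / (w0 - \<xi>)\<^sup>2))"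
          by (simp add: k_def k'_def algebra_simps diff_divide_distrib)
        also have "\<dots> = (1 / complex_of_real ((cmod \<xi>)\<^sup>2)) * ((v - w0) / ((w0 - \<xi>)\<^sup>2 * (v - \<xi>)))"
          using nz by (subst id) auto
        finally have "cmod ((k v \<xi> - k w0 \<xi>) / (v - w0) - k' \<xi>) = cmod (v - w0) / (cmod (w0 - \<xi>) * cmod (v - \<xi>)) * cmod (k w0 \<xi>)"
          unfolding nk by (simp add: norm_divide norm_mult norm_power power2_eq_square)
        also have "\<dots> \<le> cmod (v - w0) / (e * e) * cmod (k w0 \<xi>)"
          using f e by (intro mult_right_mono divide_left_mono mult_mono mult_pos_pos) auto
        finally show ?thesis .
      qed
      then show "norm (indicator W \<xi> *\<^sub>R ((k v \<xi> - k w0 \<xi>) / (v - w0) - k' \<xi>)) \<le> indicator W \<xi> *\<^sub>R (cmod (v - w0) / (e * e) * cmod (k w0 \<xi>))"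
        by (auto split: split_indicator)
    qed simp
    also have "\<dots> = cmod (v - w0) / (e * e) * J" unfolding J_def by simp
    finally show ?thesis .
  qed
  have "((\<lambda>v. cmod (v - w0) / (e * e) * J) \<longlongrightarrow> cmod (w0 - w0) / (e * e) * J) (at w0)"
    using e by (intro tendsto_intros) auto
  then have t: "((\<lambda>v. cmod (v - w0) / (e * e) * J) \<longlongrightarrow> 0) (at w0)" by simp
  have "\<forall>\<^sub>F v in at w0. norm ((logC W v - logC W w0) / (v - w0) - D) \<le> cmod (v - w0) / (e * e) * J"
    unfolding eventually_at using bound e by (intro exI[of _ e]) (auto simp: dist_norm)
  then have "((\<lambda>v. (logC W v - logC W w0) / (v - w0) - D) \<longlongrightarrow> 0) (at w0)" using t by (rule Lim_null_comparison)
  then have "((\<lambda>v. (logC W v - logC W w0) / (v - w0)) \<longlongrightarrow> D) (at w0)" by (rule LIM_zero_cancel)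
  then show "\<exists>D. (logC W has_field_derivative D) (at w0)" unfolding has_field_derivative_iff by blast
qed

lemma logC_tendsto_0:
  assumes W: "W \<in> sets borel" "W \<inter> ball 0 d = {}" "d > 0" and R: "W \<subseteq> ball 0 R"
  shows "(logC W \<longlongrightarrow> 0) at_infinity"
proof -
  note [measurable] = W(1)
  define c where "c = 1 / d\<^sup>2"
  have fin: "emeasure lborel W < \<infinity>"
    using emeasure_mono[OF R, of lborel] emeasure_bounded_finite[of "ball 0 R"] by (auto simp: less_top[symmetric] top_unique)
  have b: "cmod (logC W w) \<le> measure lborel W * (c * (1 / (cmod w - R)))" if w: "cmod w > R" for w
  proof -
    have "cmod (logC W w) = 1 / pi * cmod (LINT \<xi>:W|lborel. (1 / of_real ((cmod \<xi>)\<^sup>2)) / (w - \<xi>))"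
      unfolding logC_def by (simp add: norm_mult norm_divide)
    also have "\<dots> \<le> 1 * cmod (LINT \<xi>:W|lborel. (1 / of_real ((cmod \<xi>)\<^sup>2)) / (w - \<xi>))"
      using pi_gt3 by (intro mult_right_mono) auto
    also have "\<dots> \<le> 1 * (LINT \<xi>:W|lborel. c * (1 / (cmod w - R)))"
      unfolding set_lebesgue_integral_def
    proof (intro mult_left_mono Bochner_Integration.integral_norm_bound_integral)
      show "integrable lborel (\<lambda>\<xi>. indicator W \<xi> *\<^sub>R ((1 / of_real ((cmod \<xi>)\<^sup>2)) / (w - \<xi>)))"
        using set_integrable_log_cauchy_kernel[OF W, of w] by (simp add: set_integrable_def)
      show "integrable lborel (\<lambda>\<xi>. indicator W \<xi> *\<^sub>R (c * (1 / (cmod w - R))))"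
        using fin W by (intro integrable_scaleR_left) auto
      fix \<xi>
      have "norm ((1 / of_real ((cmod \<xi>)\<^sup>2)) / (w - \<xi>)) \<le> c * (1 / (cmod w - R))" if \<xi>: "\<xi> \<in> W"
      proof -
        have 1: "d \<le> cmod \<xi>" using W(2) \<xi> by (auto simp: disjoint_iff)
        have "cmod \<xi> < R" using R \<xi> by auto
        then have 2: "cmod w - R \<le> cmod (w - \<xi>)" using norm_triangle_ineq2[of w \<xi>] by linarith
        have "norm ((1 / complex_of_real ((cmod \<xi>)\<^sup>2)) / (w - \<xi>)) = 1 / (cmod \<xi>)\<^sup>2 * (1 / cmod (w - \<xi>))"
          by (simp add: norm_divide norm_power norm_mult)
        also have "\<dots> \<le> 1 / d\<^sup>2 * (1 / (cmod w - R))"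
          using 1 2 w W(3) by (intro mult_mono divide_left_mono power_mono mult_pos_pos) auto
        finally show ?thesis unfolding c_def .
      qed
      then show "norm (indicator W \<xi> *\<^sub>R ((1 / of_real ((cmod \<xi>)\<^sup>2)) / (w - \<xi>))) \<le> indicator W \<xi> *\<^sub>R (c * (1 / (cmod w - R)))"
        by (auto split: split_indicator)
    qed simp
    also have "\<dots> = measure lborel W * (c * (1 / (cmod w - R)))"
      using fin by (simp add: set_lebesgue_integral_def)
    finally show ?thesis .
  qed
  have "((\<lambda>w::complex. 1 / (cmod w - R)) \<longlongrightarrow> 0) at_infinity"
    by (rule tendsto_divide_0[OF tendsto_const])
       (intro filterlim_at_top_imp_at_infinity filterlim_tendsto_add_at_top[of "\<lambda>_. -R" "-R" _ cmod, simplified] filterlim_norm_at_top tendsto_const)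
  then have "((\<lambda>w. measure lborel W * (c * (1 / (cmod w - R)))) \<longlongrightarrow> measure lborel W * (c * 0)) at_infinity"
    by (intro tendsto_mult_left)
  then have t: "((\<lambda>w. measure lborel W * (c * (1 / (cmod w - R)))) \<longlongrightarrow> 0) at_infinity" by simp
  have "\<forall>\<^sub>F w in at_infinity. norm (logC W w) \<le> measure lborel W * (c * (1 / (cmod w - R)))"
    unfolding eventually_at_infinity using b by (intro exI[of _ "R + 1"]) auto
  then show ?thesis using t by (rule Lim_null_comparison)
qed

section \<open>Rotation averages\<close>

text \<open>The integral of the rotated function is the same for every angle, so it equals its mean
  over the angle, and the mean may be taken inside.\<close>

lemma lborel_rotation_average:
  fixes f :: "complex \<Rightarrow> complex"
  assumes m[measurable]: "f \<in> borel_measurable borel" and i: "integrable lborel f"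
  shows "(\<integral>z. f z \<partial>lborel) = (\<integral>z. (LINT t:{0..1}|lborel. f (exp (2 * of_real pi * \<i> * of_real t) * z)) \<partial>lborel)"
proof -
  define e where "e t = exp (2 * of_real pi * \<i> * of_real t)" for t :: real
  have e1: "cmod (e t) = 1" for t by (auto simp: e_def norm_exp_eq_Re)
  have [measurable]: "e \<in> borel_measurable borel" unfolding e_def by measurable
  have B: "(\<integral>\<^sup>+z. ennreal (cmod (f z)) \<partial>lborel) \<le> ennreal (\<integral>z. cmod (f z) \<partial>lborel)"
    using i by (subst nn_integral_eq_integral) auto
  have "(LINT t:{0..1}|lborel. (\<integral>z. f (e t * z) \<partial>lborel)) = (\<integral>z. (LINT t:{0..1}|lborel. f (e t * z)) \<partial>lborel)"
  proof (rule integral_swap_interval_plane(1))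
    show "(\<lambda>(t, z). f (e t * z)) \<in> borel_measurable (lborel \<Otimes>\<^sub>M lborel)" by measurable
    show "AE t in lborel. t \<in> {0..1} \<longrightarrow> (\<integral>\<^sup>+z. ennreal (cmod (f (e t * z))) \<partial>lborel) \<le> ennreal (\<integral>z. cmod (f z) \<partial>lborel)"
      using B nn_integral_rotate[of "\<lambda>z. ennreal (cmod (f z))" "e _"] e1 by simp
  qed
  moreover have "(LINT t:{0..1}|lborel. (\<integral>z. f (e t * z) \<partial>lborel)) = (\<integral>z. f z \<partial>lborel)"
    by (simp add: lborel_integral_rotate[OF m e1] set_lebesgue_integral_def)
  ultimately show ?thesis by (simp add: e_def)
qed

lemma cmod_rotate [simp]:
  "cmod (exp (2 * of_real pi * \<i> * of_real t)) = 1" "cmod (exp (- (2 * of_real pi * \<i> * of_real t))) = 1"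
  by (auto simp: norm_exp_eq_Re)

text \<open>The planar form of Newton's shell theorem: a uniform mass on a circle acts outside as if
  placed at the centre and has no effect inside.\<close>

lemma circle_mean_inverse:
  assumes "cmod \<xi> \<noteq> cmod w"
  shows "(LINT t:{0..1}|lborel. 1 / (w - exp (2 * of_real pi * \<i> * of_real t) * \<xi>)) = (if cmod \<xi> < cmod w then 1 / w else 0)"
proof (cases "cmod \<xi> < cmod w")
  case True
  define F where "F \<zeta> = 1 / (w - \<zeta> * \<xi>)" for \<zeta>
  \<comment> \<open>The radius up to which \<open>F\<close> is analytic. For \<xi> = 0 the function
    is constant and any radius above 1 serves.\<close>
  define R where "R = (if \<xi> = 0 then 2 else cmod w / cmod \<xi>)"
  have "F holomorphic_on ball 0 R"
    unfolding F_def
  proof (intro holomorphic_intros)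
    fix \<zeta> :: complex assume z: "\<zeta> \<in> ball 0 R"
    show "w - \<zeta> * \<xi> \<noteq> 0"
    proof
      assume "w - \<zeta> * \<xi> = 0"
      then have "cmod w = cmod \<zeta> * cmod \<xi>" by (simp add: norm_mult)
      then show False using z True by (auto simp: R_def field_simps split: if_splits)
    qed
  qed
  moreover have "R > 1" using True by (auto simp: R_def field_simps)
  ultimately have "(LINT t:{0..1}|lborel. F (exp (2 * of_real pi * \<i> * of_real t))) = F 0"
    by (rule mean_value_unit_circle(1))
  then show ?thesis using True by (simp add: F_def)
next
  case False
  then have gt: "cmod w < cmod \<xi>" using assms by simp
  \<comment> \<open>The kernel in terms of the reciprocal \<zeta> of the circle variable: now it is
    analytic beyond the closed unit disc and vanishes at the centre.\<close>
  define F where "F \<zeta> = \<zeta> / (w * \<zeta> - \<xi>)" for \<zeta>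
  define R where "R = (if w = 0 then 2 else cmod \<xi> / cmod w)"
  have "F holomorphic_on ball 0 R"
    unfolding F_def
  proof (intro holomorphic_intros)
    fix \<zeta> :: complex assume z: "\<zeta> \<in> ball 0 R"
    show "w * \<zeta> - \<xi> \<noteq> 0"
    proof
      assume "w * \<zeta> - \<xi> = 0"
      then have "cmod \<xi> = cmod w * cmod \<zeta>" by (simp add: norm_mult[symmetric])
      then show False using z gt by (auto simp: R_def field_simps split: if_splits)
    qed
  qed
  moreover have "R > 1" using gt by (auto simp: R_def field_simps)
  ultimately have "(LINT t:{0..1}|lborel. F (exp (- (2 * of_real pi * \<i> * of_real t)))) = F 0"
    by (rule mean_value_unit_circle(2))
  moreover have "F (exp (- (2 * of_real pi * \<i> * of_real t))) = 1 / (w - exp (2 * of_real pi * \<i> * of_real t) * \<xi>)" for t :: real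
  proof -
    define e where "e = exp (2 * of_real pi * \<i> * complex_of_real t)"
    have e0: "e \<noteq> 0" by (simp add: e_def)
    have "exp (- (2 * of_real pi * \<i> * complex_of_real t)) = 1 / e" by (simp add: e_def exp_minus divide_inverse)
    then have "F (exp (- (2 * of_real pi * \<i> * of_real t))) = (1 / e) / ((w - e * \<xi>) / e)"
      using e0 by (simp add: F_def diff_divide_distrib)
    also have "\<dots> = 1 / (w - e * \<xi>)" using e0 by simp
    finally show ?thesis by (simp add: e_def)
  qed
  ultimately show ?thesis using False by (simp add: F_def)
qed

text \<open>The weight is radial, so the kernel may be averaged over rotations. This leaves
  \<open>1 / w\<close> where \<open>cmod \<xi> < cmod w\<close> and 0 beyond, hence the area
  integral of the weight over an annulus, divided by \<open>w\<close>.\<close>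

lemma logC_outside_ball:
  assumes r: "0 < r" "r < cmod w"
  shows "logC (- ball 0 r) w = of_real (ln ((cmod w)\<^sup>2)) / w - of_real (ln (r\<^sup>2)) / w"
proof -
  define f where "f \<xi> = indicator (- ball 0 r) \<xi> *\<^sub>R ((1 / complex_of_real ((cmod \<xi>)\<^sup>2)) / (w - \<xi>))" for \<xi>
  have m[measurable]: "f \<in> borel_measurable borel" unfolding f_def by measurable
  have i: "integrable lborel f"
    unfolding f_def using set_integrable_log_cauchy_kernel[of "- ball 0 r" r w] r
    by (simp add: set_integrable_def)
  define A where "A = ball 0 (cmod w) - ball (0::complex) r"
  have "(\<integral>z. f z \<partial>lborel) = (\<integral>z. (LINT t:{0..1}|lborel. f (exp (2 * of_real pi * \<i> * of_real t) * z)) \<partial>lborel)"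
    by (rule lborel_rotation_average[OF m i])
  also have "\<dots> = (\<integral>z. (1 / w) * of_real (1 / (cmod z)\<^sup>2 * indicator A z) \<partial>lborel)"
  proof (rule integral_cong_AE)
    have "sphere (0::complex) (cmod w) \<in> null_sets lborel"
      using negligible_sphere[of "0::complex" "cmod w"] by (simp add: negligible_iff_null_sets null_sets_completion_iff)
    then have "AE z in lborel. z \<notin> sphere (0::complex) (cmod w)" by (rule AE_not_in)
    then show "AE z in lborel. (LINT t:{0..1}|lborel. f (exp (2 * of_real pi * \<i> * of_real t) * z)) = (1 / w) * of_real (1 / (cmod z)\<^sup>2 * indicator A z)"
    proof eventually_elim
      case (elim z)
      have ne: "cmod z \<noteq> cmod w" using elim by auto
      have "(LINT t:{0..1}|lborel. f (exp (2 * of_real pi * \<i> * of_real t) * z))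
        = (LINT t:{0..1}|lborel. (indicator (- ball 0 r) z * of_real (1 / (cmod z)\<^sup>2)) * (1 / (w - exp (2 * of_real pi * \<i> * of_real t) * z)))"
        by (intro set_lebesgue_integral_cong) (auto simp: f_def norm_mult split: split_indicator)
      also have "\<dots> = (indicator (- ball 0 r) z * of_real (1 / (cmod z)\<^sup>2)) * (if cmod z < cmod w then 1 / w else 0)"
        by (subst set_integral_mult_right) (simp only: circle_mean_inverse[OF ne])
      also have "\<dots> = (1 / w) * of_real (1 / (cmod z)\<^sup>2 * indicator A z)"
        by (auto simp: A_def split: split_indicator)
      finally show ?case .
    qed
  qed (use lborel.borel_measurable_lebesgue_integral[of "\<lambda>z t. indicator {0..1} t *\<^sub>R f (exp (2 * of_real pi * \<i> * of_real t) * z)" lborel]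
      in \<open>auto simp: set_lebesgue_integral_def A_def\<close>)
  also have "\<dots> = (1 / w) * of_real (\<integral>z. 1 / (cmod z)\<^sup>2 * indicator A z \<partial>lborel)"
    by (subst integral_mult_right_zero) (simp only: integral_complex_of_real)
  also have "(\<integral>z. 1 / (cmod z)\<^sup>2 * indicator A z \<partial>lborel) = 2 * pi * ln (cmod w / r)"
  proof (rule integral_eq_nn_integral[THEN trans])
    show "enn2real (\<integral>\<^sup>+z. ennreal (1 / (cmod z)\<^sup>2 * indicator A z) \<partial>lborel) = 2 * pi * ln (cmod w / r)"
    proof -
      have "(\<integral>\<^sup>+z. ennreal (1 / (cmod z)\<^sup>2 * indicator A z) \<partial>lborel) = (\<integral>\<^sup>+z. ennreal (1 / (cmod z)\<^sup>2) * indicator A z \<partial>lborel)"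
        by (intro nn_integral_cong) (auto split: split_indicator)
      also have "\<dots> = ennreal (2 * pi * ln (cmod w / r))"
        unfolding A_def using r by (intro nn_integral_inverse_square_annulus) auto
      finally show ?thesis using r by simp
    qed
  qed (auto simp: A_def)
  finally have "(\<integral>z. f z \<partial>lborel) = (1 / w) * of_real (2 * pi * ln (cmod w / r))" .
  then have "logC (- ball 0 r) w = of_real (1 / pi) * ((1 / w) * of_real (2 * pi * ln (cmod w / r)))"
    unfolding logC_def set_lebesgue_integral_def f_def by simp
  also have "\<dots> = of_real (2 * ln (cmod w / r)) / w" by simp
  also have "2 * ln (cmod w / r) = ln ((cmod w)\<^sup>2) - ln (r\<^sup>2)"
  proof -
    have "2 * ln (x / r) = ln (x\<^sup>2) - ln (r\<^sup>2)" if "x > 0" for x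
      using that r by (simp add: ln_div ln_realpow)
    then show ?thesis using order.strict_trans[OF r] .
  qed
  finally show ?thesis by (simp add: diff_divide_distrib)
qed

text \<open>On each circle around 0 the weight is constant and the mean of \<open>f\<close> is its
  value at the centre.\<close>

lemma integral_ball_inverse_square_eq_0:
  assumes f: "f holomorphic_on ball 0 R" "f 0 = 0" and r: "0 < r" "r \<le> R"
    and i: "set_integrable lborel (ball 0 r) (\<lambda>\<xi>. f \<xi> / of_real ((cmod \<xi>)\<^sup>2))"
  shows "(LINT \<xi>:ball 0 r|lborel. f \<xi> / of_real ((cmod \<xi>)\<^sup>2)) = 0"
proof -
  define g where "g \<xi> = indicator (ball 0 r) \<xi> *\<^sub>R (f \<xi> / complex_of_real ((cmod \<xi>)\<^sup>2))" for \<xi>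
  have gi: "integrable lborel g" using i unfolding set_integrable_def g_def .
  then have m: "g \<in> borel_measurable borel" by (simp add: borel_measurable_integrable)
  have "(LINT t:{0..1}|lborel. g (exp (2 * of_real pi * \<i> * of_real t) * z)) = 0" for z
  proof (cases "z \<in> ball 0 r \<and> z \<noteq> 0")
    case True
    define F where "F \<zeta> = f (\<zeta> * z) / of_real ((cmod z)\<^sup>2)" for \<zeta>
    have "F holomorphic_on ball 0 (R / cmod z)"
      unfolding F_def
      by (intro holomorphic_intros holomorphic_on_compose_gen[OF _ f(1), of "\<lambda>\<zeta>. \<zeta> * z", unfolded o_def])
         (use True in \<open>auto simp: norm_mult field_simps\<close>)
    moreover have "R / cmod z > 1" using True r by (simp add: field_simps)
    ultimately have "(LINT t:{0..1}|lborel. F (exp (2 * of_real pi * \<i> * of_real t))) = F 0"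
      by (rule mean_value_unit_circle(1))
    moreover have "F 0 = 0" by (simp add: F_def f)
    moreover have "(LINT t:{0..1}|lborel. g (exp (2 * of_real pi * \<i> * of_real t) * z)) = (LINT t:{0..1}|lborel. F (exp (2 * of_real pi * \<i> * of_real t)))"
      using True by (intro set_lebesgue_integral_cong) (auto simp: F_def g_def norm_mult)
    ultimately show ?thesis by simp
  next
    case False
    then show ?thesis by (auto simp: g_def norm_mult set_lebesgue_integral_def)
  qed
  then have "(\<integral>z. g z \<partial>lborel) = 0"
    using lborel_rotation_average[OF m gi] by simp
  then show ?thesis by (simp add: set_lebesgue_integral_def g_def)
qed

text \<open>On such an annulus the integral is at least \<open>2 * pi * c * ln (b / a)\<close>, and
  the logarithm can be made arbitrarily large. The annuli may shrink to 0 or expand to infinity, so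
  one argument covers both ends.\<close>

lemma not_set_integrable_annuli:
  assumes S: "S \<in> sets borel" and i: "set_integrable lborel S (\<lambda>\<xi>. f \<xi> / of_real ((cmod \<xi>)\<^sup>2))" and c: "c > 0"
    and an: "\<And>K. \<exists>a b. 0 < a \<and> a \<le> b \<and> ln (b / a) > K \<and> (\<forall>z\<in>ball (0::complex) b - ball 0 a. z \<in> S \<and> cmod (f z) \<ge> c)"
  shows False
proof -
  define K where "K = (\<integral>\<xi>. norm (indicator S \<xi> *\<^sub>R (f \<xi> / complex_of_real ((cmod \<xi>)\<^sup>2))) \<partial>lborel)"
  have K0: "K \<ge> 0" unfolding K_def by (intro integral_nonneg_AE) auto
  have K: "(\<integral>\<^sup>+\<xi>. ennreal (norm (indicator S \<xi> *\<^sub>R (f \<xi> / complex_of_real ((cmod \<xi>)\<^sup>2)))) \<partial>lborel) = ennreal K"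
    unfolding K_def by (rule nn_integral_eq_integral[OF integrable_norm[OF i[unfolded set_integrable_def]]]) auto
  obtain a b where ab: "0 < a" "a \<le> b" "ln (b / a) > K / (2 * pi * c)" "\<And>z. z \<in> ball (0::complex) b - ball 0 a \<Longrightarrow> z \<in> S \<and> cmod (f z) \<ge> c"
    using an by blast
  have "ennreal c * ennreal (2 * pi * ln (b / a)) = (\<integral>\<^sup>+\<xi>. ennreal c * (ennreal (1 / (cmod \<xi>)\<^sup>2) * indicator (ball (0::complex) b - ball 0 a) \<xi>) \<partial>lborel)"
    by (subst nn_integral_cmult) (auto simp: nn_integral_inverse_square_annulus[OF ab(1,2)])
  also have "\<dots> \<le> ennreal K" unfolding K[symmetric]
  proof (rule nn_integral_mono)
    fix \<xi>
    show "ennreal c * (ennreal (1 / (cmod \<xi>)\<^sup>2) * indicator (ball (0::complex) b - ball 0 a) \<xi>)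
        \<le> ennreal (norm (indicator S \<xi> *\<^sub>R (f \<xi> / complex_of_real ((cmod \<xi>)\<^sup>2))))"
    proof (cases "\<xi> \<in> ball (0::complex) b - ball 0 a")
      case True
      have "c * (1 / (cmod \<xi>)\<^sup>2) \<le> cmod (f \<xi>) * (1 / (cmod \<xi>)\<^sup>2)" using ab(4)[OF True] by (intro mult_right_mono) auto
      then show ?thesis using ab(4)[OF True] True c
        by (simp add: ennreal_mult[symmetric] norm_divide norm_power ennreal_leI)
    qed simp
  qed
  finally have "ennreal (c * (2 * pi * ln (b / a))) \<le> ennreal K"
    using c ab(1,2) by (subst ennreal_mult) auto
  then have "c * (2 * pi * ln (b / a)) \<le> K" using K0 by (subst (asm) ennreal_le_iff) auto
  then have "ln (b / a) \<le> K / (2 * pi * c)" using c by (simp add: field_simps)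
  then show False using ab(3) by linarith
qed

lemma set_integrable_inverse_square_zero_at_0:
  assumes S: "S \<in> sets borel" "ball 0 r \<subseteq> S" "0 < r" and i: "set_integrable lborel S (\<lambda>\<xi>. f \<xi> / of_real ((cmod \<xi>)\<^sup>2))"
    and c: "isCont f 0"
  shows "f (0::complex) = (0::complex)"
proof (rule ccontr)
  assume nz: "f 0 \<noteq> 0"
  define c where "c = cmod (f 0) / 2"
  have "c > 0" using nz by (simp add: c_def)
  have "isCont (\<lambda>z. cmod (f z)) 0" using c by (intro continuous_intros)
  then have "((\<lambda>z. cmod (f z)) \<longlongrightarrow> cmod (f 0)) (at 0)" by (simp add: isCont_def)
  then have "\<forall>\<^sub>F z in at 0. cmod (f z) > c" using nz by (intro order_tendstoD(1)) (auto simp: c_def)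
  then obtain d where d: "d > 0" "\<And>z. z \<noteq> 0 \<Longrightarrow> dist z 0 < d \<Longrightarrow> cmod (f z) > c" unfolding eventually_at by blast
  define b where "b = min d r"
  have b: "b > 0" using d S(3) by (simp add: b_def)
  show False
  proof (rule not_set_integrable_annuli[OF S(1) i \<open>c > 0\<close>])
    fix K :: real
    define a where "a = b * exp (- (\<bar>K\<bar> + 1))"
    have "ln (b / a) = \<bar>K\<bar> + 1" using b by (simp add: a_def ln_div ln_mult)
    moreover have "a \<le> b" "0 < a" using b by (auto simp: a_def mult_le_cancel_left2)
    moreover have "\<forall>z\<in>ball (0::complex) b - ball 0 a. z \<in> S \<and> cmod (f z) \<ge> c"
    proof
      fix z :: complex assume z: "z \<in> ball 0 b - ball 0 a"
      then have "z \<noteq> 0" using \<open>0 < a\<close> by auto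
      then show "z \<in> S \<and> cmod (f z) \<ge> c" using z d(2)[of z] S(2) by (auto simp: b_def)
    qed
    ultimately show "\<exists>a b. 0 < a \<and> a \<le> b \<and> ln (b / a) > K \<and> (\<forall>z\<in>ball (0::complex) b - ball 0 a. z \<in> S \<and> cmod (f z) \<ge> c)"
      by (intro exI[of _ a] exI[of _ b]) auto
  qed
qed

lemma set_integrable_inverse_square_tendsto_0:
  fixes l :: complex
  assumes S: "S \<in> sets borel" "bounded (- S)" and i: "set_integrable lborel S (\<lambda>\<xi>. f \<xi> / of_real ((cmod \<xi>)\<^sup>2))"
    and l: "(f \<longlongrightarrow> l) at_infinity"
  shows "l = 0"
proof (rule ccontr)
  assume nz: "l \<noteq> 0"
  define c where "c = cmod l / 2"
  have "c > 0" using nz by (simp add: c_def)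
  have "((\<lambda>z. cmod (f z)) \<longlongrightarrow> cmod l) at_infinity" using l by (rule tendsto_norm)
  then have "\<forall>\<^sub>F z in at_infinity. cmod (f z) > c" using nz by (intro order_tendstoD(1)) (auto simp: c_def)
  then obtain B where B: "\<And>z. B \<le> cmod z \<Longrightarrow> cmod (f z) > c" unfolding eventually_at_infinity by blast
  obtain M where M: "\<And>z. z \<notin> S \<Longrightarrow> cmod z \<le> M" using S(2) unfolding bounded_iff by auto
  define a where "a = max 1 (max B (M + 1))"
  have a: "a > 0" "B \<le> a" "M < a" by (auto simp: a_def)
  show False
  proof (rule not_set_integrable_annuli[OF S(1) i \<open>c > 0\<close>])
    fix K :: real
    define b where "b = a * exp (\<bar>K\<bar> + 1)"
    have "ln (b / a) = \<bar>K\<bar> + 1" using a by (simp add: b_def)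
    moreover have "a \<le> b" using a by (auto simp: b_def)
    moreover have "\<forall>z\<in>ball (0::complex) b - ball 0 a. z \<in> S \<and> cmod (f z) \<ge> c"
    proof
      fix z :: complex assume "z \<in> ball 0 b - ball 0 a"
      then have z: "a \<le> cmod z" by auto
      have "z \<in> S" using M[of z] z a by fastforce
      then show "z \<in> S \<and> cmod (f z) \<ge> c" using B[of z] z a by auto
    qed
    ultimately show "\<exists>a b. 0 < a \<and> a \<le> b \<and> ln (b / a) > K \<and> (\<forall>z\<in>ball (0::complex) b - ball 0 a. z \<in> S \<and> cmod (f z) \<ge> c)"
      using a by (intro exI[of _ a] exI[of _ b]) auto
  qed
qed

section \<open>Cauchy's theorem for rectifiable cycles\<close>

definition closed_lip :: "(real \<Rightarrow> complex) \<Rightarrow> bool" where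
  "closed_lip g \<longleftrightarrow> pathfinish g = pathstart g \<and> (\<exists>C. C-lipschitz_on {0..1} g)"

text \<open>Cycles are lists of weighted curves; the weight \<open>-1\<close> stands for reversed orientation.\<close>

definition cyc_int :: "(complex \<times> (real \<Rightarrow> complex)) list \<Rightarrow> (complex \<Rightarrow> complex) \<Rightarrow> complex" where
  "cyc_int ps f = (\<Sum>p\<leftarrow>ps. fst p * contour_integral (snd p) f)"

definition cyc_img :: "(complex \<times> (real \<Rightarrow> complex)) list \<Rightarrow> complex set" where
  "cyc_img ps = (\<Union>p\<in>set ps. path_image (snd p))"

text \<open>On the curve itself \<^const>\<open>winding_number\<close> is unspecified, which would spoil Borel measurability.\<close>

definition wn0 :: "(real \<Rightarrow> complex) \<Rightarrow> complex \<Rightarrow> complex" where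
  "wn0 g z = (if z \<in> path_image g then 0 else winding_number g z)"

definition cyc_wn :: "(complex \<times> (real \<Rightarrow> complex)) list \<Rightarrow> complex \<Rightarrow> complex" where
  "cyc_wn ps z = (\<Sum>p\<leftarrow>ps. fst p * wn0 (snd p) z)"

lemma compact_path_image_lip: "C-lipschitz_on {0..1} g \<Longrightarrow> compact (path_image g)"
  unfolding path_image_def by (intro compact_continuous_image lipschitz_on_continuous_on) auto

lemma emeasure_cball_complex: "r \<ge> 0 \<Longrightarrow> emeasure lborel (cball (z::complex) r) = ennreal (pi * r\<^sup>2)"
  by (simp add: emeasure_cball unit_ball_vol_2)

lemma integral_norm_bound_AE:
  fixes f :: "'a \<Rightarrow> 'b::{banach, second_countable_topology}" and g :: "'a \<Rightarrow> real"
  assumes "integrable M f" "integrable M g" "AE x in M. norm (f x) \<le> g x"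
  shows "norm (\<integral>x. f x \<partial>M) \<le> (\<integral>x. g x \<partial>M)"
  using assms by (intro order_trans[OF integral_norm_bound integral_mono_AE]) auto

lemma wn0_measurable:
  assumes "C-lipschitz_on {0..1} g"
  shows "wn0 g \<in> borel_measurable borel"
proof -
  have p: "path g" using assms by (simp add: path_def lipschitz_on_continuous_on)
  have "open (- path_image g)" using compact_path_image_lip[OF assms] compact_imp_closed by blast
  then have "(\<lambda>z. indicator (- path_image g) z *\<^sub>R winding_number g z) \<in> borel_measurable borel"
    using continuous_on_winding_number[OF p] by (intro borel_measurable_continuous_on_indicator) auto
  moreover have "wn0 g = (\<lambda>z. indicator (- path_image g) z *\<^sub>R winding_number g z)"
    by (auto simp: wn0_def fun_eq_iff)
  ultimately show ?thesis by simp
qed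

text \<open>In effect a linear bound for the area of thin neighbourhoods, as in Minkowski content. A
  Borel superset \<open>T\<close> stands for the neighbourhood so that its own measurability need
  not be discussed.\<close>

definition tube_bound :: "complex set \<Rightarrow> real \<Rightarrow> bool" where
  "tube_bound S K \<longleftrightarrow> K \<ge> 0 \<and> (\<forall>e. 0 < e \<longrightarrow> e \<le> 1 \<longrightarrow>
     (\<exists>T\<in>sets borel. emeasure lborel T \<le> ennreal (K * e) \<and> (\<forall>u. \<forall>p\<in>S. dist u p \<le> e \<longrightarrow> u \<in> T)))"

lemma tube_boundE:
  assumes "tube_bound S K" "0 < e" "e \<le> 1"
  obtains T where "T \<in> sets borel" "emeasure lborel T \<le> ennreal (K * e)" "\<And>u p. p \<in> S \<Longrightarrow> dist u p \<le> e \<Longrightarrow> u \<in> T"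
proof -
  have "\<exists>T\<in>sets borel. emeasure lborel T \<le> ennreal (K * e) \<and> (\<forall>u. \<forall>p\<in>S. dist u p \<le> e \<longrightarrow> u \<in> T)"
    using assms by (simp add: tube_bound_def)
  then obtain T where T: "T \<in> sets borel" "emeasure lborel T \<le> ennreal (K * e)" "\<forall>u. \<forall>p\<in>S. dist u p \<le> e \<longrightarrow> u \<in> T"
    by (elim bexE conjE)
  show thesis by (rule that[OF T(1,2)]) (rule T(3)[rule_format])
qed

text \<open>About \<open>1/e\<close> equally spaced parameters give centres whose discs of radius
  \<open>(C + 1) * e\<close> cover the \<open>e\<close>-neighbourhood; the number of discs is at
  most \<open>3/e\<close> and each has area of order \<open>e^2\<close>.\<close>

lemma lipschitz_tube:
  assumes g: "C-lipschitz_on {0..1} g"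
  shows "tube_bound (path_image g) (3 * pi * (C + 1)\<^sup>2)"
  unfolding tube_bound_def
proof (intro conjI allI impI)
  show "0 \<le> 3 * pi * (C + 1)\<^sup>2" by simp
  have C0: "C \<ge> 0" using g by (rule lipschitz_on_nonneg)
  fix e :: real assume e: "0 < e" "e \<le> 1"
  \<comment> \<open>Rounding up makes the parameter spacing at most \<open>e\<close>. Because
    \<open>e \<le> 1\<close>, there are at most \<open>2/e\<close> steps and hence at most
    \<open>3/e\<close> sample points.\<close>
  define N where "N = nat \<lceil>1 / e\<rceil>"
  have N1: "1 / e \<le> real N" unfolding N_def by (rule real_nat_ceiling_ge)
  have N2: "real N \<le> 2 / e"
  proof -
    have "real N < 1 / e + 1" unfolding N_def using e by (simp add: ceiling_correct) linarith
    moreover have "1 \<le> 1 / e" using e by simp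
    ultimately show ?thesis by simp
  qed
  have Npos: "real N > 0" using N1 e by (smt (verit) divide_pos_pos)
  have Ne: "1 / real N \<le> e" using N1 e Npos by (simp add: field_simps)
  define T where "T = (\<Union>i\<le>N. cball (g (real i / real N)) ((C + 1) * e))"
  have Tm: "T \<in> sets borel" unfolding T_def by auto
  have "emeasure lborel T \<le> (\<Sum>i\<le>N. emeasure lborel (cball (g (real i / real N)) ((C + 1) * e)))"
    unfolding T_def by (intro emeasure_subadditive_finite) auto
  also have "\<dots> = (\<Sum>i\<le>N. ennreal (pi * ((C + 1) * e)\<^sup>2))"
    using C0 e by (intro sum.cong emeasure_cball_complex) auto
  also have "\<dots> = ennreal (real (N + 1) * (pi * ((C + 1) * e)\<^sup>2))"
    by (subst sum_ennreal) auto
  also have "\<dots> \<le> ennreal (3 * pi * (C + 1)\<^sup>2 * e)"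
  proof (rule ennreal_leI)
    have "real (N + 1) \<le> 3 / e" using N2 e by (simp add: field_simps)
    then have "real (N + 1) * (pi * ((C + 1) * e)\<^sup>2) \<le> 3 / e * (pi * ((C + 1) * e)\<^sup>2)"
      by (intro mult_right_mono) auto
    also have "\<dots> = 3 * pi * (C + 1)\<^sup>2 * e" using e by (simp add: power_mult_distrib power2_eq_square)
    finally show "real (N + 1) * (pi * ((C + 1) * e)\<^sup>2) \<le> 3 * pi * (C + 1)\<^sup>2 * e" .
  qed
  finally have Te: "emeasure lborel T \<le> ennreal (3 * pi * (C + 1)\<^sup>2 * e)" .
  have "u \<in> T" if p: "p \<in> path_image g" "dist u p \<le> e" for u p
  proof -
    obtain t where t: "t \<in> {0..1}" "p = g t" using p(1) by (auto simp: path_image_def)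
    define i where "i = nat \<lfloor>t * real N\<rfloor>"
    have i: "real i \<le> t * real N" "t * real N < real i + 1"
      unfolding i_def using t(1) by (auto simp: of_nat_nat)
    have "t * real N \<le> 1 * real N" using t by (intro mult_right_mono) auto
    then have iN: "i \<le> N" using i(1) by linarith
    have s: "real i / real N \<in> {0..1}" using iN Npos by auto
    have "t - real i / real N = (t * real N - real i) / real N" using Npos by (simp add: field_simps)
    moreover have "\<bar>t * real N - real i\<bar> / real N \<le> 1 / real N" using i Npos by (intro divide_right_mono) auto
    ultimately have "\<bar>t - real i / real N\<bar> \<le> 1 / real N" by (simp add: abs_divide)
    then have "dist t (real i / real N) \<le> e" using Ne by (simp add: dist_real_def)
    then have "C * dist t (real i / real N) \<le> C * e" using C0 by (rule mult_left_mono)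
    then have "dist (g t) (g (real i / real N)) \<le> C * e" using lipschitz_onD[OF g t(1) s] by linarith
    then have "dist (g (real i / real N)) u \<le> (C + 1) * e"
      using p(2) t(2) dist_triangle2[of "g (real i / real N)" u "g t"] by (simp add: algebra_simps dist_commute)
    then show ?thesis using iN unfolding T_def by auto
  qed
  then show "\<exists>T\<in>sets borel. emeasure lborel T \<le> ennreal (3 * pi * (C + 1)\<^sup>2 * e) \<and>
     (\<forall>u. \<forall>p\<in>path_image g. dist u p \<le> e \<longrightarrow> u \<in> T)"
    using Tm Te by blast
qed

lemma cycle_tube:
  assumes "\<And>p. p \<in> set ps \<Longrightarrow> closed_lip (snd p)"
  shows "\<exists>K. tube_bound (cyc_img ps) K"
  using assms
proof (induction ps)
  case Nil
  show ?case by (intro exI[of _ 0]) (auto simp: cyc_img_def tube_bound_def intro!: bexI[of _ "{}"])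
next
  case (Cons q ps)
  obtain C where "C-lipschitz_on {0..1} (snd q)" using Cons.prems[of q] by (auto simp: closed_lip_def)
  from lipschitz_tube[OF this] obtain K1 where K1: "tube_bound (path_image (snd q)) K1" by blast
  obtain K2 where K2: "tube_bound (cyc_img ps) K2" using Cons by auto
  have K0: "K1 \<ge> 0" "K2 \<ge> 0" using K1 K2 by (auto simp: tube_bound_def)
  have "tube_bound (cyc_img (q # ps)) (K1 + K2)"
    unfolding tube_bound_def
  proof (intro conjI allI impI)
    have un: "cyc_img (q # ps) = path_image (snd q) \<union> cyc_img ps" by (simp add: cyc_img_def)
    show "0 \<le> K1 + K2" using K0 by simp
    fix e :: real assume e: "0 < e" "e \<le> 1"
    obtain T1 where T1: "T1 \<in> sets borel" "emeasure lborel T1 \<le> ennreal (K1 * e)"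
      "\<And>u p. p \<in> path_image (snd q) \<Longrightarrow> dist u p \<le> e \<Longrightarrow> u \<in> T1" using tube_boundE[OF K1 e] by metis
    obtain T2 where T2: "T2 \<in> sets borel" "emeasure lborel T2 \<le> ennreal (K2 * e)"
      "\<And>u p. p \<in> cyc_img ps \<Longrightarrow> dist u p \<le> e \<Longrightarrow> u \<in> T2" using tube_boundE[OF K2 e] by metis
    have "emeasure lborel (T1 \<union> T2) \<le> ennreal (K1 * e) + ennreal (K2 * e)"
      using T1 T2 by (intro order_trans[OF emeasure_subadditive] add_mono) auto
    also have "\<dots> = ennreal ((K1 + K2) * e)" using K0 e by (simp add: ennreal_plus[symmetric] distrib_right del: ennreal_plus)
    finally have "emeasure lborel (T1 \<union> T2) \<le> ennreal ((K1 + K2) * e)" .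
    then show "\<exists>T\<in>sets borel. emeasure lborel T \<le> ennreal ((K1 + K2) * e) \<and>
       (\<forall>u. \<forall>p\<in>cyc_img (q # ps). dist u p \<le> e \<longrightarrow> u \<in> T)"
      using T1(3) T2(3) sets.Un[OF T1(1) T2(1)] unfolding un by blast
  qed
  then show ?case by blast
qed

text \<open>The cycle lies in each of its neighbourhoods, whose areas are bounded by
  \<open>K * e\<close> with arbitrarily small \<open>e\<close>.\<close>

lemma cyc_img_null:
  assumes ps: "\<And>p. p \<in> set ps \<Longrightarrow> closed_lip (snd p)"
  shows "cyc_img ps \<in> null_sets lborel" "compact (cyc_img ps)"
proof -
  show c: "compact (cyc_img ps)" unfolding cyc_img_def
    using ps by (intro compact_UN) (auto simp: closed_lip_def intro: compact_path_image_lip)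
  have b: "cyc_img ps \<in> sets borel" using compact_imp_closed[OF c] by auto
  obtain K where Kt: "tube_bound (cyc_img ps) K" using cycle_tube[of ps] ps by blast
  then have K: "K \<ge> 0" by (simp add: tube_bound_def)
  have small: "emeasure lborel (cyc_img ps) \<le> ennreal \<delta>" if \<delta>: "\<delta> > 0" for \<delta>
  proof -
    define e where "e = min 1 (\<delta> / (K + 1))"
    have e: "0 < e" "e \<le> 1" using K \<delta> by (auto simp: e_def)
    obtain T where T: "T \<in> sets borel" "emeasure lborel T \<le> ennreal (K * e)"
      "\<And>u p. p \<in> cyc_img ps \<Longrightarrow> dist u p \<le> e \<Longrightarrow> u \<in> T" using tube_boundE[OF Kt e] by metis
    have "cyc_img ps \<subseteq> T" using T(3) e by (auto simp: less_imp_le)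
    then have "emeasure lborel (cyc_img ps) \<le> emeasure lborel T" using T(1) by (intro emeasure_mono) auto
    also have "\<dots> \<le> ennreal (K * e)" by fact
    also have "\<dots> \<le> ennreal \<delta>"
    proof (rule ennreal_leI)
      have "K * e \<le> (K + 1) * (\<delta> / (K + 1))" using K e by (intro mult_mono) (auto simp: e_def)
      then show "K * e \<le> \<delta>" using K by simp
    qed
    finally show ?thesis .
  qed
  have "emeasure lborel (cyc_img ps) \<le> 0"
  proof (rule ennreal_le_epsilon)
    fix \<delta> :: real assume "0 < \<delta>"
    then show "emeasure lborel (cyc_img ps) \<le> 0 + ennreal \<delta>" using small[of \<delta>] by simp
  qed
  then show "cyc_img ps \<in> null_sets lborel" using b by (intro null_setsI) auto
qed

section \<open>Cauchy transforms of bounded densities, integrated along cycles\<close>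

lemma nn_integral_inverse_ball_0:
  assumes "R \<ge> 0"
  shows "(\<integral>\<^sup>+u. ennreal (1 / cmod (u - a)) * indicator (ball 0 R) u \<partial>lborel) \<le> ennreal (2 * pi * (R + cmod a))"
proof -
  have "(\<integral>\<^sup>+u. ennreal (1 / cmod (u - a)) * indicator (ball 0 R) u \<partial>lborel)
     \<le> (\<integral>\<^sup>+u. ennreal (1 / cmod (a - u)) * indicator (ball a (R + cmod a)) u \<partial>lborel)"
  proof (rule nn_integral_mono)
    fix u :: complex
    have "u \<in> ball a (R + cmod a)" if "u \<in> ball 0 R"
      using that norm_triangle_ineq4[of a u] by (auto simp: dist_norm)
    then show "ennreal (1 / cmod (u - a)) * indicator (ball 0 R) u \<le> ennreal (1 / cmod (a - u)) * indicator (ball a (R + cmod a)) u"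
      by (auto simp: norm_minus_commute split: split_indicator)
  qed
  then show ?thesis using nn_integral_inverse_ball[of "R + cmod a" a] assms by simp
qed

text \<open>Fubini turns the integral along \<open>g\<close> of the Cauchy transform of
  \<open>G\<close> into the area integral of \<open>G u\<close> times the curve integral of
  \<open>1/(u - w)\<close>. The latter is minus \<open>2 pi \<i>\<close> times the winding number
  for every \<open>u\<close> off the curve, a null set. Replacing the transform by \<open>f\<close>
  costs \<eta> times the bound \<open>2 * C\<close> for the speed.\<close>

lemma curve_cauchy_transform:
  fixes G :: "complex \<Rightarrow> complex"
  assumes g: "C-lipschitz_on {0..1} g" "pathfinish g = pathstart g"
    and G[measurable]: "G \<in> borel_measurable borel" and Gb: "\<And>u. cmod (G u) \<le> M * indicator (ball 0 R) u" "M \<ge> 0" "R \<ge> 0"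
    and f: "continuous_on (path_image g) f"
    and ap: "\<And>w. w \<in> path_image g \<Longrightarrow> cmod ((\<integral>u. G u / (u - w) \<partial>lborel) - f w) \<le> \<eta>"
  shows "integrable lborel (\<lambda>u. G u * wn0 g u)"
    and "cmod (contour_integral g f + 2 * of_real pi * \<i> * (\<integral>u. G u * wn0 g u \<partial>lborel)) \<le> 2 * C * \<eta>"
proof -
  have C0: "C \<ge> 0" using g(1) by (rule lipschitz_on_nonneg)
  have gc: "continuous_on {0..1} g" using g(1) by (rule lipschitz_on_continuous_on)
  define \<gamma> where "\<gamma> t = g (clamp01 t)" for t
  have "continuous_on UNIV \<gamma>" unfolding \<gamma>_def
    by (rule continuous_on_compose2[OF gc]) (auto simp: clamp01_def intro!: continuous_intros)
  then have \<gamma>m[measurable]: "\<gamma> \<in> borel_measurable borel" by (rule borel_measurable_continuous_onI)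
  have \<gamma>g: "\<gamma> t = g t" if "t \<in> {0..1}" for t using that by (simp add: \<gamma>_def clamp01_id)
  have \<gamma>im: "\<gamma> t \<in> path_image g" for t unfolding \<gamma>_def path_image_def using clamp01_range by blast
  have dm[measurable]: "curve_deriv g \<in> borel_measurable borel" by (rule curve_deriv_props(1)[OF g(1)])
  obtain A where A: "\<And>w. w \<in> path_image g \<Longrightarrow> cmod w \<le> A"
    using compact_imp_bounded[OF compact_path_image_lip[OF g(1)]] unfolding bounded_iff by blast
  have A0: "A \<ge> 0" by (rule order_trans[OF norm_ge_zero A[OF \<gamma>im[of 0]]])
  have bd: "AE t in lborel. cmod (curve_deriv g t) \<le> 2 * C" by (rule curve_deriv_props(2)[OF g(1)])
  define F where "F t u = G u / (u - \<gamma> t) * curve_deriv g t" for t u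
  have Fm: "case_prod F \<in> borel_measurable (lborel \<Otimes>\<^sub>M lborel)" unfolding F_def by measurable
  define B where "B = 2 * C * (M * (2 * pi * (R + A)))"
  have FB: "AE t in lborel. t \<in> {0..1} \<longrightarrow> (\<integral>\<^sup>+u. ennreal (cmod (F t u)) \<partial>lborel) \<le> ennreal B"
    using bd
  proof eventually_elim
    case (elim t)
    have "(\<integral>\<^sup>+u. ennreal (cmod (F t u)) \<partial>lborel) \<le> (\<integral>\<^sup>+u. ennreal (2 * C * M) * (ennreal (1 / cmod (u - \<gamma> t)) * indicator (ball 0 R) u) \<partial>lborel)"
    proof (rule nn_integral_mono)
      fix u
      have "cmod (F t u) = cmod (G u) * (1 / cmod (u - \<gamma> t)) * cmod (curve_deriv g t)"
        by (simp add: F_def norm_mult norm_divide)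
      also have "\<dots> \<le> M * indicator (ball 0 R) u * (1 / cmod (u - \<gamma> t)) * (2 * C)"
        using Gb C0 elim by (intro mult_mono mult_nonneg_nonneg) auto
      finally have "cmod (F t u) \<le> 2 * C * M * (1 / cmod (u - \<gamma> t) * indicator (ball 0 R) u)" by (simp add: mult_ac)
      then have "ennreal (cmod (F t u)) \<le> ennreal (2 * C * M * (1 / cmod (u - \<gamma> t) * indicator (ball 0 R) u))" by (rule ennreal_leI)
      also have "\<dots> = ennreal (2 * C * M) * (ennreal (1 / cmod (u - \<gamma> t)) * indicator (ball 0 R) u)"
        using C0 Gb by (subst ennreal_mult) (auto split: split_indicator)
      finally show "ennreal (cmod (F t u)) \<le> ennreal (2 * C * M) * (ennreal (1 / cmod (u - \<gamma> t)) * indicator (ball 0 R) u)" .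
    qed
    also have "\<dots> = ennreal (2 * C * M) * (\<integral>\<^sup>+u. ennreal (1 / cmod (u - \<gamma> t)) * indicator (ball 0 R) u \<partial>lborel)"
      by (rule nn_integral_cmult) measurable
    also have "\<dots> \<le> ennreal (2 * C * M) * ennreal (2 * pi * (R + A))"
    proof (rule mult_left_mono)
      have "2 * pi * (R + cmod (\<gamma> t)) \<le> 2 * pi * (R + A)" using A[OF \<gamma>im[of t]] by simp
      then show "(\<integral>\<^sup>+u. ennreal (1 / cmod (u - \<gamma> t)) * indicator (ball 0 R) u \<partial>lborel) \<le> ennreal (2 * pi * (R + A))"
        by (rule order_trans[OF nn_integral_inverse_ball_0[OF Gb(3)] ennreal_leI])
    qed simp
    also have "\<dots> = ennreal B" unfolding B_def using C0 Gb A0 by (simp add: ennreal_mult[symmetric] mult.assoc)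
    finally show ?case by simp
  qed
  note swap = integral_swap_interval_plane[OF Fm FB]
  have inner: "AE u in lborel. (LINT t:{0..1}|lborel. F t u) = - (2 * of_real pi * \<i>) * (G u * wn0 g u)"
  proof -
    have "cyc_img [(1, g)] \<in> null_sets lborel"
      by (rule cyc_img_null(1)) (use g in \<open>auto simp: closed_lip_def\<close>)
    then have "AE u in lborel. u \<notin> path_image g" using AE_not_in by (fastforce simp: cyc_img_def)
    then show ?thesis
    proof eventually_elim
      case (elim u)
      have c: "continuous_on (path_image g) (\<lambda>w. 1 / (w - u))"
        using elim by (intro continuous_intros) auto
      have "(LINT t:{0..1}|lborel. F t u) = (LINT t:{0..1}|lborel. - G u * (1 / (g t - u) * curve_deriv g t))"
      proof (intro set_lebesgue_integral_cong allI impI)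
        fix t :: real assume t: "t \<in> {0..1}"
        have "G u / (u - g t) = - G u / (g t - u)" by (metis minus_diff_eq minus_divide_left minus_divide_right)
        then show "F t u = - G u * (1 / (g t - u) * curve_deriv g t)" unfolding F_def \<gamma>g[OF t] by simp
      qed simp
      also have "\<dots> = - G u * (LINT t:{0..1}|lborel. 1 / (g t - u) * curve_deriv g t)" by (rule set_integral_mult_right)
      also have "(LINT t:{0..1}|lborel. 1 / (g t - u) * curve_deriv g t) = contour_integral g (\<lambda>w. 1 / (w - u))"
        by (rule lipschitz_curve_integrable(3)[OF g(1) c, symmetric])
      also have "\<dots> = 2 * of_real pi * \<i> * wn0 g u"
        using contour_integral_unique[OF lipschitz_winding_number_integral[OF g elim]] elim by (simp add: wn0_def)
      finally show ?case by (simp add: mult_ac)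
    qed
  qed
  \<comment> \<open>Fubini provides integrability for the inner integral. Dividing by the constant
    transfers it to \<open>G u * wn0 g u\<close>, which agrees with \<open>H\<close> only almost
    everywhere.\<close>
  define H where "H u = (LINT t:{0..1}|lborel. F t u) / (- (2 * of_real pi * \<i>))" for u
  have Hi: "integrable lborel H" unfolding H_def by (intro integrable_divide swap(2))
  have HG: "AE u in lborel. H u = G u * wn0 g u"
    using inner by eventually_elim (simp add: H_def)
  have wm: "(\<lambda>u. G u * wn0 g u) \<in> borel_measurable lborel"
    using wn0_measurable[OF g(1)] G by simp
  show "integrable lborel (\<lambda>u. G u * wn0 g u)"
    using Hi HG wm by (subst integrable_cong_AE[of _ _ H]) auto
  have "(LINT t:{0..1}|lborel. (\<integral>u. F t u \<partial>lborel)) = (\<integral>u. (LINT t:{0..1}|lborel. F t u) \<partial>lborel)" by (rule swap(1))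
  also have "\<dots> = (\<integral>u. - (2 * of_real pi * \<i>) * (G u * wn0 g u) \<partial>lborel)"
    using inner swap(2) wm by (intro integral_cong_AE) auto
  also have "\<dots> = - (2 * of_real pi * \<i> * (\<integral>u. G u * wn0 g u \<partial>lborel))" by simp
  finally have val: "2 * of_real pi * \<i> * (\<integral>u. G u * wn0 g u \<partial>lborel) = - (LINT t:{0..1}|lborel. (\<integral>u. F t u \<partial>lborel))"
    by simp
  have Feq: "(\<integral>u. F t u \<partial>lborel) = (\<integral>u. G u / (u - \<gamma> t) \<partial>lborel) * curve_deriv g t" for t
    unfolding F_def by (rule integral_mult_left_zero)
  note ci = lipschitz_curve_integrable[OF g(1) f]
  have \<eta>: "\<eta> \<ge> 0" by (rule order_trans[OF norm_ge_zero ap[OF \<gamma>im[of 0]]])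
  have "contour_integral g f + 2 * of_real pi * \<i> * (\<integral>u. G u * wn0 g u \<partial>lborel)
     = (LINT t:{0..1}|lborel. f (g t) * curve_deriv g t - (\<integral>u. F t u \<partial>lborel))"
    unfolding val ci(3) using ci(1) swap(3) by (subst set_integral_diff(2)) auto
  also have "cmod \<dots> \<le> (LINT t:{0..1::real}|lborel. 2 * C * \<eta>)"
    unfolding set_lebesgue_integral_def
  proof (rule integral_norm_bound_AE[where M = lborel and f = "\<lambda>t. indicator {0..1} t *\<^sub>R (f (g t) * curve_deriv g t - (\<integral>u. F t u \<partial>lborel))"
        and g = "\<lambda>t. indicator {0..1} t *\<^sub>R (2 * C * \<eta>)"])
    show "integrable lborel (\<lambda>t. indicator {0..1} t *\<^sub>R (f (g t) * curve_deriv g t - (\<integral>u. F t u \<partial>lborel)))"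
      using set_integral_diff(1)[OF ci(1) swap(3)] by (simp add: set_integrable_def)
    show "integrable lborel (\<lambda>t::real. indicator {0..1} t *\<^sub>R (2 * C * \<eta>))" by simp
    show "AE t in lborel. norm (indicator {0..1} t *\<^sub>R (f (g t) * curve_deriv g t - (\<integral>u. F t u \<partial>lborel))) \<le> indicator {0..1} t *\<^sub>R (2 * C * \<eta>)"
      using bd
    proof eventually_elim
      case (elim t)
      show ?case
      proof (cases "t \<in> {0..1}")
        case True
        have "f (g t) * curve_deriv g t - (\<integral>u. F t u \<partial>lborel) = (f (\<gamma> t) - (\<integral>u. G u / (u - \<gamma> t) \<partial>lborel)) * curve_deriv g t"
          unfolding Feq \<gamma>g[OF True, symmetric] by (simp add: left_diff_distrib)
        then have "cmod (f (g t) * curve_deriv g t - (\<integral>u. F t u \<partial>lborel)) = cmod ((\<integral>u. G u / (u - \<gamma> t) \<partial>lborel) - f (\<gamma> t)) * cmod (curve_deriv g t)"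
          by (simp add: norm_mult norm_minus_commute)
        also have "\<dots> \<le> \<eta> * (2 * C)" using ap[OF \<gamma>im[of t]] elim \<eta> by (intro mult_mono) auto
        finally show ?thesis using True by (simp add: mult_ac)
      qed simp
    qed
  qed
  also have "\<dots> = 2 * C * \<eta>" by (simp add: set_lebesgue_integral_def)
  finally show "cmod (contour_integral g f + 2 * of_real pi * \<i> * (\<integral>u. G u * wn0 g u \<partial>lborel)) \<le> 2 * C * \<eta>" .
qed

text \<open>The constant \<open>L\<close> is fixed before the density \<open>G\<close> and the error
  \<eta>, so one \<open>L\<close> serves mollifications at all scales.\<close>

definition cauchy_bound :: "(complex \<times> (real \<Rightarrow> complex)) list \<Rightarrow> (complex \<Rightarrow> complex) \<Rightarrow> real \<Rightarrow> bool" where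
  "cauchy_bound ps f L \<longleftrightarrow> (\<forall>G M R \<eta>. G \<in> borel_measurable borel \<longrightarrow> (\<forall>u. cmod (G u) \<le> M * indicator (ball 0 R) u) \<longrightarrow> M \<ge> 0 \<longrightarrow> R \<ge> 0 \<longrightarrow>
     (\<forall>w\<in>cyc_img ps. cmod ((\<integral>u. G u / (u - w) \<partial>lborel) - f w) \<le> \<eta>) \<longrightarrow>
     integrable lborel (\<lambda>u. G u * cyc_wn ps u) \<and>
     cmod (cyc_int ps f + 2 * of_real pi * \<i> * (\<integral>u. G u * cyc_wn ps u \<partial>lborel)) \<le> L * \<eta>)"

lemma cycle_cauchy_transform:
  assumes "\<And>p. p \<in> set ps \<Longrightarrow> closed_lip (snd p)" "continuous_on (cyc_img ps) f"
  shows "\<exists>L. cauchy_bound ps f L"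
  using assms
proof (induction ps)
  case Nil
  show ?case by (intro exI[of _ 0]) (auto simp: cauchy_bound_def cyc_int_def cyc_wn_def)
next
  case (Cons q ps)
  have un: "cyc_img (q # ps) = path_image (snd q) \<union> cyc_img ps" by (simp add: cyc_img_def)
  obtain C where C: "C-lipschitz_on {0..1} (snd q)" "pathfinish (snd q) = pathstart (snd q)"
    using Cons.prems(1)[of q] by (auto simp: closed_lip_def)
  have cont: "continuous_on (path_image (snd q)) f" "continuous_on (cyc_img ps) f"
    using Cons.prems(2) unfolding un by (auto intro: continuous_on_subset)
  obtain L where L: "cauchy_bound ps f L" using Cons.IH[OF _ cont(2)] Cons.prems(1) by auto
  have "cauchy_bound (q # ps) f (cmod (fst q) * (2 * C) + L)"
    unfolding cauchy_bound_def
  proof (intro allI impI)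
    fix G M R \<eta>
    assume G: "G \<in> borel_measurable borel" "\<forall>u. cmod (G u) \<le> M * indicator (ball 0 R) u" "M \<ge> 0" "R \<ge> 0"
      and ap: "\<forall>w\<in>cyc_img (q # ps). cmod ((\<integral>u. G u / (u - w) \<partial>lborel) - f w) \<le> \<eta>"
    have 1: "integrable lborel (\<lambda>u. G u * wn0 (snd q) u)"
      "cmod (contour_integral (snd q) f + 2 * of_real pi * \<i> * (\<integral>u. G u * wn0 (snd q) u \<partial>lborel)) \<le> 2 * C * \<eta>"
      using curve_cauchy_transform[OF C G(1) G(2)[rule_format] G(3,4) cont(1), of \<eta>] ap un by auto
    have 2: "integrable lborel (\<lambda>u. G u * cyc_wn ps u)"
      "cmod (cyc_int ps f + 2 * of_real pi * \<i> * (\<integral>u. G u * cyc_wn ps u \<partial>lborel)) \<le> L * \<eta>"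
      using L[unfolded cauchy_bound_def, rule_format, OF G(1) G(2)[rule_format] G(3,4), of \<eta>] ap un by auto
    have eq: "(\<lambda>u. G u * cyc_wn (q # ps) u) = (\<lambda>u. fst q * (G u * wn0 (snd q) u) + G u * cyc_wn ps u)"
      by (simp add: cyc_wn_def fun_eq_iff algebra_simps)
    have "cyc_int (q # ps) f + 2 * of_real pi * \<i> * (\<integral>u. G u * cyc_wn (q # ps) u \<partial>lborel)
       = fst q * (contour_integral (snd q) f + 2 * of_real pi * \<i> * (\<integral>u. G u * wn0 (snd q) u \<partial>lborel))
         + (cyc_int ps f + 2 * of_real pi * \<i> * (\<integral>u. G u * cyc_wn ps u \<partial>lborel))"
    proof -
      have "(\<integral>u. fst q * (G u * wn0 (snd q) u) + G u * cyc_wn ps u \<partial>lborel)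
         = fst q * (\<integral>u. G u * wn0 (snd q) u \<partial>lborel) + (\<integral>u. G u * cyc_wn ps u \<partial>lborel)"
        using 1(1) 2(1) by (subst Bochner_Integration.integral_add) auto
      then show ?thesis unfolding eq by (simp add: cyc_int_def algebra_simps)
    qed
    also have "cmod \<dots> \<le> cmod (fst q) * (2 * C * \<eta>) + L * \<eta>"
      by (rule order_trans[OF norm_triangle_ineq add_mono[OF _ 2(2)]])
         (simp only: norm_mult mult_left_mono[OF 1(2)] norm_ge_zero)
    finally have "cmod (cyc_int (q # ps) f + 2 * of_real pi * \<i> * (\<integral>u. G u * cyc_wn (q # ps) u \<partial>lborel)) \<le> (cmod (fst q) * (2 * C) + L) * \<eta>"
      by (simp add: algebra_simps)
    moreover have "integrable lborel (\<lambda>u. G u * cyc_wn (q # ps) u)" unfolding eq using 1(1) 2(1) by simp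
    ultimately show "integrable lborel (\<lambda>u. G u * cyc_wn (q # ps) u) \<and>
       cmod (cyc_int (q # ps) f + 2 * of_real pi * \<i> * (\<integral>u. G u * cyc_wn (q # ps) u \<partial>lborel)) \<le> (cmod (fst q) * (2 * C) + L) * \<eta>"
      by blast
  qed
  then show ?case by blast
qed

section \<open>Mollification by disc averages\<close>

lemma circle_mean_ball:
  assumes e: "e > 0" and ne: "cmod y \<noteq> e"
  shows "(LINT t:{0..1}|lborel. (e * exp (2 * of_real pi * \<i> * of_real t)) / (e * exp (2 * of_real pi * \<i> * of_real t) - y)) = (if cmod y < e then 1 else 0)"
proof -
  have cm: "(LINT t:{0..1}|lborel. 1 / (y - exp (2 * of_real pi * \<i> * of_real t) * of_real e)) = (if e < cmod y then 1 / y else 0)"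
    using circle_mean_inverse[of "of_real e" y] e ne by simp
  have nz: "y - exp (2 * of_real pi * \<i> * of_real t) * of_real e \<noteq> 0" for t :: real
  proof
    assume "y - exp (2 * of_real pi * \<i> * of_real t) * of_real e = 0"
    then have "cmod y = cmod (exp (2 * of_real pi * \<i> * of_real t) * of_real e)" by simp
    then show False using ne e by (simp add: norm_mult)
  qed
  \<comment> \<open>The identity \<open>a / (a - y) = 1 - y / (y - a)\<close> reduces the claim to
    the mean of the Cauchy kernel; the result is the indicator of the disc of radius
    \<open>e\<close>.\<close>
  have id: "(e * exp (2 * of_real pi * \<i> * of_real t)) / (e * exp (2 * of_real pi * \<i> * of_real t) - y)
     = 1 - y * (1 / (y - exp (2 * of_real pi * \<i> * of_real t) * of_real e))" for t :: real
  proof -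
    have gen: "a / (a - y) = 1 - y * (1 / (y - a))" if "y - a \<noteq> 0" for a
      using that by (simp add: divide_simps) (simp add: algebra_simps)
    show ?thesis using gen[of "exp (2 * of_real pi * \<i> * of_real t) * of_real e"] nz[of t] by (simp add: mult.commute)
  qed
  have cont: "continuous_on {0..1::real} (\<lambda>t. 1 / (y - exp (2 * of_real pi * \<i> * of_real t) * of_real e))"
    using nz by (intro continuous_intros) auto
  have si: "set_integrable lborel {0..1::real} (\<lambda>t. y * (1 / (y - exp (2 * of_real pi * \<i> * of_real t) * of_real e)))"
    by (intro borel_integrable_atLeastAtMost' continuous_on_mult_left cont)
  have si1: "set_integrable lborel {0..1::real} (\<lambda>t. 1::complex)"
    by (intro borel_integrable_atLeastAtMost' continuous_intros)
  have "(LINT t:{0..1}|lborel. (e * exp (2 * of_real pi * \<i> * of_real t)) / (e * exp (2 * of_real pi * \<i> * of_real t) - y))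
     = (LINT t:{0..1::real}|lborel. 1) - y * (LINT t:{0..1}|lborel. 1 / (y - exp (2 * of_real pi * \<i> * of_real t) * of_real e))"
    unfolding id by (subst set_integral_diff(2)[OF si1 si]) (simp only: set_integral_mult_right)
  also have "(LINT t:{0..1::real}|lborel. (1::complex)) = 1" by (simp add: set_lebesgue_integral_def)
  finally show ?thesis unfolding cm using e ne by auto
qed

lemma lborel_integral_shift:
  fixes f :: "complex \<Rightarrow> complex"
  assumes [measurable]: "f \<in> borel_measurable borel"
  shows "(\<integral>z. f (z + a) \<partial>lborel) = (\<integral>z. f z \<partial>lborel)"
proof -
  have "(\<integral>z. f z \<partial>lborel) = (\<integral>z. f z \<partial>(distr lborel borel ((+) a)))" by (simp add: lborel_distr_plus)
  also have "\<dots> = (\<integral>z. f (z + a) \<partial>lborel)" by (subst integral_distr) (auto simp: add.commute)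
  finally show ?thesis by simp
qed

lemma nn_integral_shift:
  fixes f :: "complex \<Rightarrow> ennreal"
  assumes [measurable]: "f \<in> borel_measurable borel"
  shows "(\<integral>\<^sup>+z. f (z + a) \<partial>lborel) = (\<integral>\<^sup>+z. f z \<partial>lborel)"
proof -
  have "(\<integral>\<^sup>+z. f z \<partial>lborel) = (\<integral>\<^sup>+z. f z \<partial>(distr lborel borel ((+) a)))" by (simp add: lborel_distr_plus)
  also have "\<dots> = (\<integral>\<^sup>+z. f (z + a) \<partial>lborel)" by (subst nn_integral_distr) (auto simp: add.commute)
  finally show ?thesis by simp
qed

text \<open>\<open>mollifier_density f e\<close> is (up to sign) the \<open>\<partial>\<close>-bar derivative of the disc average of \<open>f\<close>;
  it is the Morera integral of \<open>f\<close> over a circle, so it exists without any smoothness of \<open>f\<close>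
  and vanishes where \<open>f\<close> is holomorphic.\<close>

definition mollifier_density :: "(complex \<Rightarrow> complex) \<Rightarrow> real \<Rightarrow> complex \<Rightarrow> complex" where
  "mollifier_density f e u = of_real (1 / (pi * e\<^sup>2)) * (LINT t:{0..1}|lborel.
     f (u - e * exp (2 * of_real pi * \<i> * of_real t)) * (e * exp (2 * of_real pi * \<i> * of_real t)))"

text \<open>Two interchanges of integration surround the translation \<open>u = z + E t\<close>. The
  angular mean then hits only \<open>E t / (E t - (w - z))\<close>, and it equals 1 for
  \<open>z\<close> in the disc of radius \<open>e\<close> around \<open>w\<close> and 0 outside its
  closure. What is left is the average of \<open>f\<close> over the disc.\<close>

lemma mollifier_cauchy_transform:
  fixes f :: "complex \<Rightarrow> complex"
  assumes c: "continuous_on UNIV f" and sup: "\<And>z. z \<notin> ball 0 R \<Longrightarrow> f z = 0" and R: "R \<ge> 0" and e: "e > 0"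
  shows "mollifier_density f e \<in> borel_measurable borel"
    and "(\<integral>u. mollifier_density f e u / (u - w) \<partial>lborel) = of_real (1 / (pi * e\<^sup>2)) * (LINT z:ball w e|lborel. f z)"
proof -
  define E where "E t = e * exp (2 * of_real pi * \<i> * of_real t)" for t :: real
  have Em[measurable]: "E \<in> borel_measurable borel" unfolding E_def by measurable
  have En: "cmod (E t) = e" for t using e by (simp add: E_def norm_mult)
  have fm[measurable]: "f \<in> borel_measurable borel" using c by (rule borel_measurable_continuous_onI)
  have "compact (f ` cball 0 R)" by (intro compact_continuous_image continuous_on_subset[OF c]) auto
  then have "bounded (f ` cball 0 R)" by (rule compact_imp_bounded)
  then obtain M where M: "\<And>z. z \<in> cball 0 R \<Longrightarrow> cmod (f z) \<le> M"
    unfolding bounded_iff by blast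
  have M0: "M \<ge> 0" using R order_trans[OF norm_ge_zero M[of 0]] by simp
  have fM: "cmod (f z) \<le> M * indicator (ball 0 R) z" for z
    using M[of z] sup[of z] M0 by (cases "z \<in> ball 0 R") auto
  have dens: "mollifier_density f e u = of_real (1 / (pi * e\<^sup>2)) * (LINT t:{0..1}|lborel. f (u - E t) * E t)" for u
    by (simp add: mollifier_density_def E_def)
  define F where "F t z = f z * (E t / (E t - (w - z)))" for t z
  define H where "H t u = f (u - E t) * E t / (u - w)" for t u
  \<comment> \<open>The translation moves the argument of \<open>f\<close> to a point independent of
    the angle.\<close>
  have HF: "H t (z + E t) = F t z" for t z by (simp add: H_def F_def algebra_simps)
  have Fm[measurable]: "case_prod F \<in> borel_measurable (lborel \<Otimes>\<^sub>M lborel)" unfolding F_def by measurable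
  have Hm[measurable]: "case_prod H \<in> borel_measurable (lborel \<Otimes>\<^sub>M lborel)" unfolding H_def by measurable
  have Hm1[measurable]: "H t \<in> borel_measurable borel" for t unfolding H_def by measurable
  define B where "B = M * e * (2 * pi * (R + (cmod w + e)))"
  have FB: "(\<integral>\<^sup>+z. ennreal (cmod (F t z)) \<partial>lborel) \<le> ennreal B" for t
  proof -
    have "(\<integral>\<^sup>+z. ennreal (cmod (F t z)) \<partial>lborel) \<le> (\<integral>\<^sup>+z. ennreal (M * e) * (ennreal (1 / cmod (z - (w - E t))) * indicator (ball 0 R) z) \<partial>lborel)"
    proof (rule nn_integral_mono)
      fix z
      have "cmod (F t z) = cmod (f z) * (e * (1 / cmod (z - (w - E t))))"
        by (simp add: F_def norm_mult norm_divide En algebra_simps)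
      also have "\<dots> \<le> (M * indicator (ball 0 R) z) * (e * (1 / cmod (z - (w - E t))))"
        using fM[of z] e by (intro mult_right_mono) auto
      finally have "cmod (F t z) \<le> (M * e) * (1 / cmod (z - (w - E t)) * indicator (ball 0 R) z)" by (simp add: mult_ac)
      then have "ennreal (cmod (F t z)) \<le> ennreal ((M * e) * (1 / cmod (z - (w - E t)) * indicator (ball 0 R) z))" by (rule ennreal_leI)
      also have "\<dots> = ennreal (M * e) * (ennreal (1 / cmod (z - (w - E t))) * indicator (ball 0 R) z)"
        using M0 e by (subst ennreal_mult) (auto split: split_indicator)
      finally show "ennreal (cmod (F t z)) \<le> ennreal (M * e) * (ennreal (1 / cmod (z - (w - E t))) * indicator (ball 0 R) z)" .
    qed
    also have "\<dots> = ennreal (M * e) * (\<integral>\<^sup>+z. ennreal (1 / cmod (z - (w - E t))) * indicator (ball 0 R) z \<partial>lborel)"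
      by (rule nn_integral_cmult) measurable
    also have "\<dots> \<le> ennreal (M * e) * ennreal (2 * pi * (R + (cmod w + e)))"
    proof (rule mult_left_mono)
      have "2 * pi * (R + cmod (w - E t)) \<le> 2 * pi * (R + (cmod w + e))"
        using norm_triangle_ineq4[of w "E t"] En[of t] by simp
      then show "(\<integral>\<^sup>+z. ennreal (1 / cmod (z - (w - E t))) * indicator (ball 0 R) z \<partial>lborel) \<le> ennreal (2 * pi * (R + (cmod w + e)))"
        by (rule order_trans[OF nn_integral_inverse_ball_0[OF R] ennreal_leI])
    qed simp
    also have "\<dots> = ennreal B" unfolding B_def using M0 e R by (simp add: ennreal_mult[symmetric] mult.assoc)
    finally show ?thesis .
  qed
  have HB: "(\<integral>\<^sup>+u. ennreal (cmod (H t u)) \<partial>lborel) \<le> ennreal B" for t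
    using FB[of t] nn_integral_shift[of "\<lambda>u. ennreal (cmod (H t u))" "E t"] by (simp add: HF)
  have "(\<lambda>u. LINT t:{0..1}|lborel. f (u - E t) * E t) \<in> borel_measurable borel"
    using lborel.borel_measurable_lebesgue_integral[of "\<lambda>u t. indicator {0..1} t *\<^sub>R (f (u - E t) * E t)" borel]
    by (simp add: set_lebesgue_integral_def)
  then show "mollifier_density f e \<in> borel_measurable borel"
    unfolding dens[abs_def] by measurable
  have "(\<integral>u. mollifier_density f e u / (u - w) \<partial>lborel) = (\<integral>u. of_real (1 / (pi * e\<^sup>2)) * (LINT t:{0..1}|lborel. H t u) \<partial>lborel)"
    unfolding dens H_def by (intro Bochner_Integration.integral_cong refl) simp
  also have "\<dots> = of_real (1 / (pi * e\<^sup>2)) * (\<integral>u. (LINT t:{0..1}|lborel. H t u) \<partial>lborel)"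
    by (rule integral_mult_right_zero)
  also have "(\<integral>u. (LINT t:{0..1}|lborel. H t u) \<partial>lborel) = (LINT t:{0..1}|lborel. (\<integral>u. H t u \<partial>lborel))"
    by (rule integral_swap_interval_plane(1)[OF Hm, symmetric]) (use HB in auto)
  also have "\<dots> = (LINT t:{0..1}|lborel. (\<integral>z. F t z \<partial>lborel))"
    using lborel_integral_shift[OF Hm1] by (simp add: HF[symmetric])
  also have "\<dots> = (\<integral>z. (LINT t:{0..1}|lborel. F t z) \<partial>lborel)"
    by (rule integral_swap_interval_plane(1)[OF Fm]) (use FB in auto)
  also have "\<dots> = (\<integral>z. indicator (ball w e) z *\<^sub>R f z \<partial>lborel)"
  proof (rule integral_cong_AE)
    have "sphere w e \<in> null_sets lborel"
      using negligible_sphere[of w e] by (simp add: negligible_iff_null_sets null_sets_completion_iff)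
    then have "AE z in lborel. z \<notin> sphere w e" by (rule AE_not_in)
    then show "AE z in lborel. (LINT t:{0..1}|lborel. F t z) = indicator (ball w e) z *\<^sub>R f z"
    proof eventually_elim
      case (elim z)
      then have ne: "cmod (w - z) \<noteq> e" by (simp add: dist_norm)
      have "(LINT t:{0..1}|lborel. F t z) = f z * (LINT t:{0..1}|lborel. E t / (E t - (w - z)))"
        unfolding F_def by (rule set_integral_mult_right)
      also have "(LINT t:{0..1}|lborel. E t / (E t - (w - z))) = (if cmod (w - z) < e then 1 else 0)"
        unfolding E_def by (rule circle_mean_ball[OF e ne])
      finally show ?case by (simp add: dist_norm)
    qed
    show "(\<lambda>z. LINT t:{0..1}|lborel. F t z) \<in> borel_measurable lborel"
      using integral_swap_interval_plane(2)[OF Fm, of B] FB by (simp add: borel_measurable_integrable)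
  qed auto
  finally show "(\<integral>u. mollifier_density f e u / (u - w) \<partial>lborel) = of_real (1 / (pi * e\<^sup>2)) * (LINT z:ball w e|lborel. f z)"
    by (simp add: set_lebesgue_integral_def)
qed

text \<open>The mean of \<open>E t\<close> over the circle is 0, so the constant \<open>f u\<close>
  can be subtracted. What remains is at most \<open>\<eta> * e\<close>, to be divided by the area
  \<open>pi * e^2\<close>.\<close>

lemma mollifier_density_bound:
  assumes c: "continuous_on UNIV f" and e: "e > 0" and osc: "\<And>x y. cmod (x - y) \<le> e \<Longrightarrow> cmod (f x - f y) \<le> \<eta>"
  shows "cmod (mollifier_density f e u) \<le> \<eta> / (pi * e)"
proof -
  define E where "E t = e * exp (2 * of_real pi * \<i> * of_real t)" for t :: real
  have En: "cmod (E t) = e" for t using e by (simp add: E_def norm_mult)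
  have Ec: "continuous_on S E" for S unfolding E_def by (intro continuous_intros)
  have fc: "continuous_on S (\<lambda>t. f (u - E t))" for S
    by (intro continuous_on_compose2[OF c] continuous_intros Ec) auto
  have si: "set_integrable lborel {0..1} (\<lambda>t. f (u - E t) * E t)" "set_integrable lborel {0..1} (\<lambda>t. f u * E t)"
    "set_integrable lborel {0..1} (\<lambda>t. (f (u - E t) - f u) * E t)"
    by (intro borel_integrable_atLeastAtMost' continuous_intros Ec fc)+
  have "(LINT t:{0..1}|lborel. E t) = 0"
    unfolding E_def using mean_value_unit_circle(1)[of "\<lambda>\<zeta>. e * \<zeta>" 2] by (simp add: holomorphic_intros)
  then have "(LINT t:{0..1}|lborel. f u * E t) = 0" by simp
  then have eq: "(LINT t:{0..1}|lborel. f (u - E t) * E t) = (LINT t:{0..1}|lborel. (f (u - E t) - f u) * E t)"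
    using set_integral_diff(2)[OF si(1,2)] by (simp add: left_diff_distrib)
  have "cmod (LINT t:{0..1}|lborel. (f (u - E t) - f u) * E t) \<le> (LINT t:{0..1::real}|lborel. \<eta> * e)"
    unfolding set_lebesgue_integral_def
  proof (rule integral_norm_bound_AE)
    show "integrable lborel (\<lambda>t. indicator {0..1} t *\<^sub>R ((f (u - E t) - f u) * E t))"
      using si(3) by (simp add: set_integrable_def)
    have "cmod ((f (u - E t) - f u) * E t) \<le> \<eta> * e" for t
      using osc[of "u - E t" u] e by (simp add: norm_mult En mult_right_mono)
    then show "AE t in lborel. norm (indicator {0..1} t *\<^sub>R ((f (u - E t) - f u) * E t)) \<le> indicator {0..1} t *\<^sub>R (\<eta> * e)"
      by (intro AE_I2) (auto split: split_indicator)
  qed simp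
  also have "\<dots> = \<eta> * e" by (simp add: set_lebesgue_integral_def)
  finally have "cmod (LINT t:{0..1}|lborel. f (u - E t) * E t) \<le> \<eta> * e" unfolding eq .
  then have "1 / (pi * e\<^sup>2) * cmod (LINT t:{0..1}|lborel. f (u - E t) * E t) \<le> 1 / (pi * e\<^sup>2) * (\<eta> * e)"
    using e by (intro mult_left_mono) auto
  moreover have "cmod (mollifier_density f e u) = 1 / (pi * e\<^sup>2) * cmod (LINT t:{0..1}|lborel. f (u - E t) * E t)"
    unfolding mollifier_density_def E_def[symmetric] using e by (simp add: norm_mult norm_divide norm_power)
  ultimately have "cmod (mollifier_density f e u) \<le> 1 / (pi * e\<^sup>2) * (\<eta> * e)" by simp
  also have "\<dots> = \<eta> / (pi * e)" using e by (simp add: power2_eq_square)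
  finally show ?thesis .
qed

text \<open>The integrand is analytic in the circle variable and contains that variable as a factor,
  so its mean is its value 0 at the centre. The margin between \<open>e\<close> and
  \<open>2 * e\<close> supplies analyticity beyond the closed disc.\<close>

lemma mollifier_density_holomorphic:
  assumes h: "f holomorphic_on ball u (2 * e)" and e: "e > 0"
  shows "mollifier_density f e u = 0"
proof -
  define F where "F \<zeta> = f (u - e * \<zeta>) * (e * \<zeta>)" for \<zeta> :: complex
  have "F holomorphic_on ball 0 2" unfolding F_def
    by (intro holomorphic_intros holomorphic_on_compose_gen[OF _ h, of "\<lambda>\<zeta>. u - e * \<zeta>", unfolded o_def])
       (use e in \<open>auto simp: dist_norm norm_mult\<close>)
  then have "(LINT t:{0..1}|lborel. F (exp (2 * of_real pi * \<i> * of_real t))) = F 0"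
    by (rule mean_value_unit_circle(1)) simp
  then show ?thesis by (simp add: F_def mollifier_density_def)
qed

lemma disc_average_bound:
  fixes f :: "complex \<Rightarrow> complex"
  assumes c: "continuous_on UNIV f" and e: "e > 0" and osc: "\<And>x y. cmod (x - y) \<le> e \<Longrightarrow> cmod (f x - f y) \<le> \<eta>"
  shows "cmod (of_real (1 / (pi * e\<^sup>2)) * (LINT z:ball w e|lborel. f z) - f w) \<le> \<eta>"
proof -
  have fm[measurable]: "f \<in> borel_measurable borel" using c by (rule borel_measurable_continuous_onI)
  have em: "emeasure lborel (ball w e) = ennreal (pi * e\<^sup>2)" using e by (simp add: emeasure_ball unit_ball_vol_2)
  have me: "measure lborel (ball w e) = pi * e\<^sup>2" using em e by (simp add: measure_def)
  have fin: "emeasure lborel (ball w e) < \<infinity>" by (simp add: em)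
  have ci: "set_integrable lborel (ball w e) (\<lambda>z. k)" for k :: "'b::{banach, second_countable_topology}"
    unfolding set_integrable_def using fin by (intro integrable_scaleR_left) auto
  have cv: "(LINT z:ball w e|lborel. k) = (pi * e\<^sup>2) *\<^sub>R k" for k :: "'b::{banach, second_countable_topology}"
    unfolding set_lebesgue_integral_def using fin me by simp
  have osc': "cmod (f z - f w) \<le> \<eta>" if "z \<in> ball w e" for z
    using that by (intro osc) (auto simp: dist_norm norm_minus_commute)
  have si: "set_integrable lborel (ball w e) (\<lambda>z. f z - f w)"
    using ci[of \<eta>]
  proof (rule set_integrable_bound)
    show "set_borel_measurable lborel (ball w e) (\<lambda>z. f z - f w)" unfolding set_borel_measurable_def by measurable
    show "AE z in lborel. z \<in> ball w e \<longrightarrow> norm (f z - f w) \<le> norm \<eta>"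
      using osc' by (intro AE_I2) force
  qed
  have "set_integrable lborel (ball w e) (\<lambda>z. (f z - f w) + f w)" by (intro set_integral_add si ci)
  then have si': "set_integrable lborel (ball w e) f" by simp
  have "(LINT z:ball w e|lborel. f z) - (pi * e\<^sup>2) *\<^sub>R f w = (LINT z:ball w e|lborel. f z - f w)"
    using set_integral_diff(2)[OF si' ci[of "f w"]] cv[of "f w"] by simp
  also have "cmod \<dots> \<le> (LINT z:ball w e|lborel. \<eta>)"
    unfolding set_lebesgue_integral_def
  proof (rule integral_norm_bound_AE)
    show "integrable lborel (\<lambda>z. indicator (ball w e) z *\<^sub>R (f z - f w))" using si by (simp add: set_integrable_def)
    show "integrable lborel (\<lambda>z. indicator (ball w e) z *\<^sub>R \<eta>)" using ci[of \<eta>] by (simp add: set_integrable_def)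
    show "AE z in lborel. norm (indicator (ball w e) z *\<^sub>R (f z - f w)) \<le> indicator (ball w e) z *\<^sub>R \<eta>"
      using osc' by (intro AE_I2) (auto split: split_indicator)
  qed
  also have "\<dots> = (pi * e\<^sup>2) * \<eta>" using cv[of \<eta>] by simp
  finally have b: "cmod ((LINT z:ball w e|lborel. f z) - (pi * e\<^sup>2) *\<^sub>R f w) \<le> (pi * e\<^sup>2) * \<eta>" .
  have "of_real (1 / (pi * e\<^sup>2)) * (LINT z:ball w e|lborel. f z) - f w
     = of_real (1 / (pi * e\<^sup>2)) * ((LINT z:ball w e|lborel. f z) - (pi * e\<^sup>2) *\<^sub>R f w)"
    using e by (simp add: right_diff_distrib scaleR_conv_of_real)
  then have "cmod (of_real (1 / (pi * e\<^sup>2)) * (LINT z:ball w e|lborel. f z) - f w)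
     = 1 / (pi * e\<^sup>2) * cmod ((LINT z:ball w e|lborel. f z) - (pi * e\<^sup>2) *\<^sub>R f w)"
    using e by (simp only: norm_mult norm_of_real) simp
  also have "\<dots> \<le> 1 / (pi * e\<^sup>2) * ((pi * e\<^sup>2) * \<eta>)" using b e by (intro mult_left_mono) auto
  also have "\<dots> = \<eta>" using e by simp
  finally show ?thesis .
qed

text \<open>The function equal to \<open>f\<close> on \<open>K\<close> and to 0 off a large disc is
  continuous on a closed set and extends by Dugundji's theorem. Compact support gives a uniform
  modulus of continuity and a density of bounded support.\<close>

lemma compact_support_extension:
  fixes f :: "complex \<Rightarrow> complex"
  assumes K: "compact K" and f: "continuous_on K f"
  obtains F R where "continuous_on UNIV F" "R > 0" "\<And>z. z \<in> K \<Longrightarrow> F z = f z" "\<And>z. z \<notin> ball 0 R \<Longrightarrow> F z = 0"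
proof -
  obtain R0 where R0: "\<And>z. z \<in> K \<Longrightarrow> cmod z \<le> R0" using compact_imp_bounded[OF K] unfolding bounded_iff by blast
  define R where "R = max 1 (R0 + 1)"
  have R: "R > 0" "K \<subseteq> ball 0 R" using R0 by (force simp: R_def)+
  define h where "h z = (if z \<in> K then f z else 0)" for z
  have "continuous_on (K \<union> - ball 0 R) h"
  proof (rule continuous_on_closed_Un)
    show "closed K" using K by (rule compact_imp_closed)
    show "continuous_on K h" using f by (rule continuous_on_eq) (simp add: h_def)
    show "continuous_on (- ball 0 R) h" 
      by (rule continuous_on_eq[OF continuous_on_const[of _ 0]]) (use R in \<open>auto simp: h_def\<close>)
  qed (auto)
  moreover have "closedin (top_of_set UNIV) (K \<union> - ball 0 R)" using compact_imp_closed[OF K] by auto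
  ultimately obtain F where F: "continuous_on UNIV F" "\<And>x. x \<in> K \<union> - ball 0 R \<Longrightarrow> F x = h x"
    using Dugundji[of UNIV UNIV "K \<union> - ball 0 R" h] by auto
  show thesis
  proof (rule that[OF F(1) R(1)])
    show "F z = f z" if "z \<in> K" for z using F(2)[of z] that by (simp add: h_def)
    show "F z = 0" if "z \<notin> ball 0 R" for z using F(2)[of z] that R(2) by (auto simp: h_def)
  qed
qed

text \<open>Two points closer than 1 lie either both in the disc of radius \<open>R + 1\<close>,
  where uniform continuity applies, or both outside the support. The cap 1/2 keeps the later collar
  width \<open>2 * e\<close> in the range of \<open>tube_bound\<close>.\<close>

lemma compact_support_uniform:
  fixes F :: "complex \<Rightarrow> complex"
  assumes F: "continuous_on UNIV F" "\<And>z. z \<notin> ball 0 R \<Longrightarrow> F z = 0" and \<eta>: "\<eta> > 0"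
  obtains e where "e > 0" "e \<le> 1/2" "\<And>x y. cmod (x - y) \<le> e \<Longrightarrow> cmod (F x - F y) \<le> \<eta>"
proof -
  have "uniformly_continuous_on (cball 0 (R + 1)) F"
    by (rule compact_uniformly_continuous[OF continuous_on_subset[OF F(1)]]) auto
  then obtain d where d: "d > 0" "\<And>x y. x \<in> cball 0 (R + 1) \<Longrightarrow> y \<in> cball 0 (R + 1) \<Longrightarrow> dist x y < d \<Longrightarrow> dist (F x) (F y) < \<eta>"
    unfolding uniformly_continuous_on_def using \<eta> by meson
  show thesis
  proof (rule that[of "min (1/2) (d/2)"])
    fix x y assume xy: "cmod (x - y) \<le> min (1/2) (d/2)"
    have n: "cmod x \<le> cmod y + cmod (x - y)" "cmod y \<le> cmod x + cmod (x - y)"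
      using norm_triangle_ineq[of y "x - y"] norm_triangle_ineq4[of x "x - y"] by simp_all
    show "cmod (F x - F y) \<le> \<eta>"
    proof (cases "x \<in> cball 0 (R + 1) \<and> y \<in> cball 0 (R + 1)")
      case True
      then show ?thesis using d(2)[of x y] xy d(1) by (simp add: dist_norm)
    next
      case False
      then have "x \<notin> ball 0 R \<and> y \<notin> ball 0 R" using n xy by auto
      then show ?thesis using F(2) \<eta> by simp
    qed
  qed (use d in auto)
qed

text \<open>The mollified \<open>f\<close> is the Cauchy transform of a density
  of size \<open>O(\<eta>/e)\<close> that, inside \<open>U\<close>, lives on a collar of area \<open>O(e)\<close>.\<close>

theorem cauchy_theorem_rectifiable:
  assumes ps: "\<And>p. p \<in> set ps \<Longrightarrow> closed_lip (snd p)"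
    and U: "open U" "bounded U" "frontier U \<subseteq> cyc_img ps" "cyc_img ps \<subseteq> closure U"
    and wn: "\<And>z. z \<notin> cyc_img ps \<Longrightarrow> cyc_wn ps z = (if z \<in> U then 1 else 0)"
    and f: "continuous_on (closure U) f" "f holomorphic_on U"
  shows "cyc_int ps f = 0"
proof -
  have cK: "compact (closure U)" using U(2) by (simp add: compact_closure)
  obtain F R where F: "continuous_on UNIV F" "R > 0" "\<And>z. z \<in> closure U \<Longrightarrow> F z = f z" "\<And>z. z \<notin> ball 0 R \<Longrightarrow> F z = 0"
    using compact_support_extension[OF cK f(1)] by blast
  have fc: "continuous_on (cyc_img ps) f" using f(1) U(4) by (rule continuous_on_subset)
  obtain K where Kt: "tube_bound (cyc_img ps) K" using cycle_tube[of ps] ps by blast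
  then have K: "K \<ge> 0" by (simp add: tube_bound_def)
  obtain L where L: "cauchy_bound ps f L" using cycle_cauchy_transform[OF ps fc] by blast
  have null: "cyc_img ps \<in> null_sets lborel" using cyc_img_null(1)[of ps] ps by blast
  have Um[measurable]: "U \<in> sets borel" using U(1) by auto
  have main: "cmod (cyc_int ps f) \<le> (L + 4 * K) * \<eta>" if \<eta>: "\<eta> > 0" for \<eta>
  proof -
    obtain e where e: "e > 0" "e \<le> 1/2" "\<And>x y. cmod (x - y) \<le> e \<Longrightarrow> cmod (F x - F y) \<le> \<eta>"
      using compact_support_uniform[OF F(1,4) \<eta>] by blast
    define G where "G = mollifier_density F e"
    have Gm[measurable]: "G \<in> borel_measurable borel" unfolding G_def
      by (rule mollifier_cauchy_transform(1)[OF F(1,4)]) (use F e in auto)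
    have Gb: "cmod (G u) \<le> \<eta> / (pi * e)" for u
      unfolding G_def by (rule mollifier_density_bound[OF F(1) e(1,3)])
    have Gs: "cmod (G u) \<le> \<eta> / (pi * e) * indicator (ball 0 (R + 2)) u" for u
    proof (cases "u \<in> ball 0 (R + 2)")
      case False
      have "F z = 0" if "z \<in> ball u (2 * e)" for z
      proof (rule F(4), rule notI)
        assume "z \<in> ball 0 R"
        then have "cmod u < R + 2 * e" using that norm_triangle_ineq[of z "u - z"] by (simp add: dist_norm)
        then show False using False e by simp
      qed
      then have "F holomorphic_on ball u (2 * e)"
        using holomorphic_transform[of "\<lambda>_. 0" "ball u (2 * e)" F] by simp
      then have "G u = 0" unfolding G_def using e by (intro mollifier_density_holomorphic)
      then show ?thesis using False by simp
    qed (use Gb in simp)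
    have ap: "cmod ((\<integral>u. G u / (u - w) \<partial>lborel) - f w) \<le> \<eta>" if w: "w \<in> cyc_img ps" for w
    proof -
      have "(\<integral>u. G u / (u - w) \<partial>lborel) = of_real (1 / (pi * e\<^sup>2)) * (LINT z:ball w e|lborel. F z)"
        unfolding G_def by (rule mollifier_cauchy_transform(2)[OF F(1,4)]) (use F e in auto)
      moreover have "f w = F w" using F(3)[of w] w U(4) by auto
      ultimately show ?thesis using disc_average_bound[OF F(1) e(1,3), of w] by simp
    qed
    have 1: "integrable lborel (\<lambda>u. G u * cyc_wn ps u)"
      "cmod (cyc_int ps f + 2 * of_real pi * \<i> * (\<integral>u. G u * cyc_wn ps u \<partial>lborel)) \<le> L * \<eta>"
      using L[unfolded cauchy_bound_def, rule_format, OF Gm Gs _ _ ap] e \<eta> F(2) by auto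
    obtain T where T: "T \<in> sets borel" "emeasure lborel T \<le> ennreal (K * (2 * e))"
      "\<And>u p. p \<in> cyc_img ps \<Longrightarrow> dist u p \<le> 2 * e \<Longrightarrow> u \<in> T"
      using tube_boundE[OF Kt, of "2 * e"] e by auto
    \<comment> \<open>Off the collar the disc of radius \<open>2 * e\<close> around \<open>u\<close>
      does not meet the frontier; being connected it stays in \<open>U\<close>, where
      \<open>F\<close> agrees with the holomorphic \<open>f\<close>.\<close>
    have GT: "G u = 0" if u: "u \<in> U" "u \<notin> T" for u
    proof -
      have bU: "ball u (2 * e) \<subseteq> U"
      proof (rule ccontr)
        assume "\<not> ball u (2 * e) \<subseteq> U"
        then have ne: "ball u (2 * e) - U \<noteq> {}" by blast
        have "u \<in> ball u (2 * e)" using e by simp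
        then have "ball u (2 * e) \<inter> U \<noteq> {}" using u by blast
        then have "ball u (2 * e) \<inter> frontier U \<noteq> {}" using ne
          by (intro connected_Int_frontier connected_ball)
        then obtain p where "p \<in> frontier U" "dist u p < 2 * e" by auto
        then show False using T(3)[of p u] U(3) u by auto
      qed
      have "f holomorphic_on ball u (2 * e)" by (rule holomorphic_on_subset[OF f(2) bU])
      moreover have "f z = F z" if "z \<in> ball u (2 * e)" for z
        by (rule F(3)[symmetric], rule subsetD[OF closure_subset], rule subsetD[OF bU], rule that)
      ultimately have "F holomorphic_on ball u (2 * e)" by (rule holomorphic_transform)
      then show ?thesis unfolding G_def using e by (intro mollifier_density_holomorphic)
    qed
    have Tfin: "emeasure lborel T < \<infinity>" using T(2) by (rule le_less_trans) simp
    have mT: "measure lborel T \<le> K * (2 * e)"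
      using T(2) K e by (intro enn2real_leI[THEN order_trans[OF eq_refl[OF measure_def]]]) auto
    \<comment> \<open>Almost everywhere \<open>cyc_wn ps\<close> is the indicator of
      \<open>U\<close>, so only points of \<open>U\<close> in the collar contribute. The behaviour
      of the extension \<open>F\<close> outside the closure of \<open>U\<close> is thereby
      eliminated.\<close>
    have "cmod (\<integral>u. G u * cyc_wn ps u \<partial>lborel) \<le> (\<integral>u. indicator T u *\<^sub>R (\<eta> / (pi * e)) \<partial>lborel)"
    proof (rule integral_norm_bound_AE[OF 1(1)])
      show "integrable lborel (\<lambda>u. indicator T u *\<^sub>R (\<eta> / (pi * e)))"
        using Tfin T(1) by (intro integrable_scaleR_left) auto
      show "AE u in lborel. norm (G u * cyc_wn ps u) \<le> indicator T u *\<^sub>R (\<eta> / (pi * e))"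
        using AE_not_in[OF null]
      proof eventually_elim
        case (elim u)
        show ?case using wn[OF elim] GT[of u] Gb[of u] \<eta> e
          by (cases "u \<in> T") (auto simp: norm_mult)
      qed
    qed
    also have "\<dots> = measure lborel T * (\<eta> / (pi * e))" using Tfin T(1) by simp
    also have "\<dots> \<le> K * (2 * e) * (\<eta> / (pi * e))" using mT \<eta> e by (intro mult_right_mono) auto
    also have "\<dots> = 2 * K * \<eta> / pi" using e by simp
    finally have 2: "cmod (\<integral>u. G u * cyc_wn ps u \<partial>lborel) \<le> 2 * K * \<eta> / pi" .
    have "cmod (cyc_int ps f) \<le> cmod (cyc_int ps f + 2 * of_real pi * \<i> * (\<integral>u. G u * cyc_wn ps u \<partial>lborel))
       + cmod (2 * of_real pi * \<i> * (\<integral>u. G u * cyc_wn ps u \<partial>lborel))"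
      using norm_triangle_ineq4[of "cyc_int ps f + 2 * of_real pi * \<i> * (\<integral>u. G u * cyc_wn ps u \<partial>lborel)"
         "2 * of_real pi * \<i> * (\<integral>u. G u * cyc_wn ps u \<partial>lborel)"] by simp
    also have "\<dots> \<le> L * \<eta> + 2 * pi * (2 * K * \<eta> / pi)"
    proof (rule add_mono[OF 1(2)])
      have "cmod (2 * of_real pi * \<i> * (\<integral>u. G u * cyc_wn ps u \<partial>lborel)) = 2 * pi * cmod (\<integral>u. G u * cyc_wn ps u \<partial>lborel)"
        by (simp add: norm_mult)
      then show "cmod (2 * of_real pi * \<i> * (\<integral>u. G u * cyc_wn ps u \<partial>lborel)) \<le> 2 * pi * (2 * K * \<eta> / pi)"
        using mult_left_mono[OF 2, of "2 * pi"] by simp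
    qed
    also have "\<dots> = (L + 4 * K) * \<eta>" by (simp add: algebra_simps)
    finally show ?thesis .
  qed
  have "cmod (cyc_int ps f) \<le> 0"
  proof (rule field_le_epsilon)
    fix \<delta> :: real assume \<delta>: "\<delta> > 0"
    define \<eta> where "\<eta> = \<delta> / (\<bar>L + 4 * K\<bar> + 1)"
    have "\<eta> > 0" using \<delta> by (simp add: \<eta>_def)
    then have "cmod (cyc_int ps f) \<le> (L + 4 * K) * \<eta>" by (rule main)
    also have "\<dots> \<le> (\<bar>L + 4 * K\<bar> + 1) * \<eta>" using \<open>\<eta> > 0\<close> by (intro mult_right_mono) auto
    also have "\<dots> = \<delta>" by (simp add: \<eta>_def)
    finally show "cmod (cyc_int ps f) \<le> 0 + \<delta>" by simp
  qed
  then show ?thesis by simp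
qed

section \<open>Linearity of cycle integrals and Cauchy's formula, interior and exterior\<close>

lemma cyc_int_integrable:
  assumes "\<And>p. p \<in> set ps \<Longrightarrow> closed_lip (snd p)" "continuous_on (cyc_img ps) f" "p \<in> set ps"
  shows "f contour_integrable_on (snd p)"
proof -
  obtain C where C: "C-lipschitz_on {0..1} (snd p)" using assms(1)[OF assms(3)] by (auto simp: closed_lip_def)
  have "continuous_on (path_image (snd p)) f" using assms(2,3) by (auto simp: cyc_img_def intro: continuous_on_subset)
  then show ?thesis using lipschitz_curve_integrable(2)[OF C] by (auto simp: contour_integrable_on_def)
qed

lemma cyc_int_add:
  assumes "\<And>p. p \<in> set ps \<Longrightarrow> f contour_integrable_on (snd p)" "\<And>p. p \<in> set ps \<Longrightarrow> g contour_integrable_on (snd p)"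
  shows "cyc_int ps (\<lambda>w. f w + g w) = cyc_int ps f + cyc_int ps g"
  using assms unfolding cyc_int_def
  by (induction ps) (auto simp: contour_integral_add algebra_simps)

lemma cyc_int_lmul:
  assumes "\<And>p. p \<in> set ps \<Longrightarrow> f contour_integrable_on (snd p)"
  shows "cyc_int ps (\<lambda>w. c * f w) = c * cyc_int ps f"
  using assms unfolding cyc_int_def
  by (induction ps) (auto simp: contour_integral_lmul algebra_simps)

lemma cyc_int_cong:
  assumes "\<And>w. w \<in> cyc_img ps \<Longrightarrow> f w = g w"
  shows "cyc_int ps f = cyc_int ps g"
proof -
  have "contour_integral (snd p) f = contour_integral (snd p) g" if "p \<in> set ps" for p
    using assms that by (intro contour_integral_eq) (auto simp: cyc_img_def)
  then show ?thesis unfolding cyc_int_def by (simp cong: map_cong)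
qed

lemma cyc_int_winding:
  assumes "\<And>p. p \<in> set ps \<Longrightarrow> closed_lip (snd p)" "z \<notin> cyc_img ps"
  shows "cyc_int ps (\<lambda>w. 1 / (w - z)) = 2 * of_real pi * \<i> * cyc_wn ps z"
  using assms
proof (induction ps)
  case Nil
  then show ?case by (simp add: cyc_int_def cyc_wn_def)
next
  case (Cons q ps)
  have z: "z \<notin> path_image (snd q)" "z \<notin> cyc_img ps" using Cons.prems(2) by (auto simp: cyc_img_def)
  obtain C where C: "C-lipschitz_on {0..1} (snd q)" "pathfinish (snd q) = pathstart (snd q)"
    using Cons.prems(1)[of q] by (auto simp: closed_lip_def)
  have "contour_integral (snd q) (\<lambda>w. 1 / (w - z)) = 2 * of_real pi * \<i> * wn0 (snd q) z"
    using contour_integral_unique[OF lipschitz_winding_number_integral[OF C z(1)]] z(1) by (simp add: wn0_def)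
  moreover have "cyc_int ps (\<lambda>w. 1 / (w - z)) = 2 * of_real pi * \<i> * cyc_wn ps z"
    using Cons.IH[OF _ z(2)] Cons.prems(1) by auto
  ultimately show ?case by (simp add: cyc_int_def cyc_wn_def algebra_simps)
qed

text \<open>Cauchy's theorem is applied to the difference quotient of \<open>f\<close> at
  \<open>z\<close>, whose singularity is removable; the rest is \<open>f z\<close> times a winding
  number.\<close>

theorem cauchy_formula_rectifiable:
  assumes ps: "\<And>p. p \<in> set ps \<Longrightarrow> closed_lip (snd p)"
    and U: "open U" "bounded U" "frontier U \<subseteq> cyc_img ps" "cyc_img ps \<subseteq> closure U"
    and wn: "\<And>z. z \<notin> cyc_img ps \<Longrightarrow> cyc_wn ps z = (if z \<in> U then 1 else 0)"
    and f: "continuous_on (closure U) f" "f holomorphic_on U"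
    and z: "z \<in> U" "z \<notin> cyc_img ps"
  shows "cyc_int ps (\<lambda>w. f w / (w - z)) = 2 * of_real pi * \<i> * f z"
proof -
  define q where "q w = (if w = z then deriv f z else (f w - f z) / (w - z))" for w
  have zi: "z \<in> interior U" using z(1) U(1) by (simp add: interior_open)
  have qh: "q holomorphic_on U" unfolding q_def by (rule pole_lemma[OF f(2) zi])
  have qc: "continuous_on (closure U) q"
  proof -
    have "continuous_on U q" using qh by (rule holomorphic_on_imp_continuous_on)
    have "isCont q w" if "w \<in> U" for w
      using \<open>continuous_on U q\<close> U(1) that continuous_on_eq_continuous_at by blast
    then have 1: "continuous (at w within closure U) q" if "w = z" for w
      using that z(1) continuous_at_imp_continuous_at_within by blast
    have "continuous_on (closure U - {z}) (\<lambda>w. (f w - f z) / (w - z))"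
      by (intro continuous_intros continuous_on_subset[OF f(1)]) auto
    then have "continuous_on (closure U - {z}) q" by (rule continuous_on_eq) (auto simp: q_def)
    then have 2: "continuous (at w within closure U) q" if "w \<in> closure U" "w \<noteq> z" for w
    proof -
      have "continuous (at w within closure U - {z}) q"
        using \<open>continuous_on (closure U - {z}) q\<close> that by (auto simp: continuous_on_eq_continuous_within)
      moreover have "at w within closure U - {z} = at w within closure U"
        using that by (intro at_within_nhd[of _ "- {z}"]) auto
      ultimately show ?thesis by simp
    qed
    show ?thesis unfolding continuous_on_eq_continuous_within using 1 2 by blast
  qed
  have qc': "continuous_on (cyc_img ps) q"
    using qc U(4) by (rule continuous_on_subset)
  have ic: "continuous_on (cyc_img ps) (\<lambda>w. 1 / (w - z))"
    using z(2) by (intro continuous_intros) auto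
  have iz: "(\<lambda>w. 1 / (w - z)) contour_integrable_on snd p" and iq: "q contour_integrable_on snd p" if "p \<in> set ps" for p
    by (rule cyc_int_integrable[OF _ ic that], erule ps) (rule cyc_int_integrable[OF _ qc' that], erule ps)
  have 0: "cyc_int ps q = 0"
    by (rule cauchy_theorem_rectifiable[OF _ U _ qc qh]) (use ps wn in auto)
  have "cyc_int ps (\<lambda>w. f w / (w - z)) = cyc_int ps (\<lambda>w. q w + f z * (1 / (w - z)))"
  proof (rule cyc_int_cong)
    fix w assume "w \<in> cyc_img ps"
    then have "w \<noteq> z" using z(2) by auto
    then show "f w / (w - z) = q w + f z * (1 / (w - z))" by (simp add: q_def diff_divide_distrib)
  qed
  also have "\<dots> = cyc_int ps q + cyc_int ps (\<lambda>w. f z * (1 / (w - z)))"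
    by (rule cyc_int_add) (erule iq, rule contour_integrable_lmul, erule iz)
  also have "\<dots> = f z * cyc_int ps (\<lambda>w. 1 / (w - z))"
    unfolding 0 by (subst cyc_int_lmul) (erule iz, simp)
  also have "\<dots> = 2 * of_real pi * \<i> * f z"
    unfolding cyc_int_winding[OF ps z(2), simplified] using z wn[OF z(2)] by simp
  finally show ?thesis .
qed

text \<open>Dominated convergence: for absolutely integrable functions the principal value is the
  ordinary integral.\<close>

lemma area_pv_eq:
  assumes U: "U \<in> sets borel" and i: "set_integrable lborel U g"
  shows "area_pv U g = of_real (1 / pi) * (LINT \<xi>:U|lborel. g \<xi>)"
proof -
  note [measurable] = U
  have int: "integrable lborel (\<lambda>\<xi>. indicator U \<xi> *\<^sub>R g \<xi>)" using i by (simp add: set_integrable_def)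
  then have m[measurable]: "(\<lambda>\<xi>. indicator U \<xi> *\<^sub>R g \<xi>) \<in> borel_measurable lborel" by (rule borel_measurable_integrable)
  have eq: "indicator (U \<inter> ball 0 R) \<xi> *\<^sub>R g \<xi> = indicator (ball 0 R) \<xi> *\<^sub>R (indicator U \<xi> *\<^sub>R g \<xi>)" for R \<xi>
    by (auto split: split_indicator)
  have "((\<lambda>R. LINT \<xi>:U \<inter> ball 0 R|lborel. g \<xi>) \<longlongrightarrow> (LINT \<xi>:U|lborel. g \<xi>)) at_top"
    unfolding set_lebesgue_integral_def
  proof (rule integral_dominated_convergence_at_top[where w="\<lambda>\<xi>. norm (indicator U \<xi> *\<^sub>R g \<xi>)"])
    show "(\<lambda>\<xi>. indicator (U \<inter> ball 0 R) \<xi> *\<^sub>R g \<xi>) \<in> borel_measurable lborel" for R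
      unfolding eq by measurable
    show "integrable lborel (\<lambda>\<xi>. norm (indicator U \<xi> *\<^sub>R g \<xi>))" using int by (rule integrable_norm)
    show "AE \<xi> in lborel. ((\<lambda>R. indicator (U \<inter> ball 0 R) \<xi> *\<^sub>R g \<xi>) \<longlongrightarrow> indicator U \<xi> *\<^sub>R g \<xi>) at_top"
    proof (intro AE_I2 tendsto_eventually)
      fix \<xi> :: complex
      show "\<forall>\<^sub>F R in at_top. indicator (U \<inter> ball 0 R) \<xi> *\<^sub>R g \<xi> = indicator U \<xi> *\<^sub>R g \<xi>"
        using eventually_gt_at_top[of "cmod \<xi>"] by eventually_elim (auto split: split_indicator)
    qed
    show "\<forall>\<^sub>F R in at_top. AE \<xi> in lborel. norm (indicator (U \<inter> ball 0 R) \<xi> *\<^sub>R g \<xi>) \<le> norm (indicator U \<xi> *\<^sub>R g \<xi>)"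
      by (intro always_eventually allI AE_I2) (auto split: split_indicator)
  qed (rule m)
  then have "((\<lambda>R. of_real (1 / pi) * (LINT \<xi>:U \<inter> ball 0 R|lborel. g \<xi>)) \<longlongrightarrow> of_real (1 / pi) * (LINT \<xi>:U|lborel. g \<xi>)) at_top"
    by (rule tendsto_mult_left)
  then show ?thesis unfolding area_pv_def by (intro tendsto_Lim) auto
qed

lemma wcauchy_eq_logC:
  assumes "U \<in> sets borel" "U \<inter> ball 0 d = {}" "d > 0"
  shows "wcauchy U w = logC U w"
  unfolding wcauchy_def logC_def by (rule area_pv_eq[OF assms(1) set_integrable_log_cauchy_kernel[OF assms]])

lemma closed_lip_circlepath: "closed_lip (circlepath z R)"
proof -
  have "(\<bar>R\<bar> * (2 * pi))-lipschitz_on {0..1} (circlepath z R)"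
  proof (rule bounded_derivative_imp_lipschitz)
    fix t :: real assume t: "t \<in> {0..1}"
    show "(circlepath z R has_derivative (\<lambda>h. h *\<^sub>R (2 * of_real pi * \<i> * R * exp (2 * of_real pi * \<i> * of_real t)))) (at t within {0..1})"
      using has_vector_derivative_circlepath[of z R t "{0..1}"] by (simp add: has_vector_derivative_def)
    show "onorm (\<lambda>h. h *\<^sub>R (2 * of_real pi * \<i> * R * exp (2 * of_real pi * \<i> * of_real t))) \<le> \<bar>R\<bar> * (2 * pi)"
      by (rule onorm_bound) (auto simp: norm_mult)
  qed auto
  then show ?thesis unfolding closed_lip_def by auto
qed

lemma circle_integral_tendsto_at_infinity:
  assumes f: "\<And>R. R > R0 \<Longrightarrow> continuous_on (sphere 0 R) f" and l: "(f \<longlongrightarrow> l) at_infinity"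
  shows "((\<lambda>R. contour_integral (circlepath 0 R) (\<lambda>w. f w / (w - z))) \<longlongrightarrow> 2 * of_real pi * \<i> * l) at_top"
proof (rule tendstoI)
  fix \<epsilon> :: real assume \<epsilon>: "\<epsilon> > 0"
  \<comment> \<open>Replacing \<open>f\<close> by its limit costs at most
    \<open>2 * \<eta> / R\<close> pointwise on a circle of length \<open>2 * pi * R\<close>, in
    total \<open>4 * pi * \<eta>\<close>, half of the allowed error.\<close>
  define \<eta> where "\<eta> = \<epsilon> / (8 * pi)"
  have \<eta>: "\<eta> > 0" using \<epsilon> by (simp add: \<eta>_def)
  have "\<forall>\<^sub>F w in at_infinity. dist (f w) l < \<eta>" using tendstoD[OF l \<eta>] .
  then obtain B where B: "\<And>w. B \<le> cmod w \<Longrightarrow> cmod (f w - l) < \<eta>"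
    unfolding eventually_at_infinity dist_norm by blast
  show "\<forall>\<^sub>F R in at_top. dist (contour_integral (circlepath 0 R) (\<lambda>w. f w / (w - z))) (2 * of_real pi * \<i> * l) < \<epsilon>"
    using eventually_gt_at_top[of "max (max B R0) (2 * cmod z + 1)"]
  proof eventually_elim
    case (elim R)
    then have R: "R \<ge> B" "R > R0" "R > 2 * cmod z" "R > 0" "R > cmod z" using norm_ge_zero[of z] by linarith+
    obtain C where C: "C-lipschitz_on {0..1} (circlepath 0 R)" using closed_lip_circlepath by (auto simp: closed_lip_def)
    have nz: "w - z \<noteq> 0" if "w \<in> sphere 0 R" for w using that R norm_ge_zero[of z] by auto
    have pi': "path_image (circlepath 0 R) = sphere 0 R" using R by simp
    have 1: "((\<lambda>w. f w / (w - z)) has_contour_integral contour_integral (circlepath 0 R) (\<lambda>w. f w / (w - z))) (circlepath 0 R)"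
    proof (rule has_contour_integral_integral)
      have "continuous_on (path_image (circlepath 0 R)) (\<lambda>w. f w / (w - z))"
        unfolding pi' using nz by (intro continuous_intros f[OF R(2)]) auto
      then show "(\<lambda>w. f w / (w - z)) contour_integrable_on circlepath 0 R"
        using lipschitz_curve_integrable(2)[OF C] by (auto simp: contour_integrable_on_def)
    qed
    have 2: "((\<lambda>w. l / (w - z)) has_contour_integral (2 * of_real pi * \<i> * l)) (circlepath 0 R)"
      by (rule Cauchy_integral_circlepath_simple) (use R(5) in \<open>auto intro!: holomorphic_intros\<close>)
    have "cmod (contour_integral (circlepath 0 R) (\<lambda>w. f w / (w - z)) - 2 * of_real pi * \<i> * l) \<le> (2 * \<eta> / R) * (2 * pi * R)"
    proof (rule has_contour_integral_bound_circlepath[OF has_contour_integral_diff[OF 1 2]])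
      show "0 \<le> 2 * \<eta> / R" "0 < R" using R \<eta> by auto
      fix w :: complex assume w: "cmod (w - 0) = R"
      have "R / 2 \<le> cmod (w - z)" using norm_triangle_ineq2[of w z] w R by simp
      moreover have "cmod (f w - l) \<le> \<eta>" using B[of w] w R by simp
      ultimately have "cmod (f w - l) / cmod (w - z) \<le> \<eta> / (R / 2)" using R \<eta> by (intro frac_le) auto
      then show "cmod (f w / (w - z) - l / (w - z)) \<le> 2 * \<eta> / R"
        by (simp add: diff_divide_distrib[symmetric] norm_divide mult.commute)
    qed
    also have "\<dots> = \<epsilon> / 2" using R by (simp add: \<eta>_def)
    finally show ?case using \<epsilon> by (simp add: dist_norm)
  qed
qed

lemma cyc_wn_circle:
  assumes "R > 0" "z \<notin> sphere 0 R"
  shows "wn0 (circlepath 0 R) z = (if z \<in> ball 0 R then 1 else 0)"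
proof (cases "z \<in> ball 0 R")
  case True
  then show ?thesis using assms by (simp add: wn0_def winding_number_circlepath)
next
  case False
  then have "z \<notin> cball 0 R" using assms by auto
  moreover have "path_image (circlepath 0 R) \<subseteq> cball 0 R" using assms by auto
  ultimately have "winding_number (circlepath 0 R) z = 0"
    by (intro winding_number_zero_outside[OF _ _ _ _ \<open>path_image (circlepath 0 R) \<subseteq> cball 0 R\<close>]) auto
  then show ?thesis using assms False by (simp add: wn0_def)
qed

lemma cyc_int_Cons: "cyc_int (p # ps) f = fst p * contour_integral (snd p) f + cyc_int ps f"
  and cyc_wn_Cons: "cyc_wn (p # ps) z = fst p * wn0 (snd p) z + cyc_wn ps z"
  and cyc_img_Cons: "cyc_img (p # ps) = path_image (snd p) \<union> cyc_img ps"
  by (simp_all add: cyc_int_def cyc_wn_def cyc_img_def)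

text \<open>For a neighbourhood \<open>W\<close> of infinity the formula is applied to \<open>W \<inter> ball 0 R\<close>, whose boundary
  cycle has one additional large circle, which contributes the value at infinity.\<close>

lemma cauchy_formula_exterior:
  assumes ps: "\<And>p. p \<in> set ps \<Longrightarrow> closed_lip (snd p)"
    and W: "open W" "bounded (- W)" "cyc_img ps = frontier W"
    and wn: "\<And>z. z \<notin> frontier W \<Longrightarrow> cyc_wn ps z = (if z \<in> W then 0 else - 1)"
    and f: "continuous_on (closure W) f" "f holomorphic_on W" "(f \<longlongrightarrow> l) at_infinity"
    and z: "z \<in> W"
  shows "cyc_int ps (\<lambda>w. f w / (w - z)) = 2 * of_real pi * \<i> * (f z - l)"
proof -
  obtain R0 where R0: "\<And>w. w \<notin> W \<Longrightarrow> cmod w \<le> R0" using W(2) unfolding bounded_iff by auto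
  have "closure (- W) \<subseteq> cball 0 R0" using R0 by (intro closure_minimal) auto
  then have fr: "frontier W \<subseteq> cball 0 R0" unfolding frontier_closures by blast
  have eqn: "contour_integral (circlepath 0 R) (\<lambda>w. f w / (w - z)) + cyc_int ps (\<lambda>w. f w / (w - z)) = 2 * of_real pi * \<i> * f z"
    if R: "R > max R0 (max (cmod z) 0)" for R
  proof -
    define U where "U = W \<inter> ball 0 R"
    define qs where "qs = (1, circlepath 0 R) # ps"
    have R': "R > R0" "R > cmod z" "R > 0" using R norm_ge_zero[of z] by linarith+
    have img: "cyc_img qs = sphere 0 R \<union> frontier W"
      using R' W(3) by (simp add: qs_def cyc_img_Cons)
    have sW: "sphere 0 R \<subseteq> W" using R0 R' by force
    have "cyc_int qs (\<lambda>w. f w / (w - z)) = 2 * of_real pi * \<i> * f z"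
    proof (rule cauchy_formula_rectifiable)
      show "closed_lip (snd p)" if "p \<in> set qs" for p
      proof -
        have "p = (1, circlepath 0 R) \<or> p \<in> set ps" using that by (simp add: qs_def)
        then show ?thesis using ps[of p] closed_lip_circlepath[of 0 R] by (elim disjE) simp_all
      qed
      show "open U" "bounded U" using W(1) by (auto simp: U_def)
      show "frontier U \<subseteq> cyc_img qs"
        using frontier_Int_subset[of W "ball 0 R"] R' unfolding img U_def by (auto simp: frontier_ball)
      show "cyc_img qs \<subseteq> closure U"
      proof -
        have "sphere 0 R \<subseteq> W \<inter> closure (ball 0 R)" using sW R' by auto
        also have "\<dots> \<subseteq> closure U" unfolding U_def by (rule open_Int_closure_subset[OF W(1)])
        finally have 1: "sphere 0 R \<subseteq> closure U" .
        have "frontier W \<subseteq> closure W" unfolding frontier_closures by blast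
        then have "frontier W \<subseteq> ball 0 R \<inter> closure W" using fr R' by force
        also have "\<dots> \<subseteq> closure (ball 0 R \<inter> W)" by (rule open_Int_closure_subset) simp
        finally have 2: "frontier W \<subseteq> closure U" by (simp add: U_def Int_commute)
        show ?thesis unfolding img using 1 2 by blast
      qed
      show "cyc_wn qs y = (if y \<in> U then 1 else 0)" if y: "y \<notin> cyc_img qs" for y
      proof -
        have "y \<notin> sphere 0 R" "y \<notin> frontier W" using y img by auto
        then have "cyc_wn qs y = (if y \<in> ball 0 R then 1 else 0) + (if y \<in> W then 0 else - 1)"
          using cyc_wn_circle[OF R'(3)] wn by (simp add: qs_def cyc_wn_Cons)
        \<comment> \<open>Beyond the large circle every point is in \<open>W\<close>, so both
          contributions vanish there; in the holes of \<open>W\<close> the circle's 1 cancels the -1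
          of the cycle.\<close>
        moreover have "y \<in> W" if "y \<notin> ball 0 R" using R0[of y] that R' by force
        ultimately show ?thesis by (auto simp: U_def)
      qed
      have UW: "closure U \<subseteq> closure W" unfolding U_def by (intro closure_mono) auto
      show "continuous_on (closure U) f" using f(1) UW by (rule continuous_on_subset)
      show "f holomorphic_on U" using f(2) by (rule holomorphic_on_subset) (auto simp: U_def)
      show "z \<in> U" using z R' by (simp add: U_def)
      show "z \<notin> cyc_img qs" using z R' W(1) unfolding img by (auto simp: frontier_def interior_open)
    qed
    then show ?thesis by (simp add: qs_def cyc_int_Cons)
  qed
  have "((\<lambda>R. contour_integral (circlepath 0 R) (\<lambda>w. f w / (w - z))) \<longlongrightarrow> 2 * of_real pi * \<i> * l) at_top"
  proof (rule circle_integral_tendsto_at_infinity[OF _ f(3), where ?R0.0 = R0])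
    fix R assume "R > R0"
    then have "sphere 0 R \<subseteq> closure W" using R0 closure_subset[of W] by force
    then show "continuous_on (sphere 0 R) f" by (rule continuous_on_subset[OF f(1)])
  qed
  then have "((\<lambda>R. contour_integral (circlepath 0 R) (\<lambda>w. f w / (w - z)) + cyc_int ps (\<lambda>w. f w / (w - z)))
     \<longlongrightarrow> 2 * of_real pi * \<i> * l + cyc_int ps (\<lambda>w. f w / (w - z))) at_top"
    by (intro tendsto_intros)
  moreover have "((\<lambda>R. contour_integral (circlepath 0 R) (\<lambda>w. f w / (w - z)) + cyc_int ps (\<lambda>w. f w / (w - z)))
     \<longlongrightarrow> 2 * of_real pi * \<i> * f z) at_top"
    by (intro tendsto_eventually eventually_mono[OF eventually_gt_at_top[of "max R0 (max (cmod z) 0)"]] eqn)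
  ultimately have "2 * of_real pi * \<i> * l + cyc_int ps (\<lambda>w. f w / (w - z)) = 2 * of_real pi * \<i> * f z"
    using tendsto_unique[OF trivial_limit_at_top_linorder] by blast
  then show ?thesis by (simp add: algebra_simps)
qed

section \<open>Analyticity at infinity, and the exchange of area and cycle integrals\<close>

lemma analytic_at_infinity_tendsto:
  assumes "analytic_at_infinity f"
  obtains l where "(f \<longlongrightarrow> l) at_infinity"
proof -
  obtain c R where R: "R > 0" "(\<lambda>w. if w = 0 then c else f (1 / w)) holomorphic_on ball 0 R"
    using assms unfolding analytic_at_infinity_def by blast
  have "continuous_on (ball 0 R) (\<lambda>w. if w = 0 then c else f (1 / w))" using R(2) by (rule holomorphic_on_imp_continuous_on)
  then have "isCont (\<lambda>w. if w = 0 then c else f (1 / w)) 0"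
    using R(1) by (simp add: continuous_on_eq_continuous_at)
  then have "((\<lambda>w. if w = 0 then c else f (1 / w)) \<longlongrightarrow> c) (at 0)" by (simp add: isCont_def)
  then have "((f \<circ> inverse) \<longlongrightarrow> c) (at 0)"
    by (rule Lim_transform_eventually) (auto simp: eventually_at_filter inverse_eq_divide)
  then show thesis using that lim_at_infinity_0 by blast
qed

text \<open>After inversion the limit at infinity fills an isolated singularity at 0 continuously,
  and such a singularity is removable.\<close>

lemma analytic_at_infinityI:
  assumes h: "f holomorphic_on {w. cmod w > B}" and l: "(f \<longlongrightarrow> l) at_infinity"
  shows "analytic_at_infinity f"
proof -
  define k where "k w = (if w = 0 then l else f (1 / w))" for w
  define R where "R = 1 / (\<bar>B\<bar> + 1)"
  have R: "R > 0" by (simp add: R_def)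
  have "(\<lambda>w. f (1 / w)) holomorphic_on ball 0 R - {0}"
  proof (rule holomorphic_on_compose_gen[OF _ h, of "\<lambda>w. 1 / w", unfolded o_def])
    show "(\<lambda>w. 1 / w) holomorphic_on ball 0 R - {0}" by (intro holomorphic_intros) auto
    show "(\<lambda>w. 1 / w) ` (ball 0 R - {0}) \<subseteq> {w. B < cmod w}"
    proof clarsimp
      fix x :: complex assume x: "cmod x < R" "x \<noteq> 0"
      then have "1 / R < 1 / cmod x" using R by (intro divide_strict_left_mono) auto
      then show "B < cmod (1 / x)" by (simp add: R_def norm_divide)
    qed
  qed
  then have hk: "k holomorphic_on ball 0 R - {0}"
    by (rule holomorphic_transform) (auto simp: k_def)
  have "((f \<circ> inverse) \<longlongrightarrow> l) (at 0)" using l lim_at_infinity_0 by blast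
  then have "(k \<longlongrightarrow> l) (at 0)"
    by (rule Lim_transform_eventually) (auto simp: eventually_at_filter inverse_eq_divide k_def)
  then have c0: "isCont k 0" by (simp add: isCont_def k_def)
  have "continuous_on (ball 0 R) k"
  proof (rule continuous_at_imp_continuous_on, rule ballI)
    fix x :: complex assume x: "x \<in> ball 0 R"
    show "isCont k x"
    proof (cases "x = 0")
      case False
      have "continuous_on (ball 0 R - {0}) k" using hk by (rule holomorphic_on_imp_continuous_on)
      then show ?thesis using x False by (auto simp: continuous_on_eq_continuous_at open_Diff)
    qed (use c0 in simp)
  qed
  then have "k holomorphic_on ball 0 R" by (rule no_isolated_singularity[OF _ hk]) auto
  then show ?thesis unfolding analytic_at_infinity_def k_def using R by blast
qed

text \<open>Although \<open>V\<close> does not meet the cycle, it may come arbitrarily close to it.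
  Fubini still applies because the absolute integral of the kernel over \<open>V\<close> is bounded
  uniformly in the point on the curve. Integrability is carried along because the induction adds
  integrals over \<open>V\<close>.\<close>

lemma cycle_logC_swap:
  assumes ps: "\<And>p. p \<in> set ps \<Longrightarrow> closed_lip (snd p)" and f: "continuous_on (cyc_img ps) f"
    and V: "V \<in> sets borel" "V \<inter> ball 0 d = {}" "d > 0" "V \<inter> cyc_img ps = {}"
  shows "cyc_int ps (\<lambda>w. f w * logC V w) = of_real (1 / pi) * (LINT \<xi>:V|lborel. of_real (1 / (cmod \<xi>)\<^sup>2) * cyc_int ps (\<lambda>w. f w / (w - \<xi>)))
    \<and> set_integrable lborel V (\<lambda>\<xi>. of_real (1 / (cmod \<xi>)\<^sup>2) * cyc_int ps (\<lambda>w. f w / (w - \<xi>)))"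
  using ps f V(4)
proof (induction ps)
  case Nil
  then show ?case by (simp add: cyc_int_def set_integrable_def)
next
  case (Cons q ps)
  note [measurable] = V(1)
  define g where "g = snd q"
  obtain C where C: "C-lipschitz_on {0..1} g" "pathfinish g = pathstart g"
    using Cons.prems(1)[of q] by (auto simp: closed_lip_def g_def)
  have fc: "continuous_on (path_image g) f" using Cons.prems(2) by (auto simp: cyc_img_Cons g_def intro: continuous_on_subset)
  have Vg: "V \<inter> path_image g = {}" using Cons.prems(3) by (auto simp: cyc_img_Cons g_def)
  have C0: "C \<ge> 0" using C(1) by (rule lipschitz_on_nonneg)
  have gc: "continuous_on {0..1} g" using C(1) by (rule lipschitz_on_continuous_on)
  define \<gamma> where "\<gamma> t = g (clamp01 t)" for t
  have \<gamma>im: "\<gamma> t \<in> path_image g" for t unfolding \<gamma>_def path_image_def using clamp01_range by blast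
  have \<gamma>c: "continuous_on UNIV \<gamma>" unfolding \<gamma>_def
    by (rule continuous_on_compose2[OF gc]) (auto simp: clamp01_def intro!: continuous_intros)
  then have \<gamma>m[measurable]: "\<gamma> \<in> borel_measurable borel" by (rule borel_measurable_continuous_onI)
  have "continuous_on UNIV (\<lambda>t. f (\<gamma> t))"
    by (rule continuous_on_compose2[OF fc \<gamma>c]) (use \<gamma>im in auto)
  then have f\<gamma>m[measurable]: "(\<lambda>t. f (\<gamma> t)) \<in> borel_measurable borel" by (rule borel_measurable_continuous_onI)
  have \<gamma>g: "\<gamma> t = g t" if "t \<in> {0..1}" for t using that by (simp add: \<gamma>_def clamp01_id)
  have dm[measurable]: "curve_deriv g \<in> borel_measurable borel" by (rule curve_deriv_props(1)[OF C(1)])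
  have bd: "AE t in lborel. cmod (curve_deriv g t) \<le> 2 * C" by (rule curve_deriv_props(2)[OF C(1)])
  obtain A where A: "\<And>w. w \<in> path_image g \<Longrightarrow> cmod w \<le> A"
    using compact_imp_bounded[OF compact_path_image_lip[OF C(1)]] unfolding bounded_iff by blast
  have A0: "A \<ge> 0" by (rule order_trans[OF norm_ge_zero A[OF \<gamma>im[of 0]]])
  have "bounded (f ` path_image g)"
    by (intro compact_imp_bounded compact_continuous_image fc compact_path_image_lip[OF C(1)])
  then obtain M where M: "\<And>w. w \<in> path_image g \<Longrightarrow> cmod (f w) \<le> M" unfolding bounded_iff by blast
  have M0: "M \<ge> 0" by (rule order_trans[OF norm_ge_zero M[OF \<gamma>im[of 0]]])
  define F where "F t \<xi> = (indicator V \<xi> *\<^sub>R ((1 / of_real ((cmod \<xi>)\<^sup>2)) / (\<gamma> t - \<xi>))) * (f (\<gamma> t) * curve_deriv g t)" for t \<xi>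
  have Fm: "case_prod F \<in> borel_measurable (lborel \<Otimes>\<^sub>M lborel)" unfolding F_def by measurable
  define K where "K = 2 * pi / d\<^sup>2 + (A + 1) * (2 * pi / d)"
  have K0: "K \<ge> 0" unfolding K_def using A0 V(3) by simp
  have FB: "AE t in lborel. t \<in> {0..1} \<longrightarrow> (\<integral>\<^sup>+\<xi>. ennreal (cmod (F t \<xi>)) \<partial>lborel) \<le> ennreal (M * (2 * C) * K)"
    using bd
  proof eventually_elim
    case (elim t)
    have "(\<integral>\<^sup>+\<xi>. ennreal (cmod (F t \<xi>)) \<partial>lborel) \<le> (\<integral>\<^sup>+\<xi>. ennreal (M * (2 * C)) * (ennreal (1 / (cmod \<xi>)\<^sup>2 * (1 / cmod (\<gamma> t - \<xi>))) * indicator V \<xi>) \<partial>lborel)"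
    proof (rule nn_integral_mono)
      fix \<xi>
      have "cmod (F t \<xi>) = (1 / (cmod \<xi>)\<^sup>2 * (1 / cmod (\<gamma> t - \<xi>)) * indicator V \<xi>) * (cmod (f (\<gamma> t)) * cmod (curve_deriv g t))"
        by (auto simp: F_def norm_mult norm_divide norm_power split: split_indicator)
      also have "\<dots> \<le> (1 / (cmod \<xi>)\<^sup>2 * (1 / cmod (\<gamma> t - \<xi>)) * indicator V \<xi>) * (M * (2 * C))"
        using M[OF \<gamma>im[of t]] elim M0 by (intro mult_left_mono mult_mono) auto
      finally have "ennreal (cmod (F t \<xi>)) \<le> ennreal ((M * (2 * C)) * (1 / (cmod \<xi>)\<^sup>2 * (1 / cmod (\<gamma> t - \<xi>)) * indicator V \<xi>))"
        by (intro ennreal_leI) (simp add: mult.commute)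
      also have "\<dots> = ennreal (M * (2 * C)) * (ennreal (1 / (cmod \<xi>)\<^sup>2 * (1 / cmod (\<gamma> t - \<xi>))) * indicator V \<xi>)"
        using M0 C0 by (subst ennreal_mult) (auto split: split_indicator)
      finally show "ennreal (cmod (F t \<xi>)) \<le> ennreal (M * (2 * C)) * (ennreal (1 / (cmod \<xi>)\<^sup>2 * (1 / cmod (\<gamma> t - \<xi>))) * indicator V \<xi>)" .
    qed
    also have "\<dots> = ennreal (M * (2 * C)) * (\<integral>\<^sup>+\<xi>. ennreal (1 / (cmod \<xi>)\<^sup>2 * (1 / cmod (\<gamma> t - \<xi>))) * indicator V \<xi> \<partial>lborel)"
      by (rule nn_integral_cmult) measurable
    also have "\<dots> \<le> ennreal (M * (2 * C)) * ennreal K"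
      unfolding K_def by (intro mult_left_mono nn_integral_log_cauchy_kernel V(1-3) A \<gamma>im) simp
    also have "\<dots> = ennreal (M * (2 * C) * K)" using M0 C0 K0 by (simp add: ennreal_mult[symmetric])
    finally show ?case by simp
  qed
  note swap = integral_swap_interval_plane[OF Fm FB]
  have inner: "(LINT t:{0..1}|lborel. F t \<xi>) = indicator V \<xi> *\<^sub>R (of_real (1 / (cmod \<xi>)\<^sup>2) * contour_integral g (\<lambda>w. f w / (w - \<xi>)))" for \<xi>
  proof (cases "\<xi> \<in> V")
    case True
    have c: "continuous_on (path_image g) (\<lambda>w. f w / (w - \<xi>))"
      using True Vg by (intro continuous_intros fc) auto
    have "(LINT t:{0..1}|lborel. F t \<xi>) = (LINT t:{0..1}|lborel. of_real (1 / (cmod \<xi>)\<^sup>2) * (f (g t) / (g t - \<xi>) * curve_deriv g t))"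
      by (intro set_lebesgue_integral_cong allI impI) (use True in \<open>auto simp: F_def \<gamma>g\<close>)
    also have "\<dots> = of_real (1 / (cmod \<xi>)\<^sup>2) * contour_integral g (\<lambda>w. f w / (w - \<xi>))"
      unfolding lipschitz_curve_integrable(3)[OF C(1) c] by (rule set_integral_mult_right)
    finally show ?thesis using True by simp
  qed (simp add: F_def set_lebesgue_integral_def)
  have i1: "set_integrable lborel V (\<lambda>\<xi>. of_real (1 / (cmod \<xi>)\<^sup>2) * contour_integral g (\<lambda>w. f w / (w - \<xi>)))"
    using swap(2) unfolding inner set_integrable_def .
  have lc: "continuous_on S (logC V)" for S by (rule continuous_logC[OF V(1-3)])
  have "contour_integral g (\<lambda>w. f w * logC V w) = (LINT t:{0..1}|lborel. f (g t) * logC V (g t) * curve_deriv g t)"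
    by (intro lipschitz_curve_integrable(3)[OF C(1)] continuous_intros fc lc)
  also have "\<dots> = (LINT t:{0..1}|lborel. of_real (1 / pi) * (\<integral>\<xi>. F t \<xi> \<partial>lborel))"
  proof (intro set_lebesgue_integral_cong allI impI)
    fix t :: real assume t: "t \<in> {0..1}"
    have "(\<integral>\<xi>. F t \<xi> \<partial>lborel) = (LINT \<xi>:V|lborel. (1 / of_real ((cmod \<xi>)\<^sup>2)) / (\<gamma> t - \<xi>)) * (f (\<gamma> t) * curve_deriv g t)"
      unfolding F_def set_lebesgue_integral_def by (rule integral_mult_left_zero)
    then show "f (g t) * logC V (g t) * curve_deriv g t = of_real (1 / pi) * (\<integral>\<xi>. F t \<xi> \<partial>lborel)"
      by (simp add: logC_def \<gamma>g[OF t])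
  qed simp
  also have "\<dots> = of_real (1 / pi) * (\<integral>\<xi>. (LINT t:{0..1}|lborel. F t \<xi>) \<partial>lborel)"
    using swap(1) by simp
  also have "\<dots> = of_real (1 / pi) * (LINT \<xi>:V|lborel. of_real (1 / (cmod \<xi>)\<^sup>2) * contour_integral g (\<lambda>w. f w / (w - \<xi>)))"
    by (simp only: inner) (simp only: set_lebesgue_integral_def)
  finally have e1: "contour_integral g (\<lambda>w. f w * logC V w) = of_real (1 / pi) * (LINT \<xi>:V|lborel. of_real (1 / (cmod \<xi>)\<^sup>2) * contour_integral g (\<lambda>w. f w / (w - \<xi>)))" .
  have IH: "cyc_int ps (\<lambda>w. f w * logC V w) = of_real (1 / pi) * (LINT \<xi>:V|lborel. of_real (1 / (cmod \<xi>)\<^sup>2) * cyc_int ps (\<lambda>w. f w / (w - \<xi>)))"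
    "set_integrable lborel V (\<lambda>\<xi>. of_real (1 / (cmod \<xi>)\<^sup>2) * cyc_int ps (\<lambda>w. f w / (w - \<xi>)))"
    using Cons.IH Cons.prems by (auto simp: cyc_img_Cons intro: continuous_on_subset)
  have eq: "of_real (1 / (cmod \<xi>)\<^sup>2) * cyc_int (q # ps) (\<lambda>w. f w / (w - \<xi>))
     = fst q * (of_real (1 / (cmod \<xi>)\<^sup>2) * contour_integral g (\<lambda>w. f w / (w - \<xi>))) + of_real (1 / (cmod \<xi>)\<^sup>2) * cyc_int ps (\<lambda>w. f w / (w - \<xi>))" for \<xi>
    by (simp add: cyc_int_Cons g_def algebra_simps)
  have i1': "set_integrable lborel V (\<lambda>\<xi>. fst q * (of_real (1 / (cmod \<xi>)\<^sup>2) * contour_integral g (\<lambda>w. f w / (w - \<xi>))))"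
    using i1 by (rule set_integrable_mult_right)
  define X where "X = (LINT \<xi>:V|lborel. of_real (1 / (cmod \<xi>)\<^sup>2) * contour_integral g (\<lambda>w. f w / (w - \<xi>)))"
  define Y where "Y = (LINT \<xi>:V|lborel. of_real (1 / (cmod \<xi>)\<^sup>2) * cyc_int ps (\<lambda>w. f w / (w - \<xi>)))"
  have "(LINT \<xi>:V|lborel. of_real (1 / (cmod \<xi>)\<^sup>2) * cyc_int (q # ps) (\<lambda>w. f w / (w - \<xi>))) = fst q * X + Y"
    unfolding eq set_integral_add(2)[OF i1' IH(2)] set_integral_mult_right X_def Y_def ..
  moreover have "cyc_int (q # ps) (\<lambda>w. f w * logC V w) = fst q * (of_real (1 / pi) * X) + of_real (1 / pi) * Y"
    by (simp only: cyc_int_Cons g_def[symmetric] e1 IH(1) X_def Y_def)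
  ultimately show ?case
    using set_integral_add(1)[OF i1' IH(2)] unfolding eq by (simp only: distrib_left mult.left_commute[of "fst q"])
qed

section \<open>Log-weighted quadrature domains\<close>

lemma bdry_int_eq_cyc_int: "bdry_int gs f = cyc_int (map (Pair 1) gs) f / (2 * of_real pi * \<i>)"
  by (simp add: bdry_int_def cyc_int_def o_def)

lemma cyc_img_map: "cyc_img (map (Pair c) gs) = (\<Union>g\<in>set gs. path_image g)"
  by (simp add: cyc_img_def)

lemma cyc_int_map: "cyc_int (map (Pair c) gs) f = c * cyc_int (map (Pair 1) gs) f"
  by (simp add: cyc_int_def o_def sum_list_const_mult)

lemma cyc_wn_map:
  assumes "z \<notin> (\<Union>g\<in>set gs. path_image g)"
  shows "cyc_wn (map (Pair c) gs) z = c * (\<Sum>g\<leftarrow>gs. winding_number g z)"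
proof -
  have "map (\<lambda>g. wn0 g z) gs = map (\<lambda>g. winding_number g z) gs"
    using assms by (auto simp: wn0_def)
  then show ?thesis
    by (simp only: cyc_wn_def map_map o_def fst_conv snd_conv sum_list_const_mult)
qed

text \<open>Extracts the analytic content of rationality: \<open>h\<close> is analytic near the
  complement of the domain, and vanishes at infinity whenever infinity is an exterior point.\<close>

lemma rational_on_complement:
  assumes "if hasinf then Rat_on Om hasinf h else Rat0_on Om hasinf h"
  obtains S where "open S" "- Om \<subseteq> S" "h holomorphic_on S" "\<not> hasinf \<Longrightarrow> (h \<longlongrightarrow> 0) at_infinity"
proof -
  obtain p q where pq: "q \<noteq> 0" "h = (\<lambda>w. poly p w / poly q w)" "{w. poly q w = 0} \<subseteq> Om"
    "\<not> hasinf \<Longrightarrow> p = 0 \<or> degree p < degree q"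
    using assms unfolding Rat_on_def Rat0_on_def by (auto split: if_splits)
  show thesis
  proof
    show "open (- {w. poly q w = 0})"
      using poly_roots_finite[OF pq(1)] by (intro open_Compl finite_imp_closed)
    show "- Om \<subseteq> - {w. poly q w = 0}" using pq(3) by blast
    show "h holomorphic_on - {w. poly q w = 0}"
      unfolding pq(2) by (intro holomorphic_intros) auto
    show "(h \<longlongrightarrow> 0) at_infinity" if "\<not> hasinf"
      using pq(4)[OF that] poly_divide_tendsto_0_at_infinity[of p q] unfolding pq(2) by auto
  qed
qed

section \<open>The domain and its exterior, with Cauchy's formula on both sides\<close>

locale quadrature_setup =
  fixes Om :: "complex set" and hasinf :: bool and gs :: "(real \<Rightarrow> complex) list"
  assumes dom: "sphere_domain Om hasinf" and rect: "boundary_cycle Om hasinf gs"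
begin

lemma open_Om: "open Om" and Om_ne: "Om \<noteq> {}" and frontier0: "0 \<notin> frontier Om" and regular: "interior (closure Om) = Om"
  and bounded_Om: "\<not> hasinf \<Longrightarrow> bounded Om" and bounded_compl: "hasinf \<Longrightarrow> bounded (- Om)"
  using dom by (auto simp: sphere_domain_def split: if_splits)

lemma Om_borel [measurable]: "Om \<in> sets borel" using open_Om by auto

abbreviation "Ext \<equiv> - closure Om"

lemma closure_Ext: "closure Ext = - Om"
  by (simp add: closure_complement regular)

lemma frontier_Om: "frontier Om = closure Om - Om"
  using open_Om by (simp add: frontier_def interior_open)

lemma frontier_Ext: "frontier Ext = frontier Om"
  unfolding frontier_complement frontier_Om by (simp add: frontier_def regular)

lemma frontier_subset_closure_Ext: "frontier Om \<subseteq> closure Ext"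
  unfolding closure_Ext frontier_Om by blast

lemma closed_lip_map: "\<And>p. p \<in> set (map (Pair c) gs) \<Longrightarrow> closed_lip (snd p)"
  using rect by (auto simp: boundary_cycle_def closed_lip_def)

lemma img_map: "cyc_img (map (Pair c) gs) = frontier Om"
  using rect by (simp add: cyc_img_map boundary_cycle_def)

lemma wn_map:
  assumes "z \<notin> frontier Om"
  shows "cyc_wn (map (Pair c) gs) z = c * ((if z \<in> Om then 1 else 0) - (if hasinf then 1 else 0))"
  using rect assms by (subst cyc_wn_map) (auto simp: boundary_cycle_def)

lemma bdry_int_cong:
  assumes "\<And>w. w \<in> frontier Om \<Longrightarrow> f w = g w"
  shows "bdry_int gs f = bdry_int gs g"
  unfolding bdry_int_eq_cyc_int using cyc_int_cong[of "map (Pair 1) gs" f g] assms by (simp add: img_map)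

lemma bdry_integrable:
  assumes "continuous_on (frontier Om) f" "p \<in> set (map (Pair (1::complex)) gs)"
  shows "f contour_integrable_on (snd p)"
  by (rule cyc_int_integrable[OF _ _ assms(2)], erule closed_lip_map) (use assms(1) in \<open>simp add: img_map\<close>)

lemma bdry_int_add:
  assumes "continuous_on (frontier Om) f" "continuous_on (frontier Om) g"
  shows "bdry_int gs (\<lambda>w. f w + g w) = bdry_int gs f + bdry_int gs g"
  unfolding bdry_int_eq_cyc_int add_divide_distrib[symmetric]
  by (rule arg_cong[where f="\<lambda>x. x / (2 * of_real pi * \<i>)"], rule cyc_int_add) (erule bdry_integrable[OF assms(1)], erule bdry_integrable[OF assms(2)])

lemma bdry_int_lmul:
  assumes "continuous_on (frontier Om) f"
  shows "bdry_int gs (\<lambda>w. c * f w) = c * bdry_int gs f"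
  unfolding bdry_int_eq_cyc_int by (subst cyc_int_lmul) (erule bdry_integrable[OF assms], simp)

lemma cauchy_formula_A_space:
  assumes f: "A_space Om hasinf f" and l: "hasinf \<Longrightarrow> (f \<longlongrightarrow> l) at_infinity" and z: "z \<in> Om"
  shows "bdry_int gs (\<lambda>w. f w / (w - z)) = f z - (if hasinf then l else 0)"
proof -
  have fh: "f holomorphic_on Om" and fc: "continuous_on (closure Om) f" using f by (auto simp: A_space_def)
  have "cyc_int (map (Pair 1) gs) (\<lambda>w. f w / (w - z)) = 2 * of_real pi * \<i> * (f z - (if hasinf then l else 0))"
  proof (cases hasinf)
    case True
    have "cyc_int (map (Pair 1) gs) (\<lambda>w. f w / (w - z)) = 2 * of_real pi * \<i> * (f z - l)"
      by (rule cauchy_formula_exterior[OF _ open_Om bounded_compl[OF True] img_map _ fc fh l[OF True] z], erule closed_lip_map)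
         (use True in \<open>simp_all add: wn_map\<close>)
    then show ?thesis using True by simp
  next
    case False
    have "cyc_int (map (Pair 1) gs) (\<lambda>w. f w / (w - z)) = 2 * of_real pi * \<i> * f z"
      by (rule cauchy_formula_rectifiable[OF _ open_Om bounded_Om[OF False] _ _ _ fc fh z], erule closed_lip_map)
         (use False z in \<open>simp_all add: wn_map img_map frontier_Om\<close>)
    then show ?thesis using False by simp
  qed
  then show ?thesis by (simp add: bdry_int_eq_cyc_int)
qed

text \<open>The poles of \<open>h\<close> lie in the domain, so \<open>h\<close> is analytic on the
  exterior and continuous up to the boundary. Cauchy's formula is therefore used on the exterior,
  with infinity now on the other side.\<close>

lemma cauchy_formula_rational:
  assumes h: "if hasinf then Rat_on Om hasinf h else Rat0_on Om hasinf h" and w: "w \<in> Ext"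
  shows "bdry_int gs (\<lambda>\<xi>. h \<xi> / (w - \<xi>)) = h w"
proof -
  obtain S where S: "open S" "- Om \<subseteq> S" "h holomorphic_on S" "\<not> hasinf \<Longrightarrow> (h \<longlongrightarrow> 0) at_infinity"
    using rational_on_complement[OF h] by blast
  have hc: "continuous_on (closure Ext) h" unfolding closure_Ext
    using holomorphic_on_imp_continuous_on[OF S(3)] S(2) by (rule continuous_on_subset)
  have hh: "h holomorphic_on Ext"
    by (rule holomorphic_on_subset[OF S(3)]) (use S(2) closure_subset[of Om] in blast)
  have fE: "frontier (closure Om) = frontier Om" using frontier_Ext by simp
  have wf: "w \<notin> frontier Om" using w unfolding frontier_Om by simp
  have disj: "z \<notin> Om \<longleftrightarrow> z \<in> Ext" if "z \<notin> frontier Om" for z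
    using that closure_subset[of Om] unfolding frontier_Om by blast
  \<comment> \<open>The weight -1 reverses the cycle, which makes it positively oriented with
    respect to the exterior.\<close>
  have "cyc_int (map (Pair (-1)) gs) (\<lambda>\<xi>. h \<xi> / (\<xi> - w)) = 2 * of_real pi * \<i> * h w"
  proof (cases hasinf)
    case True
    have "bounded Ext" using bounded_compl[OF True] by (rule bounded_subset) (use closure_subset[of Om] in blast)
    then show ?thesis
      by (intro cauchy_formula_rectifiable[OF _ _ _ _ _ _ hc hh w])
         (erule closed_lip_map, use True w wf disj frontier_subset_closure_Ext in \<open>auto simp: wn_map img_map fE\<close>)
  next
    case False
    have "bounded (- Ext)" using bounded_closure[OF bounded_Om[OF False]] by simp
    then have "cyc_int (map (Pair (-1)) gs) (\<lambda>\<xi>. h \<xi> / (\<xi> - w)) = 2 * of_real pi * \<i> * (h w - 0)"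
      by (intro cauchy_formula_exterior[OF _ _ _ _ _ hc hh S(4)[OF False] w])
         (erule closed_lip_map, use False disj in \<open>auto simp: wn_map img_map fE\<close>)
    then show ?thesis by simp
  qed
  then have "cyc_int (map (Pair 1) gs) (\<lambda>\<xi>. h \<xi> / (\<xi> - w)) = - (2 * of_real pi * \<i> * h w)"
    unfolding cyc_int_map[of "-1"] by (simp add: neg_eq_iff_add_eq_0 eq_neg_iff_add_eq_0 add.commute)
  then have "bdry_int gs (\<lambda>\<xi>. h \<xi> / (\<xi> - w)) = - h w"
    by (simp add: bdry_int_eq_cyc_int)
  moreover have "bdry_int gs (\<lambda>\<xi>. h \<xi> / (w - \<xi>)) = bdry_int gs (\<lambda>\<xi>. (-1) * (h \<xi> / (\<xi> - w)))"
    by (intro bdry_int_cong) (metis minus_diff_eq minus_divide_right mult_minus1)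
  moreover have "bdry_int gs (\<lambda>\<xi>. (-1) * (h \<xi> / (\<xi> - w))) = (-1) * bdry_int gs (\<lambda>\<xi>. h \<xi> / (\<xi> - w))"
  proof (rule bdry_int_lmul)
    have "\<xi> - w \<noteq> 0" if "\<xi> \<in> frontier Om" for \<xi> using that w unfolding frontier_Om by auto
    then show "continuous_on (frontier Om) (\<lambda>\<xi>. h \<xi> / (\<xi> - w))"
      by (intro continuous_intros continuous_on_subset[OF hc frontier_subset_closure_Ext]) auto
  qed
  ultimately show ?thesis by simp
qed

lemma L1a_vanishes_at_infinity:
  assumes "L1a Om hasinf f" hasinf
  shows "(f \<longlongrightarrow> 0) at_infinity"
proof -
  have "analytic_at_infinity f" using assms by (auto simp: L1a_def A_space_def)
  then obtain l where l: "(f \<longlongrightarrow> l) at_infinity" by (rule analytic_at_infinity_tendsto)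
  have "l = 0"
    by (rule set_integrable_inverse_square_tendsto_0[OF Om_borel bounded_compl[OF assms(2)] _ l])
       (use assms in \<open>simp add: L1a_def\<close>)
  then show ?thesis using l by simp
qed

text \<open>The set \<open>V\<close> is kept general to serve both cases: the whole domain when 0 is
  outside, and the domain without a disc around 0 otherwise.\<close>

lemma weighted_integral_eq_bdry_int:
  assumes f: "L1a Om hasinf f" and V: "V \<in> sets borel" "V \<subseteq> Om" "V \<inter> ball 0 d = {}" "d > 0"
  shows "of_real (1 / pi) * (LINT \<xi>:V|lborel. f \<xi> / of_real ((cmod \<xi>)\<^sup>2)) = bdry_int gs (\<lambda>w. f w * logC V w)"
proof -
  have fA: "A_space Om hasinf f" using f by (simp add: L1a_def)
  then have fc: "continuous_on (frontier Om) f"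
    unfolding A_space_def frontier_Om by (auto intro: continuous_on_subset)
  have "V \<inter> frontier Om = {}" using V(2) unfolding frontier_Om by blast
  then have swap: "cyc_int (map (Pair 1) gs) (\<lambda>w. f w * logC V w)
     = of_real (1 / pi) * (LINT \<xi>:V|lborel. of_real (1 / (cmod \<xi>)\<^sup>2) * cyc_int (map (Pair 1) gs) (\<lambda>w. f w / (w - \<xi>)))"
    by (intro conjunct1[OF cycle_logC_swap[OF _ _ V(1,3,4)]]) (erule closed_lip_map, simp_all add: img_map fc)
  have val: "cyc_int (map (Pair 1) gs) (\<lambda>w. f w / (w - \<xi>)) = 2 * of_real pi * \<i> * f \<xi>" if "\<xi> \<in> V" for \<xi>
    using cauchy_formula_A_space[OF fA L1a_vanishes_at_infinity[OF f], of \<xi>] that V(2)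
    by (auto simp: bdry_int_eq_cyc_int field_simps)
  have "(LINT \<xi>:V|lborel. of_real (1 / (cmod \<xi>)\<^sup>2) * cyc_int (map (Pair 1) gs) (\<lambda>w. f w / (w - \<xi>)))
     = (LINT \<xi>:V|lborel. 2 * of_real pi * \<i> * (f \<xi> / of_real ((cmod \<xi>)\<^sup>2)))"
    using V(1) by (intro set_lebesgue_integral_cong allI impI) (auto simp: val)
  also have "\<dots> = 2 * of_real pi * \<i> * (LINT \<xi>:V|lborel. f \<xi> / of_real ((cmod \<xi>)\<^sup>2))"
    by (rule set_integral_mult_right)
  finally show ?thesis unfolding bdry_int_eq_cyc_int swap by simp
qed

text \<open>The condition \<open>interior (closure Om) = Om\<close> makes every boundary point a
  limit of exterior points, so identities on the exterior pass to the boundary by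
  continuity.\<close>

lemma eq_on_frontier:
  assumes "continuous_on (- Om) f" "continuous_on (- Om) g" "\<And>w. w \<in> Ext \<Longrightarrow> f w = g w" "w \<in> frontier Om"
  shows "f w = (g w :: complex)"
proof -
  have "w \<in> closure Ext" using assms(4) frontier_subset_closure_Ext by blast
  then have "f w - g w = 0"
    by (rule continuous_constant_on_closure[rotated 2])
       (use assms(1-3) in \<open>auto simp: closure_Ext intro!: continuous_intros\<close>)
  then show ?thesis by simp
qed

end

context quadrature_setup
begin

lemma bounded_compl_R:
  assumes hasinf
  obtains R where "- Om \<subseteq> ball 0 R"
  using bounded_subset_ballD[OF bounded_compl[OF assms], of 0] by blast

lemma inverse_tendsto_0_at_infinity: "((\<lambda>\<xi>::complex. c / (w - \<xi>)) \<longlongrightarrow> 0) at_infinity"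
proof -
  have "filterlim (\<lambda>\<xi>::complex. - cmod w + cmod \<xi>) at_top at_infinity"
    by (rule filterlim_tendsto_add_at_top[OF tendsto_const filterlim_norm_at_top])
  then have "filterlim (\<lambda>\<xi>. cmod (w - \<xi>)) at_top at_infinity"
  proof (rule filterlim_at_top_mono, intro always_eventually allI)
    fix \<xi> show "- cmod w + cmod \<xi> \<le> cmod (w - \<xi>)"
      using norm_triangle_ineq2[of \<xi> w] by (simp add: norm_minus_commute)
  qed
  then have "filterlim (\<lambda>\<xi>. w - \<xi>) at_infinity at_infinity"
    by (simp add: filterlim_at_infinity_conv_norm_at_top)
  then show ?thesis by (rule tendsto_divide_0[OF tendsto_const])
qed

lemma A_spaceI:
  assumes "f holomorphic_on Om" "continuous_on (closure Om) f" "hasinf \<Longrightarrow> (f \<longlongrightarrow> l) at_infinity"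
  shows "A_space Om hasinf f"
proof -
  have "analytic_at_infinity f" if inf: hasinf
  proof -
    obtain R where R: "- Om \<subseteq> ball 0 R" using bounded_compl_R[OF inf] by blast
    show ?thesis
    proof (rule analytic_at_infinityI[OF holomorphic_on_subset[OF assms(1)] assms(3)[OF inf]])
      show "{w. R < cmod w} \<subseteq> Om" using R by force
    qed
  qed
  then show ?thesis using assms by (simp add: A_space_def)
qed

lemma A_space_limit:
  assumes "A_space Om hasinf f"
  obtains l where "hasinf \<Longrightarrow> (f \<longlongrightarrow> l) at_infinity"
proof (cases hasinf)
  case True
  then have "analytic_at_infinity f" using assms by (simp add: A_space_def)
  then show ?thesis using that by (rule analytic_at_infinity_tendsto) 
qed (use that in blast)

lemma cauchy_kernel_A_space:
  assumes "w \<in> Ext"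
  shows "A_space Om hasinf (\<lambda>\<xi>. c / (w - \<xi>))" 
proof (rule A_spaceI)
  have nz: "w - \<xi> \<noteq> 0" if "\<xi> \<in> closure Om" for \<xi> using that assms by auto
  then show "continuous_on (closure Om) (\<lambda>\<xi>. c / (w - \<xi>))" by (intro continuous_intros) auto
  show "(\<lambda>\<xi>. c / (w - \<xi>)) holomorphic_on Om"
    using nz closure_subset[of Om] by (intro holomorphic_intros) auto
  show "((\<lambda>\<xi>. c / (w - \<xi>)) \<longlongrightarrow> 0) at_infinity" by (rule inverse_tendsto_0_at_infinity)
qed

lemma ball_disjoint:
  assumes "x \<in> Om" "\<forall>z\<in>frontier Om. r < cmod (z - x)" "0 < r"
  shows "ball x r \<subseteq> Om"
proof (rule ccontr)
  assume "\<not> ball x r \<subseteq> Om"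
  then have "ball x r - Om \<noteq> {}" by blast
  moreover have "x \<in> ball x r" using assms(3) by simp
  then have "ball x r \<inter> Om \<noteq> {}" using assms(1) by blast
  ultimately have "ball x r \<inter> frontier Om \<noteq> {}" by (intro connected_Int_frontier connected_ball)
  then obtain p where "p \<in> frontier Om" "cmod (p - x) < r" by (auto simp: dist_norm norm_minus_commute)
  then show False using assms(2) by fastforce
qed

lemma rational_continuous:
  assumes "if hasinf then Rat_on Om hasinf h else Rat0_on Om hasinf h"
  shows "continuous_on (- Om) h"
  using rational_on_complement[OF assms] holomorphic_on_imp_continuous_on continuous_on_subset by metis

subsection \<open>The case \<open>0 \<notin> \<Omega>\<close>\<close>

lemma quadrature_iff_outside_0:
  assumes h: "if hasinf then Rat_on Om hasinf h else Rat0_on Om hasinf h" and 0: "0 \<notin> Om"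
  shows "QD0 Om hasinf gs h \<longleftrightarrow> (\<forall>w\<in>Ext. wcauchy Om w = h w)"
proof -
  \<comment> \<open>Being neither in the domain nor on its boundary, 0 has a disc around it free of
    the domain, and the weight is bounded on the domain.\<close>
  have "0 \<in> Ext" using 0 frontier0 unfolding frontier_Om by blast
  then obtain d where d: "d > 0" "ball 0 d \<subseteq> Ext" using openE[of Ext 0] by (metis closed_closure open_Compl)
  have Od: "Om \<inter> ball 0 d = {}" using d(2) closure_subset[of Om] by blast
  have wc: "wcauchy Om w = logC Om w" for w by (rule wcauchy_eq_logC[OF Om_borel Od d(1)])
  have pv: "area_pv Om (\<lambda>w. f w / of_real ((cmod w)\<^sup>2)) = bdry_int gs (\<lambda>w. f w * logC Om w)" if f: "L1a Om hasinf f" for f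
  proof -
    have "area_pv Om (\<lambda>w. f w / of_real ((cmod w)\<^sup>2)) = of_real (1 / pi) * (LINT \<xi>:Om|lborel. f \<xi> / of_real ((cmod \<xi>)\<^sup>2))"
      by (rule area_pv_eq[OF Om_borel]) (use f in \<open>simp add: L1a_def\<close>)
    also have "\<dots> = bdry_int gs (\<lambda>w. f w * logC Om w)"
      by (rule weighted_integral_eq_bdry_int[OF f Om_borel _ Od d(1)]) simp
    finally show ?thesis .
  qed
  show ?thesis
  proof
    assume Q: "QD0 Om hasinf gs h"
    show "\<forall>w\<in>Ext. wcauchy Om w = h w"
    proof
      fix w assume w: "w \<in> Ext"
      have eq: "1 / (w - \<xi>) / of_real ((cmod \<xi>)\<^sup>2) = 1 / of_real ((cmod \<xi>)\<^sup>2) / (w - \<xi>)" for \<xi> by simp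
      have "L1a Om hasinf (\<lambda>\<xi>. 1 / (w - \<xi>))"
        unfolding L1a_def eq using cauchy_kernel_A_space[OF w] set_integrable_log_cauchy_kernel[OF Om_borel Od d(1)] by blast
      then have "area_pv Om (\<lambda>\<xi>. 1 / (w - \<xi>) / of_real ((cmod \<xi>)\<^sup>2)) = bdry_int gs (\<lambda>\<xi>. 1 / (w - \<xi>) * h \<xi>)"
        using Q unfolding QD0_def by blast
      then show "wcauchy Om w = h w"
        using cauchy_formula_rational[OF h w] unfolding eq wcauchy_def by simp
    qed
  next
    assume C: "\<forall>w\<in>Ext. wcauchy Om w = h w"
    have fr: "logC Om w = h w" if "w \<in> frontier Om" for w
      by (rule eq_on_frontier[OF continuous_logC[OF Om_borel Od d(1)] rational_continuous[OF h] _ that]) (use C wc in simp)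
    show "QD0 Om hasinf gs h" unfolding QD0_def
    proof (intro conjI allI impI h)
      fix f assume f: "L1a Om hasinf f"
      show "area_pv Om (\<lambda>w. f w / of_real ((cmod w)\<^sup>2)) = bdry_int gs (\<lambda>w. f w * h w)"
        unfolding pv[OF f] by (intro bdry_int_cong) (simp add: fr)
    qed
  qed
qed

subsection \<open>The case \<open>0 \<in> \<Omega>\<close>\<close>

context
  fixes h :: "complex \<Rightarrow> complex" and r :: real
  assumes h: "if hasinf then Rat_on Om hasinf h else Rat0_on Om hasinf h" and zero: "0 \<in> Om"
    and r: "0 < r" "\<forall>z\<in>frontier Om. r < cmod z"
begin

lemma ball_subset: "ball 0 r \<subseteq> Om"
  using ball_disjoint[of 0 r] zero r by simp

abbreviation "V \<equiv> Om - ball 0 r"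

lemma V_facts: "V \<in> sets borel" "V \<subseteq> Om" "V \<inter> ball 0 r = {}"
  by auto

lemma compl_facts: "- Om \<in> sets borel" "- Om \<inter> ball 0 r = {}"
  using ball_subset by auto

lemma wcauchy_V: "wcauchy V w = logC V w"
  by (rule wcauchy_eq_logC[OF V_facts(1,3) r(1)])

text \<open>The complement of the disc splits into \<open>V\<close> and the complement of the
  domain. Boundary points have modulus above \<open>r\<close>, so the explicit transform of the
  disc's complement applies to them.\<close>

lemma logC_V_frontier:
  assumes "w \<in> frontier Om"
  shows "of_real (ln ((cmod w)\<^sup>2)) / w = logC V w + of_real (ln (r\<^sup>2)) / w + logC (- Om) w"
proof -
  have "V \<union> - Om = - ball 0 r" using ball_subset by blast
  then have "logC (- ball 0 r) w = logC V w + logC (- Om) w"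
    using logC_Un[OF V_facts(1) compl_facts(1) _ V_facts(3) compl_facts(2) r(1), of w] by auto
  then show ?thesis using logC_outside_ball[OF r(1), of w] r(2) assms by (simp add: algebra_simps)
qed

lemma area_pv_V:
  assumes f: "L1a Om hasinf f" "f 0 = 0"
  shows "area_pv Om (\<lambda>w. f w / of_real ((cmod w)\<^sup>2)) = of_real (1 / pi) * (LINT \<xi>:V|lborel. f \<xi> / of_real ((cmod \<xi>)\<^sup>2))"
proof -
  have i: "set_integrable lborel Om (\<lambda>w. f w / of_real ((cmod w)\<^sup>2))" using f by (simp add: L1a_def)
  have iV: "set_integrable lborel V (\<lambda>w. f w / of_real ((cmod w)\<^sup>2))"
    and iB: "set_integrable lborel (ball 0 r) (\<lambda>w. f w / of_real ((cmod w)\<^sup>2))"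
    by (rule set_integrable_subset[OF i]; use ball_subset in simp)+
  have "f holomorphic_on ball 0 r"
    using f(1) ball_subset by (auto simp: L1a_def A_space_def intro: holomorphic_on_subset)
  then have "(LINT \<xi>:ball 0 r|lborel. f \<xi> / of_real ((cmod \<xi>)\<^sup>2)) = 0"
    by (rule integral_ball_inverse_square_eq_0[OF _ f(2) r(1) order_refl iB])
  moreover have "V \<union> ball 0 r = Om" using ball_subset by blast
  ultimately have "(LINT \<xi>:Om|lborel. f \<xi> / of_real ((cmod \<xi>)\<^sup>2)) = (LINT \<xi>:V|lborel. f \<xi> / of_real ((cmod \<xi>)\<^sup>2))"
    using set_integral_Un[OF _ iV iB] V_facts(3) by simp
  then show ?thesis using area_pv_eq[OF Om_borel i] by simp
qed

lemma L1a_vanishes_at_0: "L1a Om hasinf f \<Longrightarrow> f 0 = 0"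
proof -
  assume f: "L1a Om hasinf f"
  then have "continuous_on Om f" by (auto simp: L1a_def A_space_def intro: holomorphic_on_imp_continuous_on)
  then have "isCont f 0" using open_Om zero continuous_on_eq_continuous_at by blast
  then show "f 0 = 0"
    by (intro set_integrable_inverse_square_zero_at_0[OF Om_borel ball_subset r(1)]) (use f in \<open>simp_all add: L1a_def\<close>)
qed

lemma logC_compl_A_space: "A_space Om hasinf (logC (- Om))"
proof (rule A_spaceI)
  show "logC (- Om) holomorphic_on Om"
    by (rule holomorphic_logC[OF compl_facts r(1) open_Om]) simp
  show "continuous_on (closure Om) (logC (- Om))"
    by (rule continuous_logC[OF compl_facts r(1)])
  show "(logC (- Om) \<longlongrightarrow> 0) at_infinity" if inf: hasinf
  proof -
    obtain R where "- Om \<subseteq> ball 0 R" using bounded_compl_R[OF inf] by blast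
    then show ?thesis by (rule logC_tendsto_0[OF compl_facts r(1)])
  qed
qed

lemma frontier_nz: "w \<in> frontier Om \<Longrightarrow> w \<noteq> 0"
  using r by force

text \<open>Cauchy's formula at the origin, where test functions vanish. This is why the quadrature
  identity cannot detect a multiple of \<open>1 / w\<close>.\<close>

lemma bdry_int_div_0:
  assumes f: "L1a Om hasinf f"
  shows "bdry_int gs (\<lambda>w. f w / w) = 0"
proof -
  have "bdry_int gs (\<lambda>w. f w / (w - 0)) = f 0 - (if hasinf then 0 else 0)"
    by (rule cauchy_formula_A_space[OF _ L1a_vanishes_at_infinity[OF f] zero]) (use f in \<open>simp_all add: L1a_def\<close>)
  then show ?thesis using L1a_vanishes_at_0[OF f] by simp
qed

lemma L1a_continuous: "L1a Om hasinf f \<Longrightarrow> continuous_on (frontier Om) f"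
  unfolding L1a_def A_space_def frontier_Om by (auto intro: continuous_on_subset)

lemma frontier_subset_compl: "frontier Om \<subseteq> - Om"
  unfolding frontier_Om by blast

lemma quadrature_if_cauchy_transform:
  assumes C: "\<And>w. w \<in> Ext \<Longrightarrow> wcauchy V w + of_real (ln (r\<^sup>2)) / w = h w + q / w"
  shows "QD0 Om hasinf gs h \<and> (\<exists>G. A_space Om hasinf G \<and> (\<forall>w\<in>frontier Om. of_real (ln ((cmod w)\<^sup>2)) / w = h w + q / w + G w))"
proof -
  have nz: "w \<noteq> 0" if "w \<in> - Om" for w using that zero by auto
  have hc: "continuous_on (- Om) h" by (rule rational_continuous[OF h])
  have fr: "logC V w + of_real (ln (r\<^sup>2)) / w = h w + q / w" if "w \<in> frontier Om" for w
    by (rule eq_on_frontier[of "\<lambda>w. logC V w + of_real (ln (r\<^sup>2)) / w" "\<lambda>w. h w + q / w", OF _ _ _ that])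
       (use nz C in \<open>auto simp: wcauchy_V intro!: continuous_intros hc continuous_logC[OF V_facts(1,3) r(1)]\<close>)
  have "QD0 Om hasinf gs h" unfolding QD0_def
  proof (intro conjI allI impI h)
    fix f assume f: "L1a Om hasinf f"
    note fc = L1a_continuous[OF f]
    have "area_pv Om (\<lambda>w. f w / of_real ((cmod w)\<^sup>2)) = bdry_int gs (\<lambda>w. f w * logC V w)"
      unfolding area_pv_V[OF f L1a_vanishes_at_0[OF f]] by (rule weighted_integral_eq_bdry_int[OF f V_facts r(1)])
    \<comment> \<open>On the boundary \<open>logC V\<close> differs from \<open>h\<close> by a
      multiple of \<open>1 / w\<close>, which integrates to 0 against \<open>f\<close>.\<close>
    also have "\<dots> = bdry_int gs (\<lambda>w. f w * h w + (q - of_real (ln (r\<^sup>2))) * (f w / w))"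
    proof (rule bdry_int_cong)
      fix w assume w: "w \<in> frontier Om"
      have e: "logC V w = h w + q / w - of_real (ln (r\<^sup>2)) / w" using fr[OF w] by (simp add: eq_diff_eq)
      show "f w * logC V w = f w * h w + (q - of_real (ln (r\<^sup>2))) * (f w / w)"
        unfolding e by (simp add: algebra_simps diff_divide_distrib)
    qed
    also have "\<dots> = bdry_int gs (\<lambda>w. f w * h w) + bdry_int gs (\<lambda>w. (q - of_real (ln (r\<^sup>2))) * (f w / w))"
      by (rule bdry_int_add) (use frontier_nz in \<open>auto intro!: continuous_intros fc continuous_on_subset[OF hc frontier_subset_compl]\<close>)
    also have "bdry_int gs (\<lambda>w. (q - of_real (ln (r\<^sup>2))) * (f w / w)) = (q - of_real (ln (r\<^sup>2))) * bdry_int gs (\<lambda>w. f w / w)"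
      by (rule bdry_int_lmul) (use frontier_nz in \<open>auto intro!: continuous_intros fc\<close>)
    finally show "area_pv Om (\<lambda>w. f w / of_real ((cmod w)\<^sup>2)) = bdry_int gs (\<lambda>w. f w * h w)"
      by (simp add: bdry_int_div_0[OF f])
  qed
  moreover have "of_real (ln ((cmod w)\<^sup>2)) / w = h w + q / w + logC (- Om) w" if "w \<in> frontier Om" for w
    using logC_V_frontier[OF that] fr[OF that] by simp
  ultimately show ?thesis using logC_compl_A_space by blast
qed

text \<open>The difference equals \<open>\<xi> * (w0 - w) / ((w - \<xi>) * (w0 - \<xi>))\<close>.
  The factor \<xi> turns the weight near 0 into \<open>1 / cmod \<xi>\<close>, which is integrable
  there; off the disc each term is integrable by itself.\<close>

lemma test_function_L1a:
  assumes w: "w \<in> Ext" "w0 \<in> Ext"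
  shows "L1a Om hasinf (\<lambda>\<xi>. w / (w - \<xi>) - w0 / (w0 - \<xi>))"
proof -
  define f where "f \<xi> = w / (w - \<xi>) - w0 / (w0 - \<xi>)" for \<xi>
  have nz: "w - \<xi> \<noteq> 0" "w0 - \<xi> \<noteq> 0" if "\<xi> \<in> Om" for \<xi> using that w closure_subset[of Om] by auto
  have A: "A_space Om hasinf f"
  proof (rule A_spaceI)
    show "f holomorphic_on Om" "continuous_on (closure Om) f"
      using cauchy_kernel_A_space[OF w(1), of w] cauchy_kernel_A_space[OF w(2), of w0]
      unfolding f_def A_space_def by (auto intro!: holomorphic_intros continuous_on_diff)
    show "(f \<longlongrightarrow> 0) at_infinity"
      unfolding f_def using tendsto_diff[OF inverse_tendsto_0_at_infinity[of w w] inverse_tendsto_0_at_infinity[of w0 w0]] by simp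
  qed
  have iV: "set_integrable lborel V (\<lambda>\<xi>. f \<xi> / of_real ((cmod \<xi>)\<^sup>2))"
  proof -
    have k: "set_integrable lborel V (\<lambda>\<xi>. v * (1 / of_real ((cmod \<xi>)\<^sup>2) / (v - \<xi>)))" for v
      by (intro set_integrable_mult_right set_integrable_log_cauchy_kernel[OF V_facts(1,3) r(1)])
    have "f \<xi> / of_real ((cmod \<xi>)\<^sup>2) = w * (1 / of_real ((cmod \<xi>)\<^sup>2) / (w - \<xi>)) - w0 * (1 / of_real ((cmod \<xi>)\<^sup>2) / (w0 - \<xi>))" for \<xi>
      unfolding f_def by (simp add: diff_divide_distrib mult.commute)
    then show ?thesis using set_integral_diff(1)[OF k k, of w w0] by simp
  qed
  obtain \<delta> where \<delta>: "\<delta> > 0" "ball w \<delta> \<subseteq> Ext" "ball w0 \<delta> \<subseteq> Ext"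
  proof -
    obtain a b where "a > 0" "ball w a \<subseteq> Ext" "b > 0" "ball w0 b \<subseteq> Ext"
      using w openE[of Ext] by (metis closed_closure open_Compl)
    then show thesis by (intro that[of "min a b"]) auto
  qed
  have far: "\<delta> \<le> cmod (v - \<xi>)" if "\<xi> \<in> Om" "ball v \<delta> \<subseteq> Ext" for v \<xi>
  proof (rule ccontr)
    assume "\<not> \<delta> \<le> cmod (v - \<xi>)"
    then have "\<xi> \<in> ball v \<delta>" by (simp add: dist_norm)
    then show False using that closure_subset[of Om] by blast
  qed
  define c where "c = cmod (w0 - w) / (\<delta> * \<delta>)"
  have iB: "set_integrable lborel (ball 0 r) (\<lambda>\<xi>. f \<xi> / of_real ((cmod \<xi>)\<^sup>2))"
    unfolding set_integrable_def
  proof (rule Bochner_Integration.integrable_bound)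
    show "integrable lborel (\<lambda>\<xi>::complex. c * (indicator (ball 0 r) \<xi> * (1 / cmod \<xi>)))"
    proof (intro integrable_mult_right integrableI_bounded)
      have "(\<integral>\<^sup>+\<xi>. ennreal (norm (indicator (ball 0 r) \<xi> * (1 / cmod \<xi>))) \<partial>lborel)
         = (\<integral>\<^sup>+\<xi>. ennreal (1 / cmod (\<xi> - 0)) * indicator (ball 0 r) \<xi> \<partial>lborel)"
        by (intro nn_integral_cong) (auto split: split_indicator)
      also have "\<dots> < \<infinity>" using nn_integral_inverse_ball_0[of r 0] r(1) by (auto intro: le_less_trans)
      finally show "(\<integral>\<^sup>+\<xi>. ennreal (norm (indicator (ball 0 r) \<xi> * (1 / cmod \<xi>))) \<partial>lborel) < \<infinity>" .
    qed measurable
    show "(\<lambda>\<xi>. indicator (ball 0 r) \<xi> *\<^sub>R (f \<xi> / of_real ((cmod \<xi>)\<^sup>2))) \<in> borel_measurable lborel"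
      unfolding f_def by measurable
    show "AE \<xi> in lborel. norm (indicator (ball 0 r) \<xi> *\<^sub>R (f \<xi> / of_real ((cmod \<xi>)\<^sup>2))) \<le> norm (c * (indicator (ball 0 r) \<xi> * (1 / cmod \<xi>)))"
    proof (intro AE_I2)
      fix \<xi>
      have "cmod (f \<xi> / of_real ((cmod \<xi>)\<^sup>2)) \<le> c * (1 / cmod \<xi>)" if \<xi>: "\<xi> \<in> ball 0 r"
      proof -
        have O: "\<xi> \<in> Om" using \<xi> ball_subset by blast
        have "f \<xi> = \<xi> * (w0 - w) / ((w - \<xi>) * (w0 - \<xi>))"
          using nz[OF O] unfolding f_def by (simp add: diff_frac_eq) (simp add: algebra_simps)
        then have "cmod (f \<xi> / of_real ((cmod \<xi>)\<^sup>2)) = cmod (w0 - w) / (cmod (w - \<xi>) * cmod (w0 - \<xi>)) * (1 / cmod \<xi>)"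
          by (simp add: norm_divide norm_mult norm_power power2_eq_square)
        also have "\<dots> \<le> c * (1 / cmod \<xi>)"
          unfolding c_def using far[OF O \<delta>(2)] far[OF O \<delta>(3)] \<delta>(1)
          by (intro mult_right_mono divide_left_mono mult_mono mult_pos_pos) auto
        finally show ?thesis .
      qed
      moreover have "c \<ge> 0" using \<delta>(1) by (simp add: c_def)
      ultimately show "norm (indicator (ball 0 r) \<xi> *\<^sub>R (f \<xi> / of_real ((cmod \<xi>)\<^sup>2))) \<le> norm (c * (indicator (ball 0 r) \<xi> * (1 / cmod \<xi>)))"
        by (auto split: split_indicator)
    qed
  qed
  have "V \<union> ball 0 r = Om" using ball_subset by blast
  then have "set_integrable lborel Om (\<lambda>\<xi>. f \<xi> / of_real ((cmod \<xi>)\<^sup>2))"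
    using set_integrable_Un[OF iV iB] by auto
  then show ?thesis using A unfolding L1a_def f_def by blast
qed

lemma cauchy_transform_if_quadrature:
  assumes Q: "QD0 Om hasinf gs h" and G: "A_space Om hasinf G" "\<And>w. w \<in> frontier Om \<Longrightarrow> of_real (ln ((cmod w)\<^sup>2)) / w = h w + q / w + G w"
    and w: "w \<in> Ext"
  shows "wcauchy V w + of_real (ln (r\<^sup>2)) / w = h w + q / w"
proof -
  have nz: "v \<noteq> 0" if "v \<in> - Om" for v using that zero by auto
  have ExtO: "Ext \<subseteq> - Om" using closure_subset[of Om] by blast
  have hc: "continuous_on (- Om) h" by (rule rational_continuous[OF h])
  have Vc: "continuous_on S (logC V)" for S by (rule continuous_logC[OF V_facts(1,3) r(1)])
  \<comment> \<open>The given exterior point \<open>w\<close> serves as the reference point of the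
    test functions, and \<open>c\<close> is the multiple of \<open>1 / w\<close> they leave
    undetermined.\<close>
  define c where "c = w * (logC V w - h w)"
  have Ext_c: "logC V v = h v + c / v" if v: "v \<in> Ext" for v
  proof -
    define f where "f \<xi> = v / (v - \<xi>) - w / (w - \<xi>)" for \<xi>
    have f: "L1a Om hasinf f" unfolding f_def by (rule test_function_L1a[OF v w])
    have k: "set_integrable lborel V (\<lambda>\<xi>. u * (1 / of_real ((cmod \<xi>)\<^sup>2) / (u - \<xi>)))" for u
      by (intro set_integrable_mult_right set_integrable_log_cauchy_kernel[OF V_facts(1,3) r(1)])
    have feq: "f \<xi> / of_real ((cmod \<xi>)\<^sup>2) = v * (1 / of_real ((cmod \<xi>)\<^sup>2) / (v - \<xi>)) - w * (1 / of_real ((cmod \<xi>)\<^sup>2) / (w - \<xi>))" for \<xi>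
      unfolding f_def by (simp add: diff_divide_distrib mult.commute)
    have "of_real (1 / pi) * (LINT \<xi>:V|lborel. f \<xi> / of_real ((cmod \<xi>)\<^sup>2)) = v * logC V v - w * logC V w"
      unfolding feq set_integral_diff(2)[OF k k] set_integral_mult_right logC_def
      by (simp only: right_diff_distrib mult.left_commute)
    then have 1: "area_pv Om (\<lambda>w. f w / of_real ((cmod w)\<^sup>2)) = v * logC V v - w * logC V w"
      using area_pv_V[OF f L1a_vanishes_at_0[OF f]] by simp
    have kc: "continuous_on (frontier Om) (\<lambda>\<xi>. h \<xi> / (u - \<xi>))" if "u \<in> Ext" for u
    proof -
      have "u - \<xi> \<noteq> 0" if "\<xi> \<in> frontier Om" for \<xi> using that \<open>u \<in> Ext\<close> unfolding frontier_Om by auto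
      then show ?thesis by (intro continuous_intros continuous_on_subset[OF hc frontier_subset_compl]) auto
    qed
    have "bdry_int gs (\<lambda>\<xi>. f \<xi> * h \<xi>) = bdry_int gs (\<lambda>\<xi>. v * (h \<xi> / (v - \<xi>)) + (- w) * (h \<xi> / (w - \<xi>)))"
      by (rule bdry_int_cong) (simp add: f_def left_diff_distrib)
    also have "\<dots> = bdry_int gs (\<lambda>\<xi>. v * (h \<xi> / (v - \<xi>))) + bdry_int gs (\<lambda>\<xi>. (- w) * (h \<xi> / (w - \<xi>)))"
      by (rule bdry_int_add; intro continuous_on_mult_left kc v w)
    also have "\<dots> = v * h v - w * h w"
      unfolding bdry_int_lmul[OF kc[OF v]] bdry_int_lmul[OF kc[OF w]] cauchy_formula_rational[OF h v] cauchy_formula_rational[OF h w] by simp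
    finally have "v * logC V v - w * logC V w = v * h v - w * h w"
      using Q f 1 by (simp add: QD0_def)
    then have "v * (logC V v - h v) = c" by (simp add: c_def algebra_simps)
    moreover have "v \<noteq> 0" using nz ExtO v by blast
    ultimately show ?thesis by (simp add: field_simps)
  qed
  have fr_c: "logC V v = h v + c / v" if "v \<in> frontier Om" for v
    by (rule eq_on_frontier[of "logC V" "\<lambda>v. h v + c / v", OF Vc _ Ext_c that])
       (use nz in \<open>auto intro!: continuous_intros hc\<close>)
  \<comment> \<open>The claim is \<open>k = 0\<close>. Two decompositions of the boundary values of
    the logarithm are compared, one with \<open>G\<close> and one with
    \<open>logC (- Om)\<close>.\<close>
  define k where "k = q - of_real (ln (r\<^sup>2)) - c"
  define F where "F v = logC (- Om) v - G v" for v
  have Fk: "v * F v = k" if v: "v \<in> frontier Om" for v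
  proof -
    have "h v + q / v + G v = h v + c / v + of_real (ln (r\<^sup>2)) / v + logC (- Om) v"
      using logC_V_frontier[OF v] G(2)[OF v] fr_c[OF v] by simp
    then have "F v = k / v" by (simp add: F_def k_def diff_divide_distrib add_divide_distrib algebra_simps)
    then show ?thesis using frontier_nz[OF v] by simp
  qed
  obtain l where l: "hasinf \<Longrightarrow> (G \<longlongrightarrow> l) at_infinity" using A_space_limit[OF G(1)] by blast
  obtain l' where l': "hasinf \<Longrightarrow> (logC (- Om) \<longlongrightarrow> l') at_infinity" using A_space_limit[OF logC_compl_A_space] by blast
  have Fh: "F holomorphic_on Om" and Fc: "continuous_on (closure Om) F"
    using G(1) logC_compl_A_space unfolding F_def A_space_def by (auto intro!: holomorphic_intros continuous_intros)
  have Fl: "(F \<longlongrightarrow> l' - l) at_infinity" if hasinf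
    unfolding F_def by (intro tendsto_diff l l' that)
  text \<open>\<open>u\<close> vanishes on the boundary, so by Cauchy's formula it is constant, hence zero; at the origin this says \<open>k = 0\<close>.\<close>
  define u where "u \<xi> = (\<xi> * F \<xi> - k) / (\<xi> - w)" for \<xi>
  have nw: "\<xi> - w \<noteq> 0" if "\<xi> \<in> closure Om" for \<xi> using that w by auto
  \<comment> \<open>The divisor \<open>\<xi> - w\<close> compensates the growth of the factor \<xi>,
    so \<open>u\<close> has a finite limit at infinity and belongs to the space covered by Cauchy's
    formula.\<close>
  have ul: "(u \<longlongrightarrow> l' - l) at_infinity" if hasinf
  proof -
    have wi: "((\<lambda>\<xi>. a / (\<xi> - w)) \<longlongrightarrow> 0) at_infinity" for a
      using tendsto_minus[OF inverse_tendsto_0_at_infinity[of a w]] by (simp add: minus_divide_right)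
    have "((\<lambda>\<xi>. (1 + w / (\<xi> - w)) * F \<xi> - k / (\<xi> - w)) \<longlongrightarrow> (1 + 0) * (l' - l) - 0) at_infinity"
      by (intro tendsto_intros wi Fl that)
    moreover have "\<forall>\<^sub>F \<xi> in at_infinity. (1 + w / (\<xi> - w)) * F \<xi> - k / (\<xi> - w) = u \<xi>"
    proof -
      have "(1 + w / (\<xi> - w)) * F \<xi> - k / (\<xi> - w) = u \<xi>" if "cmod w + 1 \<le> cmod \<xi>" for \<xi>
      proof -
        have "\<xi> - w \<noteq> 0" using that by auto
        then have "1 + w / (\<xi> - w) = \<xi> / (\<xi> - w)" by (simp add: field_simps)
        then show ?thesis by (simp add: u_def diff_divide_distrib)
      qed
      then show ?thesis unfolding eventually_at_infinity by blast
    qed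
    ultimately show ?thesis by (simp add: Lim_transform_eventually)
  qed
  have uA: "A_space Om hasinf u"
  proof (rule A_spaceI[OF _ _ ul])
    show "u holomorphic_on Om" unfolding u_def
      using nw closure_subset[of Om] by (intro holomorphic_intros Fh) auto
    show "continuous_on (closure Om) u" unfolding u_def using nw by (intro continuous_intros Fc) auto
  qed
  define L where "L = (if hasinf then l' - l else 0)"
  have uL: "u \<xi> = L" if \<xi>: "\<xi> \<in> Om" for \<xi>
  proof -
    have "bdry_int gs (\<lambda>v. u v / (v - \<xi>)) = bdry_int gs (\<lambda>v. 0)"
      by (rule bdry_int_cong) (simp add: u_def Fk)
    then have "bdry_int gs (\<lambda>v. u v / (v - \<xi>)) = 0" by (simp add: bdry_int_def)
    then show ?thesis using cauchy_formula_A_space[OF uA ul \<xi>] by (simp add: L_def)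
  qed
  \<comment> \<open>The domain is nonempty and misses \<open>w\<close>, and the plane is connected.
    A boundary point is needed to compare the constant value of \<open>u\<close> with its zero
    boundary values.\<close>
  have "frontier Om \<noteq> {}"
  proof -
    have "UNIV \<inter> frontier Om \<noteq> {}"
      by (rule connected_Int_frontier) (use Om_ne w ExtO in auto)
    then show ?thesis by simp
  qed
  then obtain p where p: "p \<in> frontier Om" by blast
  have "u p = L"
    by (rule continuous_constant_on_closure[OF _ uL]) (use uA p in \<open>auto simp: A_space_def frontier_Om\<close>)
  moreover have "u p = 0" using p by (simp add: u_def Fk)
  \<comment> \<open>At the origin the term with \<open>F\<close> drops out and \<open>u 0\<close> is
    \<open>k / w\<close>.\<close>
  ultimately have "u 0 = 0" using uL[OF zero] by simp
  moreover have "w \<noteq> 0" using nz ExtO w by blast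
  ultimately have "k = 0" by (simp add: u_def)
  then have "q = c + of_real (ln (r\<^sup>2))" by (simp add: k_def algebra_simps)
  then show ?thesis using Ext_c[OF w] by (simp add: wcauchy_V add_divide_distrib)
qed

end

end

theorem mainTheorem8:
  fixes Om :: "complex set" and hasinf :: bool and gs :: "(real \<Rightarrow> complex) list"
    and h :: "complex \<Rightarrow> complex" and r :: real
  assumes dom: "sphere_domain Om hasinf"
    and rect: "boundary_cycle Om hasinf gs"
    and hrat: "if hasinf then Rat_on Om hasinf h else Rat0_on Om hasinf h"
    and rpos: "0 < r"
    and rdist: "\<forall>z\<in>frontier Om. r < cmod z"
  shows "(0 \<notin> Om \<longrightarrow>
            (QD0 Om hasinf gs h \<longleftrightarrow> (\<forall>w\<in>- closure Om. wcauchy Om w = h w)))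
       \<and> (\<forall>q::complex. 0 \<in> Om \<longrightarrow> residue h 0 = 0 \<longrightarrow>
            (QD0q Om hasinf gs h q \<longleftrightarrow>
              (\<forall>w\<in>- closure Om. wcauchy (Om - ball 0 r) w + of_real (ln (r\<^sup>2)) / w
                                 = h w + q / w)))"
proof -
  interpret quadrature_setup Om hasinf gs using dom rect by unfold_locales
  show ?thesis
  proof (intro conjI impI allI)
    assume "0 \<notin> Om"
    then show "QD0 Om hasinf gs h \<longleftrightarrow> (\<forall>w\<in>- closure Om. wcauchy Om w = h w)"
      by (rule quadrature_iff_outside_0[OF hrat])
  next
    fix q assume zero: "0 \<in> Om" and res: "residue h 0 = 0"
    show "QD0q Om hasinf gs h q \<longleftrightarrow>
       (\<forall>w\<in>- closure Om. wcauchy (Om - ball 0 r) w + of_real (ln (r\<^sup>2)) / w = h w + q / w)"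
    proof
      assume "QD0q Om hasinf gs h q"
      then show "\<forall>w\<in>- closure Om. wcauchy (Om - ball 0 r) w + of_real (ln (r\<^sup>2)) / w = h w + q / w"
        using cauchy_transform_if_quadrature[OF hrat zero rpos rdist] unfolding QD0q_def by blast
    next
      assume "\<forall>w\<in>- closure Om. wcauchy (Om - ball 0 r) w + of_real (ln (r\<^sup>2)) / w = h w + q / w"
      then show "QD0q Om hasinf gs h q"
        using quadrature_if_cauchy_transform[OF hrat zero rpos rdist, of q] zero res unfolding QD0q_def by blast
    qed
  qed
qed

end
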